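(* Let $L>0$, $\Omega=(0,L)^2$, $R>0$, $U\in\mathbb{R}$, $f\in L^2(\Omega)$, and let $\sigma:\overline{\Omega}\to\mathbb{R}$ be a measurable function with $\sigma_m\le\sigma(x)\le\sigma_M$ for all $x\in\overline{\Omega}$, for some constants $\sigma_m,\sigma_M>0$. Let $\Phi\in V^c$ and $\Phi_h\in V_h^c$ be the solutions of $$a(\Phi,v)=L(v)\ \ \text{for all } v\in V^c,\qquad a(\Phi_h,v_h)=L(v_h)\ \ \text{for all } v_h\in V_h^c,$$ respectively, where $V_h^c$ is the continuous piecewise linear finite element subspace of $V^c$. If $\Phi\in H^2(\Omega)$, then $$|\Phi-\Phi_h|_{1,\Omega}\le C\,h\,\|\Phi\|_{2,\Omega},$$ with a constant $C>0$ independent of $h$, $\Phi$, $f$ and $U$. Furthermore, when the $H^2$ regularity result holds, i.e. $\Phi\in H^2(\Omega)$ and $\|\Phi\|_{2,\Omega}\le C_{\mathrm{reg}}\|f\|_{0,\Omega}$ for a constant $C_{\mathrm{reg}}$, then $$|\Phi-\Phi_h|_{1,\Omega}\le C'\,h\,\|f\|_{0,\Omega},$$ with a constant $C'>0$ independent of $h$, $\Phi$, $f$ and $U$ except through $C_{\mathrm{reg}}$.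
   Context: Write $\Gamma_1=\{(x,y)\in\partial\Omega: x=0\}$, $\Gamma_3=\{(x,y)\in\partial\Omega: x=L\}$, and let $|\Gamma_1|=L$ be the length of $\Gamma_1$. Boundary values are understood in the sense of traces. Let $$V^c=\{\Phi\in H^1(\Omega): \Phi|_{\Gamma_1}\text{ is a constant function},\ \Phi|_{\Gamma_3}=0\},$$ where the constant on $\Gamma_1$ is not prescribed. Define, for $\Phi,v\in V^c$, $$a(\Phi,v)=\int_\Omega \sigma\nabla\Phi\cdot\nabla v\,dx+\frac{1}{|\Gamma_1|R}\int_{\Gamma_1}\Phi v\,ds,\qquad L(v)=\int_\Omega f v\,dx+\frac{U}{|\Gamma_1|R}\int_{\Gamma_1}v\,ds.$$ (The symbol $L(\cdot)$ for the functional is distinct from the side length $L$.) $\mathcal{T}^h$ denotes a uniform triangular mesh of $\Omega$ with mesh size $h$: $\overline\Omega$ is divided into $M\times M$ congruent squares, each split into two triangles by a diagonal, all diagonals being parallel, with $h=L/M$. The finite element space is $$V_h^c=\{\Phi_h\in C(\overline\Omega)\cap V^c: \Phi_h|_{\mathcal K}\in P_1(\mathcal K)\ \text{for all } \mathcal K\in\mathcal T^h\},$$ where $P_1(\mathcal K)$ is the space of polynomials of degree at most $1$ on $\mathcal K$. $\|\cdot\|_{0,\Omega}$ is the $L^2(\Omega)$ norm, $|v|_{1,\Omega}=\|\nabla v\|_{0,\Omega}$ is the $H^1$ semi-norm, and $\|\cdot\|_{2,\Omega}$ is the $H^2(\Omega)$ norm. *)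

theory Defs
  imports "HOL-Analysis.Analysis"
begin

section \<open>Square-integrable functions\<close>

definition square_integrable :: "'a measure \<Rightarrow> ('a \<Rightarrow> real) \<Rightarrow> bool" where
  "square_integrable M u \<longleftrightarrow> u \<in> borel_measurable M \<and> integrable M (\<lambda>x. (u x)\<^sup>2)"

definition L2_norm :: "'a measure \<Rightarrow> ('a \<Rightarrow> real) \<Rightarrow> real" where
  "L2_norm M u = sqrt (LINT x|M. (u x)\<^sup>2)"


section \<open>Weak derivatives and Sobolev spaces\<close>

primrec C_k :: "nat \<Rightarrow> ('a::euclidean_space \<Rightarrow> real) \<Rightarrow> bool" where
  "C_k 0 u \<longleftrightarrow> continuous_on UNIV u"
| "C_k (Suc k) u \<longleftrightarrow> (\<forall>x. u differentiable (at x)) \<and>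
     (\<forall>b\<in>Basis. C_k k (\<lambda>x. frechet_derivative u (at x) b))"

definition test_functions :: "'a::euclidean_space set \<Rightarrow> ('a \<Rightarrow> real) set" where
  "test_functions S = {\<phi>. (\<forall>k. C_k k \<phi>) \<and> (\<exists>K. compact K \<and> K \<subseteq> S \<and> (\<forall>x. x \<notin> K \<longrightarrow> \<phi> x = 0))}"

definition locally_integrable :: "'a::euclidean_space set \<Rightarrow> ('a \<Rightarrow> real) \<Rightarrow> bool" where
  "locally_integrable S u \<longleftrightarrow> (\<forall>K. compact K \<and> K \<subseteq> S \<longrightarrow> u absolutely_integrable_on K)"

text \<open>Elements of function spaces on an open set \<open>S\<close> are represented by total functions;
  their values outside \<open>S\<close> (and on null sets) play no role.\<close>

definition has_weak_partial ::
    "'a::euclidean_space set \<Rightarrow> 'a \<Rightarrow> ('a \<Rightarrow> real) \<Rightarrow> ('a \<Rightarrow> real) \<Rightarrow> bool" where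
  "has_weak_partial S b u g \<longleftrightarrow> locally_integrable S u \<and> locally_integrable S g \<and>
     (\<forall>\<phi>\<in>test_functions S.
        (LINT x|lebesgue_on S. u x * frechet_derivative \<phi> (at x) b)
        = - (LINT x|lebesgue_on S. g x * \<phi> x))"

text \<open>A weak derivative is unique only almost everywhere; a representative is chosen.\<close>

definition weak_partial :: "'a::euclidean_space set \<Rightarrow> 'a \<Rightarrow> ('a \<Rightarrow> real) \<Rightarrow> 'a \<Rightarrow> real" where
  "weak_partial S b u = (SOME g. has_weak_partial S b u g)"

definition weak_grad :: "'a::euclidean_space set \<Rightarrow> ('a \<Rightarrow> real) \<Rightarrow> 'a \<Rightarrow> 'a" where
  "weak_grad S u x = (\<Sum>b\<in>Basis. weak_partial S b u x *\<^sub>R b)"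

definition H1 :: "'a::euclidean_space set \<Rightarrow> ('a \<Rightarrow> real) set" where
  "H1 S = {u. square_integrable (lebesgue_on S) u \<and>
     (\<forall>b\<in>Basis. \<exists>g. has_weak_partial S b u g \<and> square_integrable (lebesgue_on S) g)}"

definition H1_seminorm :: "'a::euclidean_space set \<Rightarrow> ('a \<Rightarrow> real) \<Rightarrow> real" where
  "H1_seminorm S u = L2_norm (lebesgue_on S) (\<lambda>x. norm (weak_grad S u x))"

definition H1_norm :: "'a::euclidean_space set \<Rightarrow> ('a \<Rightarrow> real) \<Rightarrow> real" where
  "H1_norm S u = sqrt ((L2_norm (lebesgue_on S) u)\<^sup>2 + (H1_seminorm S u)\<^sup>2)"

definition H2 :: "'a::euclidean_space set \<Rightarrow> ('a \<Rightarrow> real) set" where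
  "H2 S = {u \<in> H1 S. \<forall>b\<in>Basis. weak_partial S b u \<in> H1 S}"

text \<open>The second-order part is the \<open>L\<^sup>2\<close> norm of the full Hessian, so each mixed derivative
  is counted twice.\<close>

definition H2_norm :: "'a::euclidean_space set \<Rightarrow> ('a \<Rightarrow> real) \<Rightarrow> real" where
  "H2_norm S u = sqrt ((H1_norm S u)\<^sup>2 + (\<Sum>b\<in>Basis. (H1_seminorm S (weak_partial S b u))\<^sup>2))"


section \<open>Traces\<close>

text \<open>For a bounded Lipschitz domain \<open>S\<close> and a surface measure \<open>\<mu>\<close> on (a part of) its boundary,
  the trace operator is the continuous extension to \<open>H1 S\<close>, with values in \<open>L\<^sup>2(\<mu>)\<close>, of the
  restriction map on functions that are \<open>C\<^sup>1\<close> up to the boundary, the latter being taken as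
  restrictions of \<open>C\<^sup>1\<close> functions on the whole space. The relation below is its graph, with
  functions in \<open>L\<^sup>2(\<mu>)\<close> identified \<open>\<mu>\<close>-almost everywhere.\<close>

definition has_trace ::
    "'a::euclidean_space set \<Rightarrow> 'a measure \<Rightarrow> ('a \<Rightarrow> real) \<Rightarrow> ('a \<Rightarrow> real) \<Rightarrow> bool" where
  "has_trace S \<mu> u g \<longleftrightarrow> u \<in> H1 S \<and> square_integrable \<mu> g \<and>
     (\<exists>w. (\<forall>n::nat. C_k 1 (w n)) \<and>
        (\<lambda>n. H1_norm S (\<lambda>x. w n x - u x)) \<longlonglongrightarrow> 0 \<and>
        (\<lambda>n. L2_norm \<mu> (\<lambda>x. w n x - g x)) \<longlonglongrightarrow> 0)"

definition boundary_trace :: "'a::euclidean_space set \<Rightarrow> 'a measure \<Rightarrow> ('a \<Rightarrow> real) \<Rightarrow> 'a \<Rightarrow> real" where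
  "boundary_trace S \<mu> u = (SOME g. has_trace S \<mu> u g)"


section \<open>The boundary value problem on the square\<close>

definition \<Omega> :: "real \<Rightarrow> (real \<times> real) set" where
  "\<Omega> L = {0<..<L} \<times> {0<..<L}"

definition \<Gamma>\<^sub>1 :: "real \<Rightarrow> (real \<times> real) set" where
  "\<Gamma>\<^sub>1 L = {p \<in> frontier (\<Omega> L). fst p = 0}"

definition \<Gamma>\<^sub>3 :: "real \<Rightarrow> (real \<times> real) set" where
  "\<Gamma>\<^sub>3 L = {p \<in> frontier (\<Omega> L). fst p = L}"

text \<open>Arc length on the vertical line \<open>x = a\<close>.\<close>

definition vertical_length :: "real \<Rightarrow> (real \<times> real) measure" where
  "vertical_length a = distr lborel borel (\<lambda>y. (a, y))"

definition ds\<^sub>1 :: "real \<Rightarrow> (real \<times> real) measure" where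
  "ds\<^sub>1 L = restrict_space (vertical_length 0) (\<Gamma>\<^sub>1 L)"

definition ds\<^sub>3 :: "real \<Rightarrow> (real \<times> real) measure" where
  "ds\<^sub>3 L = restrict_space (vertical_length L) (\<Gamma>\<^sub>3 L)"

definition length\<^sub>1 :: "real \<Rightarrow> real" where
  "length\<^sub>1 L = measure (ds\<^sub>1 L) (\<Gamma>\<^sub>1 L)"

lemma \<Gamma>\<^sub>1_eq: "L > 0 \<Longrightarrow> \<Gamma>\<^sub>1 L = {0} \<times> {0..L}"
  by (auto simp: \<Gamma>\<^sub>1_def \<Omega>_def frontier_def closure_Times interior_Times)

lemma \<Gamma>\<^sub>3_eq: "L > 0 \<Longrightarrow> \<Gamma>\<^sub>3 L = {L} \<times> {0..L}"
  by (auto simp: \<Gamma>\<^sub>3_def \<Omega>_def frontier_def closure_Times interior_Times)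

lemma length\<^sub>1_eq:
  assumes "L > 0"
  shows "length\<^sub>1 L = L"
proof -
  have closed: "closed ({0::real} \<times> {0..L})"
    by (intro closed_Times) auto
  have pre: "Pair (0::real) -` ({0} \<times> {0..L}) = {0..L}"
    by auto
  have meas: "Pair (0::real) \<in> borel_measurable (lborel :: real measure)"
    by measurable
  show ?thesis
    using assms closed meas
    by (simp add: length\<^sub>1_def ds\<^sub>1_def vertical_length_def \<Gamma>\<^sub>1_eq measure_restrict_space
        measure_distr borel_closed pre)
qed

definition Vc :: "real \<Rightarrow> (real \<times> real \<Rightarrow> real) set" where
  "Vc L = {\<Phi> \<in> H1 (\<Omega> L). (\<exists>c. has_trace (\<Omega> L) (ds\<^sub>1 L) \<Phi> (\<lambda>_. c)) \<and>
     has_trace (\<Omega> L) (ds\<^sub>3 L) \<Phi> (\<lambda>_. 0)}"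

definition bilinear_form :: "real \<Rightarrow> real \<Rightarrow> (real \<times> real \<Rightarrow> real) \<Rightarrow>
    (real \<times> real \<Rightarrow> real) \<Rightarrow> (real \<times> real \<Rightarrow> real) \<Rightarrow> real" where
  "bilinear_form L R \<sigma> \<Phi> v =
     (LINT x|lebesgue_on (\<Omega> L). \<sigma> x * (weak_grad (\<Omega> L) \<Phi> x \<bullet> weak_grad (\<Omega> L) v x))
     + 1 / (length\<^sub>1 L * R)
       * (LINT x|ds\<^sub>1 L. boundary_trace (\<Omega> L) (ds\<^sub>1 L) \<Phi> x * boundary_trace (\<Omega> L) (ds\<^sub>1 L) v x)"

definition load :: "real \<Rightarrow> real \<Rightarrow> real \<Rightarrow> (real \<times> real \<Rightarrow> real) \<Rightarrow>
    (real \<times> real \<Rightarrow> real) \<Rightarrow> real" where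
  "load L R U f v =
     (LINT x|lebesgue_on (\<Omega> L). f x * v x)
     + U / (length\<^sub>1 L * R) * (LINT x|ds\<^sub>1 L. boundary_trace (\<Omega> L) (ds\<^sub>1 L) v x)"

definition solves_in :: "(real \<times> real \<Rightarrow> real) set \<Rightarrow> real \<Rightarrow> real \<Rightarrow> (real \<times> real \<Rightarrow> real) \<Rightarrow>
    real \<Rightarrow> (real \<times> real \<Rightarrow> real) \<Rightarrow> (real \<times> real \<Rightarrow> real) \<Rightarrow> bool" where
  "solves_in V L R \<sigma> U f \<Phi> \<longleftrightarrow> \<Phi> \<in> V \<and> (\<forall>v\<in>V. bilinear_form L R \<sigma> \<Phi> v = load L R U f v)"


section \<open>Uniform meshes and the finite element space\<close>

definition node :: "real \<Rightarrow> nat \<Rightarrow> nat \<Rightarrow> real \<times> real" where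
  "node h i j = (real i * h, real j * h)"

definition mesh_up :: "real \<Rightarrow> nat \<Rightarrow> (real \<times> real) set set" where
  "mesh_up h M = (\<Union>i<M. \<Union>j<M.
     {convex hull {node h i j, node h (i + 1) j, node h (i + 1) (j + 1)},
      convex hull {node h i j, node h i (j + 1), node h (i + 1) (j + 1)}})"

definition mesh_down :: "real \<Rightarrow> nat \<Rightarrow> (real \<times> real) set set" where
  "mesh_down h M = (\<Union>i<M. \<Union>j<M.
     {convex hull {node h (i + 1) j, node h i (j + 1), node h i j},
      convex hull {node h (i + 1) j, node h i (j + 1), node h (i + 1) (j + 1)}})"

definition uniform_mesh :: "real \<Rightarrow> nat \<Rightarrow> (real \<times> real) set set \<Rightarrow> bool" where
  "uniform_mesh L M T \<longleftrightarrow> M \<ge> 1 \<and> (T = mesh_up (L / real M) M \<or> T = mesh_down (L / real M) M)"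

definition P1_on :: "(real \<times> real) set \<Rightarrow> (real \<times> real \<Rightarrow> real) \<Rightarrow> bool" where
  "P1_on K u \<longleftrightarrow> (\<exists>c0 c1 c2. \<forall>(x, y)\<in>K. u (x, y) = c0 + c1 * x + c2 * y)"

definition Vhc :: "real \<Rightarrow> (real \<times> real) set set \<Rightarrow> (real \<times> real \<Rightarrow> real) set" where
  "Vhc L T = {\<Phi>h \<in> Vc L. continuous_on (closure (\<Omega> L)) \<Phi>h \<and> (\<forall>K\<in>T. P1_on K \<Phi>h)}"

end

theory Submission
  imports Defs
begin

text \<open>Galerkin orthogonality is tested with an interpolant that has the same constant on the left side
  as the exact solution; the boundary terms then combine to a square with the good sign, so that the error is
  bounded by the interpolation error in the seminorm.

  The interpolant is the nodal one, but no embedding of \<open>H\<^sup>2\<close> into the continuous functions is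
  used. A square-integrable function with weak derivative \<open>g\<close> in the second variable has the form
  \<open>p(x) + \<integral>\<^sub>0\<^sup>y g(x, t) dt\<close>; applied to the first partial derivatives of \<open>\<Phi>\<close>, and combined with the
  trace conditions, this yields \<open>\<Phi>(x, y) = c + \<integral>\<^sub>0\<^sup>x (p(s) + \<integral>\<^sub>0\<^sup>y q(s, t) dt) ds\<close>, where \<open>q\<close> is the
  mixed derivative. The right-hand side is defined everywhere and supplies the nodal values. The
  difference quotients of the interpolant along mesh edges are then means of traces of first
  derivatives, which differ from these derivatives on a cell by integrals of second derivatives over
  that cell.\<close>

section \<open>Smooth functions and product test functions\<close>

text \<open>If the solution and the interpolant have the constant c on the left side and the
  discrete solution has d, the boundary form of the error against interpolant minus discrete
  solution is (c - d)^2 / \<open>R\<close>. Hence only the ratio of the bounds of \<sigma> enters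
  the constant.

  Two features of the definitions shape the rest. Weak derivatives and traces are choices,
  determined only almost everywhere, while interpolation needs values at single points. The argument
  therefore runs on Borel representatives and Fubini, and statements valid for almost every height
  reach every height because integrals depend continuously on their end points. Moreover a trace is
  a limit of continuously differentiable functions on the plane, so the interpolant needs such
  approximations too. Averages over small squares supply them, and local affinity almost everywhere
  identifies the limits of their derivatives.

  Constants: a cell costs 2 h^2 times its squared second derivatives; two candidate edges make it 4
  h^2; the mixed derivative, counted for both directions, makes it 8 h^2; and 3 exceeds the square
  root of 8.\<close>

lemma C_k_const [simp]: "C_k k (\<lambda>_::'a::euclidean_space. c)"
  by (induction k arbitrary: c) auto

lemma C_k_SucD: "C_k (Suc k) u \<Longrightarrow> C_k k u"
proof (induction k arbitrary: u)
  case 0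
  then show ?case
    by (auto intro!: continuous_at_imp_continuous_on differentiable_imp_continuous_within)
next
  case (Suc k)
  then show ?case
    by (metis C_k.simps(2))
qed

lemma C_k_add: "C_k k u \<Longrightarrow> C_k k v \<Longrightarrow> C_k k (\<lambda>x. u x + v x)"
proof (induction k arbitrary: u v)
  case (Suc k)
  then have diff: "u differentiable (at x)" "v differentiable (at x)" for x
    by auto
  have "frechet_derivative (\<lambda>x. u x + v x) (at x) b
      = frechet_derivative u (at x) b + frechet_derivative v (at x) b" for x b
  proof -
    have "((\<lambda>x. u x + v x) has_derivative
        (\<lambda>b. frechet_derivative u (at x) b + frechet_derivative v (at x) b)) (at x)"
      using diff[of x] by (intro has_derivative_add) (auto simp: frechet_derivative_works)
    from frechet_derivative_at[OF this] show ?thesis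
      by metis
  qed
  then show ?case
    using Suc diff by auto
qed (auto intro: continuous_intros)

lemma frechet_derivative_times:
  assumes "u differentiable (at x)" "v differentiable (at x)"
  shows "frechet_derivative (\<lambda>x. u x * v x :: real) (at x) b
      = u x * frechet_derivative v (at x) b + frechet_derivative u (at x) b * v x"
proof -
  have "((\<lambda>x. u x * v x) has_derivative
      (\<lambda>b. u x * frechet_derivative v (at x) b + frechet_derivative u (at x) b * v x)) (at x)"
    using assms by (intro has_derivative_mult) (auto simp: frechet_derivative_works)
  from frechet_derivative_at[OF this] show ?thesis
    by metis
qed

lemma C_k_mult: "C_k k u \<Longrightarrow> C_k k v \<Longrightarrow> C_k k (\<lambda>x. u x * v x)"
proof (induction k arbitrary: u v)
  case 0
  then show ?case
    by (auto intro: continuous_intros)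
next
  case (Suc k)
  then have diff: "u differentiable (at x)" "v differentiable (at x)" for x
    by auto
  moreover have "C_k k u" "C_k k v"
    using Suc.prems C_k_SucD by blast+
  ultimately show ?case
    using Suc diff by (auto intro!: C_k_add simp: frechet_derivative_times)
qed

lemma C_k_cmult: "C_k k u \<Longrightarrow> C_k k (\<lambda>x. c * u x)"
  by (intro C_k_mult C_k_const)

lemma frechet_derivative_real_1:
  assumes "(f has_real_derivative d) (at x)"
  shows "frechet_derivative f (at x) 1 = d"
  using frechet_derivative_at[OF assms[unfolded has_field_derivative_def]] by (metis mult.right_neutral)

lemma C_k_real_SucI:
  fixes f :: "real \<Rightarrow> real"
  assumes "\<And>x. (f has_real_derivative f' x) (at x)" "C_k k f'"
  shows "C_k (Suc k) f"
proof -
  have "(\<lambda>x. frechet_derivative f (at x) 1) = f'"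
    using frechet_derivative_real_1[OF assms(1)] by auto
  moreover have "f differentiable (at x)" for x
    using assms(1)[of x] by (auto simp: has_field_derivative_def differentiable_def)
  ultimately show ?thesis
    using assms(2) by simp
qed

lemma C_k_real_SucE:
  fixes f :: "real \<Rightarrow> real"
  assumes "C_k (Suc k) f"
  shows "(f has_real_derivative deriv f x) (at x)" "C_k k (deriv f)"
proof -
  have d: "(f has_real_derivative deriv f x) (at x)" for x
    using assms by (auto simp: DERIV_deriv_iff_real_differentiable)
  have "(\<lambda>x. frechet_derivative f (at x) 1) = deriv f"
    using frechet_derivative_real_1[OF d] by auto
  then show "C_k k (deriv f)"
    using assms by auto
  show "(f has_real_derivative deriv f x) (at x)"
    by (rule d)
qed

lemma C_k_affine:
  fixes f :: "real \<Rightarrow> real"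
  shows "C_k k f \<Longrightarrow> C_k k (\<lambda>x. f (c * x + d))"
proof (induction k arbitrary: f)
  case 0
  then show ?case
    by (auto intro!: continuous_intros continuous_on_compose2[of UNIV f])
next
  case (Suc k)
  show ?case
  proof (rule C_k_real_SucI)
    show "((\<lambda>x. f (c * x + d)) has_real_derivative c * deriv f (c * x + d)) (at x)" for x
    proof -
      have "((\<lambda>x. c * x + d) has_real_derivative c) (at x)"
        by (auto intro!: derivative_eq_intros)
      from DERIV_chain2[OF C_k_real_SucE(1)[OF Suc.prems] this] show ?thesis
        by (simp add: mult.commute)
    qed
    show "C_k k (\<lambda>x. c * deriv f (c * x + d))"
      using Suc C_k_real_SucE(2)[OF Suc.prems] by (intro C_k_cmult) auto
  qed
qed

lemma has_derivative_compose_fst: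
  fixes f :: "real \<Rightarrow> real"
  assumes "(f has_real_derivative d) (at (fst p))"
  shows "((\<lambda>p::real \<times> real. f (fst p)) has_derivative (\<lambda>v. d * fst v)) (at p)"
  using has_derivative_compose[OF has_derivative_fst[OF has_derivative_ident] assms[unfolded has_field_derivative_def]]
  by simp

lemma has_derivative_compose_snd:
  fixes f :: "real \<Rightarrow> real"
  assumes "(f has_real_derivative d) (at (snd p))"
  shows "((\<lambda>p::real \<times> real. f (snd p)) has_derivative (\<lambda>v. d * snd v)) (at p)"
  using has_derivative_compose[OF has_derivative_snd[OF has_derivative_ident] assms[unfolded has_field_derivative_def]]
  by simp

lemma Basis_real_prod: "(Basis :: (real \<times> real) set) = {(1, 0), (0, 1)}"
  by (auto simp: Basis_prod_def)

lemma C_k_fst: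
  fixes f :: "real \<Rightarrow> real"
  shows "C_k k f \<Longrightarrow> C_k k (\<lambda>p::real \<times> real. f (fst p))"
proof (induction k arbitrary: f)
  case 0
  then show ?case
    by (auto intro!: continuous_intros continuous_on_compose2[of UNIV f])
next
  case (Suc k)
  have D: "((\<lambda>p::real \<times> real. f (fst p)) has_derivative (\<lambda>v. deriv f (fst p) * fst v)) (at p)" for p
    by (intro has_derivative_compose_fst C_k_real_SucE(1)[OF Suc.prems])
  have "frechet_derivative (\<lambda>p::real \<times> real. f (fst p)) (at p) = (\<lambda>v. deriv f (fst p) * fst v)" for p
    using frechet_derivative_at[OF D] by metis
  moreover have "(\<lambda>p::real \<times> real. f (fst p)) differentiable (at p)" for p
    using D differentiable_def by blast
  ultimately show ?case
    using Suc.IH[OF C_k_real_SucE(2)[OF Suc.prems]] by (auto simp: Basis_real_prod)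
qed

lemma C_k_snd:
  fixes f :: "real \<Rightarrow> real"
  shows "C_k k f \<Longrightarrow> C_k k (\<lambda>p::real \<times> real. f (snd p))"
proof (induction k arbitrary: f)
  case 0
  then show ?case
    by (auto intro!: continuous_intros continuous_on_compose2[of UNIV f])
next
  case (Suc k)
  have D: "((\<lambda>p::real \<times> real. f (snd p)) has_derivative (\<lambda>v. deriv f (snd p) * snd v)) (at p)" for p
    by (intro has_derivative_compose_snd C_k_real_SucE(1)[OF Suc.prems])
  have "frechet_derivative (\<lambda>p::real \<times> real. f (snd p)) (at p) = (\<lambda>v. deriv f (snd p) * snd v)" for p
    using frechet_derivative_at[OF D] by metis
  moreover have "(\<lambda>p::real \<times> real. f (snd p)) differentiable (at p)" for p
    using D differentiable_def by blast
  ultimately show ?case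
    using Suc.IH[OF C_k_real_SucE(2)[OF Suc.prems]] by (auto simp: Basis_real_prod)
qed

subsection \<open>The function exp (-1/x)\<close>

text \<open>The polynomial factor makes this family closed under differentiation, so that smoothness
  follows by induction on the order with \<open>p\<close> arbitrary.\<close>

definition flat :: "real poly \<Rightarrow> real \<Rightarrow> real" where
  "flat p x = (if x \<le> 0 then 0 else poly p (inverse x) * exp (- inverse x))"

lemma poly_times_exp_tendsto_0: "((\<lambda>z. poly p z * exp (- z)) \<longlongrightarrow> (0::real)) at_top"
proof -
  have "((\<lambda>z. \<Sum>i\<le>degree p. coeff p i * (z ^ i / exp z)) \<longlongrightarrow> (\<Sum>i\<le>degree p. coeff p i * 0)) at_top"
    by (intro tendsto_intros tendsto_power_div_exp_0)
  moreover have "(\<lambda>z. \<Sum>i\<le>degree p. coeff p i * (z ^ i / exp z)) = (\<lambda>z. poly p z * exp (- z))"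
    by (auto simp: poly_altdef exp_minus sum_distrib_right divide_inverse mult.assoc)
  ultimately show ?thesis
    by simp
qed

lemma flat_tendsto_0: "(flat p \<longlongrightarrow> 0) (at 0)"
proof (rule filterlim_split_at)
  have "eventually (\<lambda>x. flat p x = 0) (at_left 0)"
    by (auto simp: flat_def eventually_at_filter)
  then show "(flat p \<longlongrightarrow> 0) (at_left 0)"
    by (rule tendsto_eventually)
  have "((\<lambda>x. poly p (inverse x) * exp (- inverse x)) \<longlongrightarrow> 0) (at_right 0)"
    by (rule filterlim_compose[OF poly_times_exp_tendsto_0 filterlim_inverse_at_top_right])
  moreover have "eventually (\<lambda>x. poly p (inverse x) * exp (- inverse x) = flat p x) (at_right 0)"
    by (auto simp: flat_def eventually_at_filter)
  ultimately show "(flat p \<longlongrightarrow> 0) (at_right 0)"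
    by (rule Lim_transform_eventually)
qed

text \<open>With z = 1 / x the chain rule turns p(z) exp (- z) into z^2 (p(z) - p'(z)) exp (- z),
  which is where the new polynomial comes from.\<close>

lemma flat_has_derivative:
  "(flat p has_real_derivative flat ([:0, 0, 1:] * (p - pderiv p)) x) (at x)"
proof -
  consider "x < 0" | "x > 0" | "x = 0" by linarith
  then show ?thesis
  proof cases
    case 1
    have "((\<lambda>_. 0) has_real_derivative 0) (at x)"
      by simp
    moreover have "eventually (\<lambda>x. 0 = flat p x) (nhds x)"
      using eventually_nhds_in_open[of "{..<0}" x] 1
      by (auto elim!: eventually_mono simp: flat_def)
    ultimately show ?thesis
      using 1 DERIV_cong_ev[of x x "\<lambda>_. 0" "flat p" 0 0] by (simp add: flat_def)
  next
    case 2
    have "((\<lambda>x. poly p (inverse x) * exp (- inverse x)) has_real_derivative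
        flat ([:0, 0, 1:] * (p - pderiv p)) x) (at x)"
      using 2 by (auto intro!: derivative_eq_intros DERIV_chain2[OF poly_DERIV]
          simp: flat_def algebra_simps power2_eq_square)
    moreover have "eventually (\<lambda>x. poly p (inverse x) * exp (- inverse x) = flat p x) (nhds x)"
      using eventually_nhds_in_open[of "{0<..}" x] 2
      by (auto elim!: eventually_mono simp: flat_def)
    ultimately show ?thesis
      using DERIV_cong_ev[OF refl _ refl, of "\<lambda>x. poly p (inverse x) * exp (- inverse x)" "flat p"]
      by blast
  next
    case 3
    \<comment> \<open>The difference quotient at 0 is \<open>flat\<close> of the polynomial z p(z),
      which tends to 0 as well.\<close>
    have "((\<lambda>y. flat p y / y) \<longlongrightarrow> 0) (at 0)"
      using flat_tendsto_0[of "[:0, 1:] * p"]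
      by (rule Lim_transform_eventually)
         (auto simp: eventually_at_filter flat_def field_simps)
    then show ?thesis
      using 3 by (simp add: has_field_derivative_iff flat_def)
  qed
qed

lemma C_k_flat: "C_k k (flat p)"
proof (induction k arbitrary: p)
  case 0
  then show ?case
    using flat_has_derivative DERIV_continuous
    by (auto intro!: continuous_at_imp_continuous_on) blast
next
  case (Suc k)
  then show ?case
    using C_k_real_SucI[OF flat_has_derivative] by blast
qed

subsection \<open>Bumps\<close>

definition bumps :: "real \<Rightarrow> (real \<Rightarrow> real) set" where
  "bumps L = {\<alpha>. (\<forall>k. C_k k \<alpha>) \<and> (\<exists>a b. 0 < a \<and> b < L \<and> (\<forall>x. x \<notin> {a..b} \<longrightarrow> \<alpha> x = 0))}"

text \<open>As \<open>n\<close> grows these functions, with values in [0, 1], tend pointwise to the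
  indicator of the open interval from \<open>a\<close> to \<open>b\<close>, because exp (- 1 / (n
  x)) tends to 1 for x > 0. Dominated convergence then recovers integrals over boxes from integrals
  against smooth functions.\<close>

definition bump :: "real \<Rightarrow> real \<Rightarrow> nat \<Rightarrow> real \<Rightarrow> real" where
  "bump a b n x = flat 1 (real n * (x - a)) * flat 1 (real n * (b - x))"

lemma C_k_bump: "C_k k (bump a b n)"
proof -
  have "C_k k (\<lambda>x. flat 1 (real n * x + (- real n * a)) * flat 1 ((- real n) * x + real n * b))"
    by (intro C_k_mult C_k_affine C_k_flat)
  then show ?thesis
    by (simp add: bump_def[abs_def] algebra_simps)
qed

lemma bump_in_bumps: "0 < a \<Longrightarrow> b < L \<Longrightarrow> bump a b n \<in> bumps L"
proof -
  assume "0 < a" "b < L"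
  moreover have "bump a b n x = 0" if "x \<notin> {a..b}" for x
    using that by (auto simp: bump_def flat_def mult_le_0_iff)
  ultimately show ?thesis
    unfolding bumps_def using C_k_bump by blast
qed

lemma flat_1_bounds: "0 \<le> flat 1 x" "flat 1 x \<le> 1"
  by (auto simp: flat_def)

lemma bump_bounds: "0 \<le> bump a b n x" "bump a b n x \<le> 1"
  by (auto simp: bump_def flat_1_bounds mult_le_one)

lemma flat_1_LIMSEQ: "x > 0 \<Longrightarrow> (\<lambda>n. flat 1 (real n * x)) \<longlonglongrightarrow> 1"
proof -
  assume x: "x > 0"
  have "(\<lambda>n. exp (- inverse (real n) * inverse x)) \<longlonglongrightarrow> exp (- 0 * inverse x)"
    by (intro tendsto_intros lim_inverse_n)
  moreover have "eventually (\<lambda>n. exp (- inverse (real n) * inverse x) = flat 1 (real n * x)) sequentially"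
    using eventually_gt_at_top[of 0]
    by eventually_elim (use x in \<open>auto simp: flat_def mult_le_0_iff\<close>)
  ultimately show ?thesis
    using Lim_transform_eventually by fastforce
qed

lemma bump_LIMSEQ: "(\<lambda>n. bump a b n x) \<longlonglongrightarrow> indicator {a<..<b} x"
proof (cases "x \<in> {a<..<b}")
  case True
  then have "(\<lambda>n. bump a b n x) \<longlonglongrightarrow> 1 * 1"
    unfolding bump_def by (intro tendsto_mult flat_1_LIMSEQ) auto
  then show ?thesis
    using True by simp
next
  case False
  then have "bump a b n x = 0" for n
    by (auto simp: bump_def flat_def mult_le_0_iff zero_less_mult_iff)
  then show ?thesis
    using False by simp
qed

lemma bumps_DERIV: "\<alpha> \<in> bumps L \<Longrightarrow> (\<alpha> has_real_derivative deriv \<alpha> x) (at x)"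
  by (auto simp: bumps_def intro: C_k_real_SucE(1))

lemma bumps_continuous: "\<alpha> \<in> bumps L \<Longrightarrow> continuous_on S \<alpha>"
  by (meson DERIV_isCont bumps_DERIV continuous_at_imp_continuous_on)

lemma bumps_zero: "\<alpha> \<in> bumps L \<Longrightarrow> x \<le> 0 \<or> L \<le> x \<Longrightarrow> \<alpha> x = 0"
  by (fastforce simp: bumps_def)

lemma bumps_deriv:
  assumes "\<alpha> \<in> bumps L"
  shows "deriv \<alpha> \<in> bumps L"
proof -
  obtain a b where ab: "0 < a" "b < L" "\<And>x. x \<notin> {a..b} \<Longrightarrow> \<alpha> x = 0" and C: "\<And>k. C_k k \<alpha>"
    using assms by (auto simp: bumps_def)
  have "deriv \<alpha> x = 0" if "x \<notin> {a..b}" for x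
  proof -
    have "eventually (\<lambda>x. 0 = \<alpha> x) (nhds x)"
      using eventually_nhds_in_open[of "- {a..b}" x] that ab(3)
      by (auto elim!: eventually_mono simp: open_Compl)
    then have "(\<alpha> has_real_derivative 0) (at x)"
      using DERIV_cong_ev[of x x "\<lambda>_. 0" \<alpha> 0 0] by simp
    then show ?thesis
      by (rule DERIV_imp_deriv)
  qed
  moreover have "C_k k (deriv \<alpha>)" for k
    using C_k_real_SucE(2)[OF C] .
  ultimately show ?thesis
    using ab by (auto simp: bumps_def)
qed

lemma bumps_bounded:
  assumes "\<alpha> \<in> bumps L"
  obtains B where "\<And>x. \<bar>\<alpha> x\<bar> \<le> B" "B \<ge> 0"
proof -
  have "bounded (\<alpha> ` {0..L})"
    by (intro compact_imp_bounded compact_continuous_image bumps_continuous[OF assms]) auto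
  then obtain B where B: "\<And>x. x \<in> {0..L} \<Longrightarrow> \<bar>\<alpha> x\<bar> \<le> B"
    by (metis bounded_iff imageI real_norm_def)
  have "\<bar>\<alpha> x\<bar> \<le> \<bar>B\<bar>" for x
    by (cases "x \<in> {0..L}") (use B[of x] bumps_zero[OF assms, of x] in auto)
  then show ?thesis
    using that[of "\<bar>B\<bar>"] by auto
qed

lemma bumps_borel [measurable_dest]: "\<alpha> \<in> bumps L \<Longrightarrow> \<alpha> \<in> borel_measurable borel"
  by (intro borel_measurable_continuous_onI bumps_continuous)

lemma bumps_integrable: 
  assumes "\<alpha> \<in> bumps L"
  shows "integrable lborel \<alpha>"
proof -
  have "integrable lborel (\<lambda>x. indicator {0..L} x *\<^sub>R \<alpha> x)"
    by (intro borel_integrable_compact bumps_continuous[OF assms]) auto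
  moreover have "(\<lambda>x. indicator {0..L} x *\<^sub>R \<alpha> x) = \<alpha>"
    using bumps_zero[OF assms] by (auto simp: fun_eq_iff indicator_def) (meson linear)+
  ultimately show ?thesis
    by simp
qed

lemma bumps_diff_cmult:
  assumes "\<alpha> \<in> bumps L" "\<beta> \<in> bumps L"
  shows "(\<lambda>x. \<alpha> x - c * \<beta> x) \<in> bumps L"
proof -
  obtain a b where ab: "0 < a" "b < L" "\<And>x. x \<notin> {a..b} \<Longrightarrow> \<alpha> x = 0" and C: "\<And>k. C_k k \<alpha>"
    using assms by (auto simp: bumps_def)
  obtain a' b' where ab': "0 < a'" "b' < L" "\<And>x. x \<notin> {a'..b'} \<Longrightarrow> \<beta> x = 0" and C': "\<And>k. C_k k \<beta>"
    using assms by (auto simp: bumps_def)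
  have "C_k k (\<lambda>x. \<alpha> x + (- c) * \<beta> x)" for k
    by (intro C_k_add C_k_cmult C C')
  moreover have "\<alpha> x - c * \<beta> x = 0" if "x \<notin> {min a a'..max b b'}" for x
  proof -
    have "x \<notin> {a..b}" "x \<notin> {a'..b'}"
      using that by auto
    then show ?thesis
      using ab(3) ab'(3) by simp
  qed
  moreover have "0 < min a a'" "max b b' < L"
    using ab ab' by auto
  ultimately show ?thesis
    unfolding bumps_def by (simp del: max_less_iff_conj min_less_iff_conj) blast
qed

text \<open>The primitive that vanishes at 0 is zero to the left of the support of \<beta>, and to
  the right of it equals the total mass. Mean zero is thus exactly what keeps its support
  compact.\<close>

lemma bumps_antiderivative:
  assumes "\<beta> \<in> bumps L" "(\<integral>y. \<beta> y \<partial>lborel) = 0"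
  obtains \<theta> where "\<theta> \<in> bumps L" "deriv \<theta> = \<beta>"
proof -
  obtain a b where ab: "0 < a" "b < L" "\<And>x. x \<notin> {a..b} \<Longrightarrow> \<beta> x = 0" and C: "\<And>k. C_k k \<beta>"
    using assms by (auto simp: bumps_def)
  obtain F where F: "\<And>x. (F has_real_derivative \<beta> x) (at x)"
    using einterval_antiderivative[of "-\<infinity>" \<infinity> \<beta>] bumps_continuous[OF assms(1), of UNIV]
    by (auto simp: continuous_on_eq_continuous_at has_real_derivative_iff_has_vector_derivative)
  define \<theta> where "\<theta> x = F x - F 0" for x
  have \<theta>: "(\<theta> has_real_derivative \<beta> x) (at x)" for x
    unfolding \<theta>_def by (auto intro!: derivative_eq_intros F)
  have int: "(\<integral>x. \<beta> x * indicator {u..v} x \<partial>lborel) = \<theta> v - \<theta> u" if "u \<le> v" for u v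
    by (rule integral_FTC_Icc_real[OF that \<theta>])
       (metis assms(1) bumps_continuous continuous_on_eq_continuous_at open_UNIV UNIV_I)
  have left: "\<theta> x = 0" if x: "x < a" for x
  proof (cases "x \<le> 0")
    case True
    have "(\<lambda>t. \<beta> t * indicator {x..0} t) = (\<lambda>t. 0)"
      using ab by (auto simp: indicator_def fun_eq_iff)
    then show ?thesis
      using int[OF True] by (simp add: \<theta>_def)
  next
    case False
    have "(\<lambda>t. \<beta> t * indicator {0..x} t) = (\<lambda>t. 0)"
      using ab x by (auto simp: indicator_def fun_eq_iff)
    then show ?thesis
      using int[of 0 x] False by (simp add: \<theta>_def)
  qed
  have right: "\<theta> x = 0" if "x > b" for x
  proof (cases "x < a")
    case False
    \<comment> \<open>The point a/2 lies to the left of the support, where \<theta> is already known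
      to vanish, and still inside the positive axis.\<close>
    have "\<beta> t = 0" if "t \<notin> {a/2..x}" for t
    proof -
      have "t \<notin> {a..b}"
        using that ab \<open>x > b\<close> by auto
      then show ?thesis
        by (rule ab)
    qed
    then have "(\<lambda>t. \<beta> t * indicator {a/2..x} t) = \<beta>"
      by (auto simp: indicator_def fun_eq_iff)
    then show ?thesis
      using int[of "a/2" x] False left[of "a/2"] assms(2) ab by simp
  qed (use left in auto)
  have "C_k k \<theta>" for k
    using C_k_real_SucI[OF \<theta> C] C_k_SucD by blast
  then have "\<theta> \<in> bumps L"
    using left right ab(1,2) unfolding bumps_def by (simp add: not_le) (metis linorder_not_le)
  moreover have "deriv \<theta> = \<beta>"
    using DERIV_imp_deriv[OF \<theta>] by auto
  ultimately show ?thesis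
    using that by blast
qed

text \<open>Uniqueness of weak derivatives and the integral representations test only with such
  products; a partial derivative then acts on a single factor, and Fubini separates the
  variables.\<close>

lemma bumps_product:
  assumes "\<alpha> \<in> bumps L" "\<beta> \<in> bumps L"
  shows "(\<lambda>p. \<alpha> (fst p) * \<beta> (snd p)) \<in> test_functions (\<Omega> L)"
    "frechet_derivative (\<lambda>p. \<alpha> (fst p) * \<beta> (snd p)) (at p) (1, 0) = deriv \<alpha> (fst p) * \<beta> (snd p)"
    "frechet_derivative (\<lambda>p. \<alpha> (fst p) * \<beta> (snd p)) (at p) (0, 1) = \<alpha> (fst p) * deriv \<beta> (snd p)"
proof -
  obtain a b where ab: "0 < a" "b < L" "\<And>x. x \<notin> {a..b} \<Longrightarrow> \<alpha> x = 0" and C: "\<And>k. C_k k \<alpha>"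
    using assms by (auto simp: bumps_def)
  obtain a' b' where ab': "0 < a'" "b' < L" "\<And>x. x \<notin> {a'..b'} \<Longrightarrow> \<beta> x = 0" and C': "\<And>k. C_k k \<beta>"
    using assms by (auto simp: bumps_def)
  have "C_k k (\<lambda>p. \<alpha> (fst p) * \<beta> (snd p))" for k
    by (intro C_k_mult C_k_fst C_k_snd C C')
  moreover have "compact ({a..b} \<times> {a'..b'})" "{a..b} \<times> {a'..b'} \<subseteq> \<Omega> L"
    using ab ab' by (auto simp: \<Omega>_def intro: compact_Times)
  moreover have "\<forall>p. p \<notin> {a..b} \<times> {a'..b'} \<longrightarrow> \<alpha> (fst p) * \<beta> (snd p) = 0"
    using ab ab' by (auto simp: mem_Times_iff)
  ultimately show "(\<lambda>p. \<alpha> (fst p) * \<beta> (snd p)) \<in> test_functions (\<Omega> L)"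
    unfolding test_functions_def by blast
  have "((\<lambda>p. \<alpha> (fst p) * \<beta> (snd p)) has_derivative
      (\<lambda>v. \<alpha> (fst p) * (deriv \<beta> (snd p) * snd v) + deriv \<alpha> (fst p) * fst v * \<beta> (snd p))) (at p)"
    by (intro has_derivative_mult has_derivative_compose_fst has_derivative_compose_snd
        bumps_DERIV[OF assms(1)] bumps_DERIV[OF assms(2)])
  from frechet_derivative_at[OF this]
  have "frechet_derivative (\<lambda>p. \<alpha> (fst p) * \<beta> (snd p)) (at p) =
      (\<lambda>v. \<alpha> (fst p) * (deriv \<beta> (snd p) * snd v) + deriv \<alpha> (fst p) * fst v * \<beta> (snd p))"
    by simp
  then show "frechet_derivative (\<lambda>p. \<alpha> (fst p) * \<beta> (snd p)) (at p) (1, 0) = deriv \<alpha> (fst p) * \<beta> (snd p)"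
    "frechet_derivative (\<lambda>p. \<alpha> (fst p) * \<beta> (snd p)) (at p) (0, 1) = \<alpha> (fst p) * deriv \<beta> (snd p)"
    by auto
qed

section \<open>The fundamental lemma of the calculus of variations\<close>

text \<open>Dynkin argument: boxes are stable under intersection and generate the Borel sets, and
  vanishing of the integral passes to complements and disjoint unions. A function whose integral
  over every Borel set is zero vanishes almost everywhere.\<close>

lemma AE_zero_if_zero_on_boxes:
  fixes f :: "'a::euclidean_space \<Rightarrow> real"
  assumes f: "integrable lborel f"
    and box: "\<And>a b. (\<integral>x. indicator (box a b) x * f x \<partial>lborel) = 0"
  shows "AE x in lborel. f x = 0"
proof (rule sigma_finite_measure.density_zero[OF sigma_finite_lborel f])
  have [measurable]: "f \<in> borel_measurable borel"
    using f by auto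
  have int: "integrable lborel (\<lambda>x. indicator A x * f x)" if "A \<in> sets borel" for A
    using integrable_mult_indicator[of A lborel f] f that by simp
  \<comment> \<open>Passing to complements requires the integral over the whole space, obtained as
    the limit over growing boxes.\<close>
  have all: "(\<integral>x. f x \<partial>lborel) = 0"
  proof -
    define B where "B n = box (- real n *\<^sub>R One) (real n *\<^sub>R One :: 'a)" for n :: nat
    have "(\<lambda>n. \<integral>x. indicator (B n) x * f x \<partial>lborel) \<longlonglongrightarrow> (\<integral>x. f x \<partial>lborel)"
    proof (rule integral_dominated_convergence[where w = "\<lambda>x. \<bar>f x\<bar>"])
      show "AE x in lborel. (\<lambda>n. indicator (B n) x * f x) \<longlonglongrightarrow> f x"
      proof (rule AE_I2)
        fix x :: 'a
        obtain n0 :: nat where n0: "norm x < real n0"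
          using reals_Archimedean2 by blast
        have "eventually (\<lambda>n. f x = indicator (B n) x * f x) sequentially"
          using eventually_ge_at_top[of n0]
        proof eventually_elim
          case (elim n)
          have "\<bar>x \<bullet> i\<bar> < real n" if "i \<in> Basis" for i
            using Basis_le_norm[OF that, of x] n0 elim by simp
          then have "x \<in> B n"
            by (auto simp: B_def mem_box abs_less_iff) (metis minus_less_iff)
          then show ?case
            by simp
        qed
        then show "(\<lambda>n. indicator (B n) x * f x) \<longlonglongrightarrow> f x"
          by (rule tendsto_eventually[OF eventually_mono]) simp
      qed
    qed (use f in \<open>auto simp: indicator_def B_def\<close>)
    then show ?thesis
      using box by (auto simp: B_def intro: LIMSEQ_unique)
  qed
  fix A :: "'a set"
  assume "A \<in> sets lborel"
  then have A: "A \<in> sigma_sets UNIV (range (\<lambda>(a, b). box a b))"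
    by (simp add: borel_eq_box)
  have "Int_stable (range (\<lambda>(a, b). box a (b::'a)))"
  proof (rule Int_stableI)
    fix A B :: "'a set"
    assume "A \<in> range (\<lambda>(a, b). box a b)" "B \<in> range (\<lambda>(a, b). box a b)"
    then show "A \<inter> B \<in> range (\<lambda>(a, b). box a b)"
      by (auto simp: box_Int_box image_def) blast
  qed
  moreover have "range (\<lambda>(a, b). box a (b::'a)) \<subseteq> Pow UNIV"
    by simp
  ultimately have "A \<in> sets borel \<and> (\<integral>x. indicator A x * f x \<partial>lborel) = 0"
    using A
  proof (induction rule: sigma_sets_induct_disjoint)
    case (basic A)
    then show ?case
      using box by auto
  next
    case (compl A)
    then have [measurable]: "A \<in> sets borel" by simp
    have "(\<integral>x. indicator (UNIV - A) x * f x \<partial>lborel) = (\<integral>x. f x - indicator A x * f x \<partial>lborel)"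
      by (intro Bochner_Integration.integral_cong) (auto simp: indicator_def)
    then show ?case
      using compl all f int[of A] by auto
  next
    case (union A)
    have "(\<integral>x\<in>(\<Union>i. A i). f x \<partial>lborel) = (\<Sum>i. \<integral>x\<in>A i. f x \<partial>lborel)"
      using union by (intro lebesgue_integral_countable_add)
        (auto simp: set_integrable_def disjoint_family_on_def intro!: int)
    then show ?case
      using union by (auto simp: set_lebesgue_integral_def)
  qed auto
  then show "set_lebesgue_integral lborel A f = 0"
    by (simp add: set_lebesgue_integral_def)
qed

text \<open>A compact exhaustion of the open square: local integrability gives information on each
  member, and every point of the square eventually belongs to them.\<close>

definition core :: "real \<Rightarrow> nat \<Rightarrow> (real \<times> real) set" where
  "core L m = {inverse (real (Suc m))..L - inverse (real (Suc m))} \<times> {inverse (real (Suc m))..L - inverse (real (Suc m))}"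

lemma compact_core: "compact (core L m)"
  by (auto simp: core_def intro: compact_Times)

lemma core_subset: "core L m \<subseteq> \<Omega> L"
proof -
  define r where "r = inverse (real (Suc m))"
  have "0 < r"
    by (simp add: r_def)
  then show ?thesis
    unfolding core_def \<Omega>_def r_def[symmetric] by (intro Sigma_mono) auto
qed

lemma eventually_core:
  assumes "p \<in> \<Omega> L"
  shows "eventually (\<lambda>m. p \<in> core L m) sequentially"
proof -
  define e where "e = min (min (fst p) (L - fst p)) (min (snd p) (L - snd p))"
  have "e > 0"
    using assms by (auto simp: e_def \<Omega>_def)
  then have "eventually (\<lambda>m. inverse (real (Suc m)) < e) sequentially"
    using LIMSEQ_inverse_real_of_nat order_tendstoD(2) by blast
  then show ?thesis
    by eventually_elim (auto simp: core_def e_def mem_Times_iff)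
qed

lemma open_square: "open (\<Omega> L)"
  by (auto simp: \<Omega>_def intro: open_Times)

lemma square_borel [measurable, simp]: "\<Omega> L \<in> sets borel"
  by (simp add: open_square)

lemma box_real_prod: "box (a, c) (b, d) = {a<..<b::real} \<times> {c<..<d::real}"
  by (auto simp: box_def Basis_real_prod)

lemma fst_borel [measurable]:
  "fst \<in> borel \<rightarrow>\<^sub>M (borel :: 'a::second_countable_topology measure)"
  by (intro borel_measurable_continuous_onI continuous_on_fst continuous_on_id)

lemma snd_borel [measurable]:
  "snd \<in> borel \<rightarrow>\<^sub>M (borel :: 'a::second_countable_topology measure)"
  by (intro borel_measurable_continuous_onI continuous_on_snd continuous_on_id)

text \<open>Products of bumps converge to indicators of boxes that stay away from the boundary, so
  the integral of \<open>h\<close> over each such box vanishes. Local integrability prevents a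
  direct use of all boxes, whence the detour through squares with a margin.\<close>

lemma fundamental_lemma:
  fixes h :: "real \<times> real \<Rightarrow> real"
  assumes h [measurable]: "h \<in> borel_measurable borel"
    and int: "\<And>K. compact K \<Longrightarrow> K \<subseteq> \<Omega> L \<Longrightarrow> integrable lborel (\<lambda>p. indicator K p * h p)"
    and zero: "\<And>\<alpha> \<beta>. \<alpha> \<in> bumps L \<Longrightarrow> \<beta> \<in> bumps L \<Longrightarrow> (\<integral>p. h p * (\<alpha> (fst p) * \<beta> (snd p)) \<partial>lborel) = 0"
  shows "AE p in lborel. p \<in> \<Omega> L \<longrightarrow> h p = 0"
proof -
  have box0: "(\<integral>p. indicator ({a<..<b} \<times> {c<..<d}) p * h p \<partial>lborel) = 0"
    if "0 < a" "b < L" "0 < c" "d < L" for a b c d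
  proof -
    let ?K = "{a..b} \<times> {c..d}"
    have K: "compact ?K" "?K \<subseteq> \<Omega> L"
      using that by (auto simp: \<Omega>_def intro: compact_Times)
    have [measurable]: "bump a b n \<in> borel_measurable borel" for a b n
      using C_k_bump[of 0] by (auto intro: borel_measurable_continuous_onI)
    have "(\<lambda>n. \<integral>p. h p * (bump a b n (fst p) * bump c d n (snd p)) \<partial>lborel)
      \<longlonglongrightarrow> (\<integral>p. h p * (indicator {a<..<b} (fst p) * indicator {c<..<d} (snd p)) \<partial>lborel)"
    proof (rule integral_dominated_convergence[where w = "\<lambda>p. \<bar>indicator ?K p * h p\<bar>"])
      show "AE p in lborel. (\<lambda>n. h p * (bump a b n (fst p) * bump c d n (snd p)))
        \<longlonglongrightarrow> h p * (indicator {a<..<b} (fst p) * indicator {c<..<d} (snd p))"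
        by (intro AE_I2 tendsto_intros bump_LIMSEQ)
      show "AE p in lborel. norm (h p * (bump a b n (fst p) * bump c d n (snd p)))
        \<le> \<bar>indicator ?K p * h p\<bar>" for n
      proof (rule AE_I2)
        fix p :: "real \<times> real"
        show "norm (h p * (bump a b n (fst p) * bump c d n (snd p))) \<le> \<bar>indicator ?K p * h p\<bar>"
        proof (cases "p \<in> ?K")
          case True
          then show ?thesis
            using bump_bounds[of a b n "fst p"] bump_bounds[of c d n "snd p"]
            by (auto simp: abs_mult intro!: mult_left_le mult_le_one)
        next
          case False
          then have "bump a b n (fst p) * bump c d n (snd p) = 0"
            by (auto simp: mem_Times_iff bump_def flat_def mult_le_0_iff not_le)
          then show ?thesis
            by (simp only:) simp
        qed
      qed
    qed (use int[OF K] in \<open>measurable, auto\<close>)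
    moreover have "(\<integral>p. h p * (bump a b n (fst p) * bump c d n (snd p)) \<partial>lborel) = 0" for n
      using that by (intro zero bump_in_bumps)
    ultimately have "(\<integral>p. h p * (indicator {a<..<b} (fst p) * indicator {c<..<d} (snd p)) \<partial>lborel) = 0"
      using LIMSEQ_unique[OF _ tendsto_const] by simp
    then show ?thesis
      by (simp add: indicator_times mult.commute)
  qed
  have "AE p in lborel. indicator (core L m) p * h p = 0" for m
  proof -
    \<comment> \<open>\<open>?B\<close> lies between two consecutive cores: it contains
      \<open>core L m\<close>, so vanishing there suffices, and it is contained in
      \<open>core L (Suc m)\<close>, where \<open>h\<close> is integrable.\<close>
    define r where "r = inverse (real (Suc (Suc m)))"
    let ?r = r
    let ?B = "{?r<..<L - ?r} \<times> {?r<..<L - ?r}"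
    have "r < inverse (real (Suc m))"
      by (simp add: field_simps r_def)
    moreover define r' where "r' = inverse (real (Suc m))"
    ultimately have sub: "core L m \<subseteq> ?B" "?B \<subseteq> core L (Suc m)"
      unfolding core_def r_def[symmetric] r'_def[symmetric] by auto
    have "AE p in lborel. indicator ?B p * h p = 0"
    proof (rule AE_zero_if_zero_on_boxes)
      have "integrable lborel (\<lambda>p. indicator ?B p *\<^sub>R (indicator (core L (Suc m)) p * h p))"
        using int[OF compact_core core_subset] by (intro integrable_mult_indicator) (auto simp: open_Times)
      moreover have "(\<lambda>p. indicator ?B p *\<^sub>R (indicator (core L (Suc m)) p * h p)) = (\<lambda>p. indicator ?B p * h p)"
        using sub(2) by (force simp: indicator_def fun_eq_iff)
      ultimately show "integrable lborel (\<lambda>p. indicator ?B p * h p)"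
        by simp
      fix u v :: "real \<times> real"
      obtain a c b d where uv: "u = (a, c)" "v = (b, d)"
        by (metis surj_pair)
      have r: "0 < r" by (simp add: r_def)
      \<comment> \<open>An arbitrary box cut down to \<open>?B\<close> is again a box, now with
        distance at least \<open>?r\<close> from the boundary, so \<open>box0\<close>
        applies.\<close>
      have "indicator (box u v) p * (indicator ?B p * h p)
        = indicator ({max a ?r<..<min b (L - ?r)} \<times> {max c ?r<..<min d (L - ?r)}) p * h p" for p
        by (auto simp: uv box_real_prod indicator_def)
      then show "(\<integral>p. indicator (box u v) p * (indicator ?B p * h p) \<partial>lborel) = 0"
        using box0[of "max a ?r" "min b (L - ?r)" "max c ?r" "min d (L - ?r)"] r
        by (simp only: less_max_iff_disj min_less_iff_disj) simp
    qed
    then show ?thesis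
      by eventually_elim (use sub(1) in \<open>auto simp: indicator_def\<close>)
  qed
  then have "AE p in lborel. \<forall>m. indicator (core L m) p * h p = 0"
    unfolding AE_all_countable by blast
  then show ?thesis
  proof eventually_elim
    case (elim p)
    then show ?case
      using eventually_happens[OF eventually_core[of p L]] by (auto simp: indicator_def)
  qed
qed

section \<open>Borel representatives\<close>

text \<open>The function spaces speak of Lebesgue measurable functions on the square, whereas Fubini
  and the exchange of coordinates are used for Borel functions on the plane. Extension by zero turns
  integrals over the square into integrals over the plane.\<close>

definition borel_rep :: "'a::euclidean_space set \<Rightarrow> ('a \<Rightarrow> real) \<Rightarrow> ('a \<Rightarrow> real) \<Rightarrow> bool" where
  "borel_rep S f g \<longleftrightarrow> g \<in> borel_measurable borel \<and> (\<forall>x. x \<notin> S \<longrightarrow> g x = 0) \<and>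
     f \<in> borel_measurable (lebesgue_on S) \<and> (AE x in lborel. x \<in> S \<longrightarrow> f x = g x)"

lemma AE_lebesgue_on:
  fixes S :: "'a::euclidean_space set"
  assumes "S \<in> sets borel"
  shows "(AE x in lebesgue_on S. P x) \<longleftrightarrow> (AE x in lborel. x \<in> S \<longrightarrow> P x)"
  using assms by (simp add: AE_restrict_space_iff AE_completion_iff)

lemma borel_rep_exists:
  fixes S :: "'a::euclidean_space set"
  assumes S: "S \<in> sets borel" and f: "f \<in> borel_measurable (lebesgue_on S)"
  obtains g where "borel_rep S f g"
proof -
  have "(\<lambda>x. f x * indicator S x) \<in> borel_measurable lebesgue"
    using f S by (subst (asm) borel_measurable_restrict_space_iff) (auto simp: mult.commute)
  then obtain g where g: "g \<in> borel_measurable lborel" "AE x in lborel. f x * indicator S x = g x"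
    using completion_ex_borel_measurable_real by blast
  have "borel_rep S f (\<lambda>x. g x * indicator S x)"
    unfolding borel_rep_def using g S f by auto
  then show ?thesis
    using that by blast
qed

lemma borel_rep_AE: "borel_rep S f g \<Longrightarrow> S \<in> sets borel \<Longrightarrow> AE x in lebesgue_on S. f x = g x"
  by (simp add: borel_rep_def AE_lebesgue_on)

lemma integral_lebesgue_on_borel:
  fixes g :: "'a::euclidean_space \<Rightarrow> real"
  assumes S: "S \<in> sets borel" and g: "g \<in> borel_measurable borel" "\<And>x. x \<notin> S \<Longrightarrow> g x = 0"
  shows "(LINT x|lebesgue_on S. g x) = (LINT x|lborel. g x)"
    and "integrable (lebesgue_on S) g \<longleftrightarrow> integrable lborel g"
proof -
  have eq: "(\<lambda>x. indicator S x * g x) = g"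
    using g(2) by (auto simp: indicator_def fun_eq_iff)
  have S': "S \<inter> space lebesgue \<in> sets lebesgue"
    using S by auto
  show "(LINT x|lebesgue_on S. g x) = (LINT x|lborel. g x)"
    using integral_restrict_space[OF S', of g] g(1) by (simp add: eq integral_completion)
  show "integrable (lebesgue_on S) g \<longleftrightarrow> integrable lborel g"
    using integrable_restrict_space[OF S', of g] g(1) by (simp add: eq integrable_completion)
qed

lemma borel_rep_integral:
  assumes S: "S \<in> sets borel" and r: "borel_rep S f g"
  shows "(LINT x|lebesgue_on S. f x) = (LINT x|lborel. g x)"
    and "integrable (lebesgue_on S) f \<longleftrightarrow> integrable lborel g"
proof -
  have m: "f \<in> borel_measurable (lebesgue_on S)" "g \<in> borel_measurable (lebesgue_on S)"
    using r by (auto simp: borel_rep_def intro!: measurable_restrict_space1 measurable_completion)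
  have "(LINT x|lebesgue_on S. f x) = (LINT x|lebesgue_on S. g x)"
    by (intro integral_cong_AE m borel_rep_AE r S)
  then show "(LINT x|lebesgue_on S. f x) = (LINT x|lborel. g x)"
    using integral_lebesgue_on_borel(1)[OF S, of g] r by (simp add: borel_rep_def)
  have "integrable (lebesgue_on S) f \<longleftrightarrow> integrable (lebesgue_on S) g"
    by (intro integrable_cong_AE m borel_rep_AE r S)
  then show "integrable (lebesgue_on S) f \<longleftrightarrow> integrable lborel g"
    using integral_lebesgue_on_borel(2)[OF S, of g] r by (simp add: borel_rep_def)
qed

lemma borel_rep_diff: "borel_rep S f g \<Longrightarrow> borel_rep S f' g' \<Longrightarrow> borel_rep S (\<lambda>x. f x - f' x) (\<lambda>x. g x - g' x)"
  by (auto simp: borel_rep_def)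

lemma borel_rep_power2: "borel_rep S f g \<Longrightarrow> borel_rep S (\<lambda>x. (f x)\<^sup>2) (\<lambda>x. (g x)\<^sup>2)"
  by (auto simp: borel_rep_def)

lemma borel_rep_mult:
  assumes "borel_rep S f g" "\<phi> \<in> borel_measurable borel"
  shows "borel_rep S (\<lambda>x. f x * \<phi> x) (\<lambda>x. g x * \<phi> x)"
proof -
  have "\<phi> \<in> borel_measurable (lebesgue_on S)"
    using assms(2) by (intro measurable_restrict_space1 measurable_completion) auto
  then show ?thesis
    using assms by (auto simp: borel_rep_def)
qed

lemma borel_rep_borel:
  assumes "S \<in> sets borel" "\<phi> \<in> borel_measurable borel"
  shows "borel_rep S \<phi> (\<lambda>x. indicator S x * \<phi> x)"
proof -
  have "\<phi> \<in> borel_measurable (lebesgue_on S)"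
    using assms(2) by (intro measurable_restrict_space1 measurable_completion) auto
  then show ?thesis
    using assms by (auto simp: borel_rep_def)
qed

section \<open>Weak derivatives\<close>

text \<open>Local integrability only speaks of compact subsets; measurability on the whole open
  square comes from the pointwise limit along the cores.\<close>

lemma locally_integrable_borel_measurable:
  assumes "locally_integrable (\<Omega> L) g"
  shows "g \<in> borel_measurable (lebesgue_on (\<Omega> L))"
proof -
  have "(\<lambda>p. indicator (\<Omega> L) p * g p) \<in> borel_measurable lebesgue"
  proof (rule borel_measurable_LIMSEQ_real)
    show "(\<lambda>m. indicator (core L m) p * g p) \<longlonglongrightarrow> indicator (\<Omega> L) p * g p" for p
    proof (cases "p \<in> \<Omega> L")
      case True
      have "eventually (\<lambda>m. indicator (core L m) p * g p = indicator (\<Omega> L) p * g p) sequentially"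
        by (rule eventually_mono[OF eventually_core[OF True]]) (simp add: True)
      then show ?thesis
        by (rule tendsto_eventually)
    next
      case False
      then have "p \<notin> core L m" for m
        using core_subset by blast
      then show ?thesis
        using False by simp
    qed
    show "(\<lambda>p. indicator (core L m) p * g p) \<in> borel_measurable lebesgue" for m
    proof -
      have "g absolutely_integrable_on core L m"
        using assms compact_core core_subset by (auto simp: locally_integrable_def)
      then show ?thesis
        by (auto simp: set_integrable_def dest: borel_measurable_integrable)
    qed
  qed
  then show ?thesis
    by (subst borel_measurable_restrict_space_iff) auto
qed

lemma locally_integrable_borel_rep:
  assumes g: "locally_integrable (\<Omega> L) g" and r: "borel_rep (\<Omega> L) g g'"
    and K: "compact K" "K \<subseteq> \<Omega> L"
  shows "integrable lborel (\<lambda>p. indicator K p * g' p)"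
proof -
  have i: "integrable lebesgue (\<lambda>p. indicator K p * g p)"
    using assms by (auto simp: locally_integrable_def set_integrable_def)
  have m: "(\<lambda>p. indicator K p * g' p) \<in> borel_measurable lborel"
    using r K(1) by (auto simp: borel_rep_def compact_imp_closed)
  have "AE p in lebesgue. indicator K p * g p = indicator K p * g' p"
    using r K(2) unfolding AE_completion_iff[of "\<lambda>p. indicator K p * g p = indicator K p * g' p"]
    by (auto simp: borel_rep_def elim!: eventually_mono split: split_indicator)
  with i have "integrable lebesgue (\<lambda>p. indicator K p * g' p)"
    using measurable_completion[OF m] by (subst integrable_cong_AE[symmetric]) auto
  then show ?thesis
    using m by (simp add: integrable_completion)
qed

lemma weak_partial_bumps:
  assumes w: "has_weak_partial (\<Omega> L) b u g" and u: "borel_rep (\<Omega> L) u u'" and g: "borel_rep (\<Omega> L) g g'"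
    and \<alpha>: "\<alpha> \<in> bumps L" and \<beta>: "\<beta> \<in> bumps L"
  shows "b = (1, 0) \<Longrightarrow> (\<integral>p. u' p * (deriv \<alpha> (fst p) * \<beta> (snd p)) \<partial>lborel)
      = - (\<integral>p. g' p * (\<alpha> (fst p) * \<beta> (snd p)) \<partial>lborel)"
    and "b = (0, 1) \<Longrightarrow> (\<integral>p. u' p * (\<alpha> (fst p) * deriv \<beta> (snd p)) \<partial>lborel)
      = - (\<integral>p. g' p * (\<alpha> (fst p) * \<beta> (snd p)) \<partial>lborel)"
proof -
  note [measurable] = bumps_borel[OF \<alpha>] bumps_borel[OF \<beta>] bumps_borel[OF bumps_deriv[OF \<alpha>]]
    bumps_borel[OF bumps_deriv[OF \<beta>]]
  have "(LINT x|lebesgue_on (\<Omega> L). u x * frechet_derivative (\<lambda>p. \<alpha> (fst p) * \<beta> (snd p)) (at x) b)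
    = - (LINT x|lebesgue_on (\<Omega> L). g x * (\<alpha> (fst x) * \<beta> (snd x)))"
    using w bumps_product(1)[OF \<alpha> \<beta>] by (auto simp: has_weak_partial_def)
  moreover have "(LINT x|lebesgue_on (\<Omega> L). g x * (\<alpha> (fst x) * \<beta> (snd x)))
    = (\<integral>p. g' p * (\<alpha> (fst p) * \<beta> (snd p)) \<partial>lborel)"
    by (intro borel_rep_integral borel_rep_mult g) auto
  moreover have "(LINT x|lebesgue_on (\<Omega> L). u x * (deriv \<alpha> (fst x) * \<beta> (snd x)))
    = (\<integral>p. u' p * (deriv \<alpha> (fst p) * \<beta> (snd p)) \<partial>lborel)"
    "(LINT x|lebesgue_on (\<Omega> L). u x * (\<alpha> (fst x) * deriv \<beta> (snd x)))
    = (\<integral>p. u' p * (\<alpha> (fst p) * deriv \<beta> (snd p)) \<partial>lborel)"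
    by (intro borel_rep_integral borel_rep_mult u; measurable)+
  ultimately show "b = (1, 0) \<Longrightarrow> (\<integral>p. u' p * (deriv \<alpha> (fst p) * \<beta> (snd p)) \<partial>lborel)
      = - (\<integral>p. g' p * (\<alpha> (fst p) * \<beta> (snd p)) \<partial>lborel)"
    "b = (0, 1) \<Longrightarrow> (\<integral>p. u' p * (\<alpha> (fst p) * deriv \<beta> (snd p)) \<partial>lborel)
      = - (\<integral>p. g' p * (\<alpha> (fst p) * \<beta> (snd p)) \<partial>lborel)"
    by (auto simp: bumps_product[OF \<alpha> \<beta>])
qed

lemma integrable_times_bumps:
  fixes g :: "real \<times> real \<Rightarrow> real"
  assumes \<alpha>: "\<alpha> \<in> bumps L" and \<beta>: "\<beta> \<in> bumps L" and g: "g \<in> borel_measurable borel"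
    and int: "\<And>K. compact K \<Longrightarrow> K \<subseteq> \<Omega> L \<Longrightarrow> integrable lborel (\<lambda>p. indicator K p * g p)"
  shows "integrable lborel (\<lambda>p. g p * (\<alpha> (fst p) * \<beta> (snd p)))"
proof -
  note [measurable] = bumps_borel[OF \<alpha>] bumps_borel[OF \<beta>] g
  obtain a b where ab: "0 < a" "b < L" "\<And>x. x \<notin> {a..b} \<Longrightarrow> \<alpha> x = 0"
    using \<alpha> by (auto simp: bumps_def)
  obtain a' b' where ab': "0 < a'" "b' < L" "\<And>x. x \<notin> {a'..b'} \<Longrightarrow> \<beta> x = 0"
    using \<beta> by (auto simp: bumps_def)
  obtain A where A: "\<And>x. \<bar>\<alpha> x\<bar> \<le> A" "A \<ge> 0" using bumps_bounded[OF \<alpha>] by blast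
  obtain B where B: "\<And>x. \<bar>\<beta> x\<bar> \<le> B" "B \<ge> 0" using bumps_bounded[OF \<beta>] by blast
  let ?K = "{a..b} \<times> {a'..b'}"
  have K: "compact ?K" "?K \<subseteq> \<Omega> L"
    using ab ab' by (auto simp: \<Omega>_def intro: compact_Times)
  show ?thesis
  proof (rule Bochner_Integration.integrable_bound)
    show "integrable lborel (\<lambda>p. (A * B) * (indicator ?K p * g p))"
      by (intro integrable_mult_right int K)
    show "AE p in lborel. norm (g p * (\<alpha> (fst p) * \<beta> (snd p))) \<le> norm (A * B * (indicator ?K p * g p))"
    proof (rule AE_I2)
      fix p :: "real \<times> real"
      show "norm (g p * (\<alpha> (fst p) * \<beta> (snd p))) \<le> norm (A * B * (indicator ?K p * g p))"
      proof (cases "p \<in> ?K")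
        case True
        have "\<bar>\<alpha> (fst p) * \<beta> (snd p)\<bar> \<le> A * B"
          unfolding abs_mult using A B by (intro mult_mono) auto
        then show ?thesis
          using True A B by (simp add: abs_mult mult.commute[of _ "\<bar>g p\<bar>"] mult_left_mono)
      next
        case False
        then have "\<alpha> (fst p) * \<beta> (snd p) = 0"
          using ab(3)[of "fst p"] ab'(3)[of "snd p"] by (auto simp: mem_Times_iff)
        then show ?thesis
          by (simp only:) simp
      qed
    qed
  qed simp
qed

text \<open>Since \<open>weak_partial\<close> is a choice, this is what identifies it with any
  derivative exhibited by hand.\<close>

lemma weak_partial_unique:
  assumes w1: "has_weak_partial (\<Omega> L) b u g1" and w2: "has_weak_partial (\<Omega> L) b u g2" and b: "b \<in> Basis"
  shows "AE p in lebesgue_on (\<Omega> L). g1 p = g2 p"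
proof -
  have l: "locally_integrable (\<Omega> L) u" "locally_integrable (\<Omega> L) g1" "locally_integrable (\<Omega> L) g2"
    using w1 w2 by (auto simp: has_weak_partial_def)
  obtain u' where u': "borel_rep (\<Omega> L) u u'"
    using borel_rep_exists[OF square_borel locally_integrable_borel_measurable[OF l(1)]] .
  obtain g1' where g1': "borel_rep (\<Omega> L) g1 g1'"
    using borel_rep_exists[OF square_borel locally_integrable_borel_measurable[OF l(2)]] .
  obtain g2' where g2': "borel_rep (\<Omega> L) g2 g2'"
    using borel_rep_exists[OF square_borel locally_integrable_borel_measurable[OF l(3)]] .
  have i: "integrable lborel (\<lambda>p. indicator K p * g1' p)" "integrable lborel (\<lambda>p. indicator K p * g2' p)"
    if "compact K" "K \<subseteq> \<Omega> L" for K
    using locally_integrable_borel_rep[OF l(2) g1' that] locally_integrable_borel_rep[OF l(3) g2' that] by auto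
  have m [measurable]: "g1' \<in> borel_measurable borel" "g2' \<in> borel_measurable borel"
    using g1' g2' by (auto simp: borel_rep_def)
  have "AE p in lborel. p \<in> \<Omega> L \<longrightarrow> g1' p - g2' p = 0"
  proof (rule fundamental_lemma)
    fix \<alpha> \<beta> assume ab: "\<alpha> \<in> bumps L" "\<beta> \<in> bumps L"
    have "(\<integral>p. g1' p * (\<alpha> (fst p) * \<beta> (snd p)) \<partial>lborel) = (\<integral>p. g2' p * (\<alpha> (fst p) * \<beta> (snd p)) \<partial>lborel)"
      using b weak_partial_bumps[OF w1 u' g1' ab] weak_partial_bumps[OF w2 u' g2' ab]
      by (auto simp: Basis_real_prod)
    then show "(\<integral>p. (g1' p - g2' p) * (\<alpha> (fst p) * \<beta> (snd p)) \<partial>lborel) = 0"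
      using integrable_times_bumps[OF ab m(1) i(1)] integrable_times_bumps[OF ab m(2) i(2)]
      by (simp add: left_diff_distrib)
  qed (auto simp: right_diff_distrib intro!: i)
  then have "AE p in lborel. p \<in> \<Omega> L \<longrightarrow> g1 p = g2 p"
    using g1' g2' unfolding borel_rep_def by auto
  then show ?thesis
    by (simp add: AE_lebesgue_on)
qed

subsection \<open>Square-integrable functions on the square\<close>

lemma finite_measure_square: "finite_measure (lebesgue_on (\<Omega> L))"
proof (rule finite_measure_lebesgue_on)
  have "bounded (\<Omega> L)"
    by (auto simp: \<Omega>_def intro: bounded_Times)
  then show "\<Omega> L \<in> lmeasurable"
    by (intro bounded_set_imp_lmeasurable) auto
qed

lemma square_integrable_imp_integrable:
  "finite_measure M \<Longrightarrow> square_integrable M u \<Longrightarrow> integrable M u"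
  by (rule finite_measure.square_integrable_imp_integrable) (auto simp: square_integrable_def)

lemma square_integrable_mult:
  assumes "square_integrable M u" "square_integrable M v"
  shows "integrable M (\<lambda>x. u x * v x)"
proof (rule Bochner_Integration.integrable_bound)
  show "integrable M (\<lambda>x. (u x)\<^sup>2 + (v x)\<^sup>2)"
    using assms by (auto simp: square_integrable_def)
  show "AE x in M. norm (u x * v x) \<le> norm ((u x)\<^sup>2 + (v x)\<^sup>2)"
  proof (rule AE_I2)
    fix x
    have "2 * \<bar>u x\<bar> * \<bar>v x\<bar> \<le> \<bar>u x\<bar>\<^sup>2 + \<bar>v x\<bar>\<^sup>2"
      by (rule sum_squares_bound)
    moreover have "0 \<le> \<bar>u x\<bar> * \<bar>v x\<bar>"
      by simp
    ultimately have "\<bar>u x\<bar> * \<bar>v x\<bar> \<le> (u x)\<^sup>2 + (v x)\<^sup>2"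
      unfolding power2_abs mult.assoc by linarith
    then show "norm (u x * v x) \<le> norm ((u x)\<^sup>2 + (v x)\<^sup>2)"
      by (simp add: abs_mult)
  qed
qed (use assms in \<open>auto simp: square_integrable_def\<close>)

lemma square_integrable_diff:
  assumes "square_integrable M u" "square_integrable M v"
  shows "square_integrable M (\<lambda>x. u x - v x)"
proof -
  have "integrable M (\<lambda>x. (u x)\<^sup>2 + (v x)\<^sup>2 - 2 * (u x * v x))"
    using assms square_integrable_mult[OF assms] by (auto simp: square_integrable_def)
  then show ?thesis
    using assms by (auto simp: square_integrable_def power2_diff algebra_simps)
qed

lemma square_integrable_cong_AE:
  assumes "AE x in M. u x = v x" "v \<in> borel_measurable M" "square_integrable M u"
  shows "square_integrable M v"
  using assms unfolding square_integrable_def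
  by (auto intro: integrable_cong_AE_imp[where g = "\<lambda>x. (u x)\<^sup>2"] elim!: eventually_mono)

lemma square_integrable_locally_integrable:
  assumes "square_integrable (lebesgue_on (\<Omega> L)) u"
  shows "locally_integrable (\<Omega> L) u"
  unfolding locally_integrable_def
proof safe
  fix K assume K: "compact K" "K \<subseteq> \<Omega> L"
  have "integrable (lebesgue_on (\<Omega> L)) u"
    using square_integrable_imp_integrable[OF finite_measure_square assms] .
  then have "u absolutely_integrable_on \<Omega> L"
    by (subst (asm) integrable_restrict_space) (auto simp: set_integrable_def)
  then show "u absolutely_integrable_on K"
    using K by (auto intro: set_integrable_subset simp: compact_imp_closed)
qed

lemma L2_norm_sq: "(L2_norm M u)\<^sup>2 = (LINT x|M. (u x)\<^sup>2)"
  by (simp add: L2_norm_def)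

subsection \<open>The space H1\<close>

text \<open>The choice in \<open>weak_partial\<close> asks only for some weak derivative. Its square
  integrability is carried over from the witness in \<open>H1\<close> by uniqueness almost
  everywhere.\<close>

lemma H1_D:
  assumes "u \<in> H1 (\<Omega> L)" "b \<in> Basis"
  shows "has_weak_partial (\<Omega> L) b u (weak_partial (\<Omega> L) b u)"
    and "square_integrable (lebesgue_on (\<Omega> L)) (weak_partial (\<Omega> L) b u)"
proof -
  obtain g where g: "has_weak_partial (\<Omega> L) b u g" "square_integrable (lebesgue_on (\<Omega> L)) g"
    using assms by (auto simp: H1_def)
  show w: "has_weak_partial (\<Omega> L) b u (weak_partial (\<Omega> L) b u)"
    unfolding weak_partial_def by (rule someI[where P = "has_weak_partial (\<Omega> L) b u", OF g(1)])
  then show "square_integrable (lebesgue_on (\<Omega> L)) (weak_partial (\<Omega> L) b u)"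
    using weak_partial_unique[OF g(1) w assms(2)] g(2)
    by (auto intro: square_integrable_cong_AE locally_integrable_borel_measurable simp: has_weak_partial_def)
qed

lemma H1_weak_partial_eq:
  assumes "u \<in> H1 (\<Omega> L)" "b \<in> Basis" "has_weak_partial (\<Omega> L) b u g"
  shows "AE p in lebesgue_on (\<Omega> L). weak_partial (\<Omega> L) b u p = g p"
  using weak_partial_unique[OF H1_D(1)[OF assms(1,2)] assms(3,2)] .

lemma continuous_compact_support_bounded:
  fixes f :: "'a::euclidean_space \<Rightarrow> real"
  assumes "continuous_on UNIV f" "compact K" "\<And>x. x \<notin> K \<Longrightarrow> f x = 0"
  obtains B where "\<And>x. \<bar>f x\<bar> \<le> B"
proof -
  have "bounded (f ` K)"
    using assms by (intro compact_imp_bounded compact_continuous_image) (auto intro: continuous_on_subset)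
  then obtain B where B: "\<And>x. x \<in> K \<Longrightarrow> \<bar>f x\<bar> \<le> B"
    by (metis bounded_iff imageI real_norm_def)
  have "\<bar>f x\<bar> \<le> \<bar>B\<bar>" for x
    by (cases "x \<in> K") (use B[of x] assms(3)[of x] in auto)
  then show ?thesis
    using that by blast
qed

lemma frechet_derivative_zero_off_support:
  fixes F :: "'a::euclidean_space \<Rightarrow> real"
  assumes "closed K" "\<And>x. x \<notin> K \<Longrightarrow> F x = 0" "x \<notin> K"
  shows "frechet_derivative F (at x) b = 0"
proof -
  have "((\<lambda>_. 0) has_derivative (\<lambda>_. 0)) (at x)"
    by simp
  then have "(F has_derivative (\<lambda>_. 0)) (at x)"
    by (rule has_derivative_transform_within_open[of _ _ _ _ "- K"]) (use assms in auto)
  from frechet_derivative_at[OF this] show ?thesis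
    by metis
qed

lemma test_function_bounded:
  assumes "\<phi> \<in> test_functions S" "b \<in> Basis"
  obtains B where "\<And>x. \<bar>\<phi> x\<bar> \<le> B" "\<And>x. \<bar>frechet_derivative \<phi> (at x) b\<bar> \<le> B"
    "continuous_on UNIV \<phi>" "continuous_on UNIV (\<lambda>x. frechet_derivative \<phi> (at x) b)"
proof -
  obtain K where K: "compact K" "\<And>x. x \<notin> K \<Longrightarrow> \<phi> x = 0" and C: "C_k 0 \<phi>" "C_k (Suc 0) \<phi>"
    using assms unfolding test_functions_def by blast
  have c: "continuous_on UNIV \<phi>" "continuous_on UNIV (\<lambda>x. frechet_derivative \<phi> (at x) b)"
    using C assms by auto
  obtain B1 where B1: "\<And>x. \<bar>\<phi> x\<bar> \<le> B1"
    using continuous_compact_support_bounded[OF c(1) K] by blast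
  obtain B2 where B2: "\<And>x. \<bar>frechet_derivative \<phi> (at x) b\<bar> \<le> B2"
    using continuous_compact_support_bounded[OF c(2) K(1) frechet_derivative_zero_off_support[OF compact_imp_closed[OF K(1)] K(2)]]
    by blast
  show ?thesis
    using that[of "max B1 B2"] B1 B2 c by (simp add: le_max_iff_disj)
qed

lemma integrable_times_continuous_bounded:
  assumes u: "square_integrable (lebesgue_on (\<Omega> L)) u" and "continuous_on UNIV \<phi>" "\<And>x. \<bar>\<phi> x\<bar> \<le> B"
  shows "integrable (lebesgue_on (\<Omega> L)) (\<lambda>x. u x * \<phi> x)"
proof (rule Bochner_Integration.integrable_bound)
  show "integrable (lebesgue_on (\<Omega> L)) (\<lambda>x. B * u x)"
    using square_integrable_imp_integrable[OF finite_measure_square u] by simp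
  have "\<phi> \<in> borel_measurable (lebesgue_on (\<Omega> L))"
    using assms(2) by (intro measurable_restrict_space1 measurable_completion)
      (auto intro: borel_measurable_continuous_onI)
  then show "(\<lambda>x. u x * \<phi> x) \<in> borel_measurable (lebesgue_on (\<Omega> L))"
    using u by (auto simp: square_integrable_def)
  have "\<bar>\<phi> x\<bar> \<le> \<bar>B\<bar>" for x
    using assms(3)[of x] by linarith
  then show "AE x in lebesgue_on (\<Omega> L). norm (u x * \<phi> x) \<le> norm (B * u x)"
    by (auto simp: abs_mult mult.commute intro!: AE_I2 mult_right_mono)
qed

lemma has_weak_partial_diff:
  assumes u: "square_integrable (lebesgue_on (\<Omega> L)) u" "square_integrable (lebesgue_on (\<Omega> L)) g"
      "has_weak_partial (\<Omega> L) b u g"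
    and v: "square_integrable (lebesgue_on (\<Omega> L)) v" "square_integrable (lebesgue_on (\<Omega> L)) k"
      "has_weak_partial (\<Omega> L) b v k"
    and b: "b \<in> Basis"
  shows "has_weak_partial (\<Omega> L) b (\<lambda>x. u x - v x) (\<lambda>x. g x - k x)"
  unfolding has_weak_partial_def
proof (intro conjI ballI)
  show "locally_integrable (\<Omega> L) (\<lambda>x. u x - v x)" "locally_integrable (\<Omega> L) (\<lambda>x. g x - k x)"
    using u v by (auto intro!: square_integrable_locally_integrable square_integrable_diff)
  fix \<phi> assume \<phi>: "\<phi> \<in> test_functions (\<Omega> L)"
  obtain B where B: "\<And>x. \<bar>\<phi> x\<bar> \<le> B" "\<And>x. \<bar>frechet_derivative \<phi> (at x) b\<bar> \<le> B"
    "continuous_on UNIV \<phi>" "continuous_on UNIV (\<lambda>x. frechet_derivative \<phi> (at x) b)"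
    using test_function_bounded[OF \<phi> b] by blast
  have "(LINT x|lebesgue_on (\<Omega> L). w x * frechet_derivative \<phi> (at x) b) = - (LINT x|lebesgue_on (\<Omega> L). h x * \<phi> x)"
    if "has_weak_partial (\<Omega> L) b w h" for w h
    using that \<phi> by (auto simp: has_weak_partial_def)
  from this[OF u(3)] this[OF v(3)]
  show "(LINT x|lebesgue_on (\<Omega> L). (u x - v x) * frechet_derivative \<phi> (at x) b)
      = - (LINT x|lebesgue_on (\<Omega> L). (g x - k x) * \<phi> x)"
    using integrable_times_continuous_bounded[OF u(1) B(4,2)] integrable_times_continuous_bounded[OF v(1) B(4,2)]
      integrable_times_continuous_bounded[OF u(2) B(3,1)] integrable_times_continuous_bounded[OF v(2) B(3,1)]
    by (simp add: left_diff_distrib)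
qed

lemma H1_diff:
  assumes "u \<in> H1 (\<Omega> L)" "v \<in> H1 (\<Omega> L)"
  shows "(\<lambda>x. u x - v x) \<in> H1 (\<Omega> L)"
    and "b \<in> Basis \<Longrightarrow> AE p in lebesgue_on (\<Omega> L). weak_partial (\<Omega> L) b (\<lambda>x. u x - v x) p
      = weak_partial (\<Omega> L) b u p - weak_partial (\<Omega> L) b v p"
proof -
  have sq: "square_integrable (lebesgue_on (\<Omega> L)) u" "square_integrable (lebesgue_on (\<Omega> L)) v"
    using assms by (auto simp: H1_def)
  have w: "has_weak_partial (\<Omega> L) b (\<lambda>x. u x - v x) (\<lambda>x. weak_partial (\<Omega> L) b u x - weak_partial (\<Omega> L) b v x)"
    if "b \<in> Basis" for b
    by (intro has_weak_partial_diff sq H1_D assms that)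
  show *: "(\<lambda>x. u x - v x) \<in> H1 (\<Omega> L)"
    unfolding H1_def using w sq H1_D(2)[OF assms(1)] H1_D(2)[OF assms(2)]
    by (blast intro: square_integrable_diff)
  show "b \<in> Basis \<Longrightarrow> AE p in lebesgue_on (\<Omega> L). weak_partial (\<Omega> L) b (\<lambda>x. u x - v x) p
      = weak_partial (\<Omega> L) b u p - weak_partial (\<Omega> L) b v p"
    using H1_weak_partial_eq[OF * _ w] by blast
qed

lemma inner_weak_grad:
  "weak_grad S u p \<bullet> weak_grad S v p = weak_partial S (1, 0) u p * weak_partial S (1, 0) v p
    + weak_partial S (0, 1) u p * weak_partial S (0, 1) (v :: real \<times> real \<Rightarrow> real) p"
  by (simp add: weak_grad_def Basis_real_prod inner_Pair)

lemma norm_weak_grad_sq: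
  "(norm (weak_grad S u p))\<^sup>2 = (weak_partial S (1, 0) u p)\<^sup>2 + (weak_partial S (0, 1) (u :: real \<times> real \<Rightarrow> real) p)\<^sup>2"
  unfolding power2_norm_eq_inner inner_weak_grad by (simp add: power2_eq_square)

lemma H1_seminorm_sq:
  assumes "u \<in> H1 (\<Omega> L)"
  shows "(H1_seminorm (\<Omega> L) u)\<^sup>2 = (LINT p|lebesgue_on (\<Omega> L). (weak_partial (\<Omega> L) (1, 0) u p)\<^sup>2)
    + (LINT p|lebesgue_on (\<Omega> L). (weak_partial (\<Omega> L) (0, 1) u p)\<^sup>2)"
  using H1_D(2)[OF assms] unfolding H1_seminorm_def L2_norm_sq norm_weak_grad_sq
  by (subst Bochner_Integration.integral_add) (auto simp: square_integrable_def Basis_real_prod)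

subsection \<open>Continuously differentiable functions\<close>

lemma C_1_partials:
  fixes F :: "real \<times> real \<Rightarrow> real"
  assumes "C_k 1 F"
  shows "((\<lambda>x. F (x, y)) has_real_derivative frechet_derivative F (at (x, y)) (1, 0)) (at x)"
    "((\<lambda>y. F (x, y)) has_real_derivative frechet_derivative F (at (x, y)) (0, 1)) (at y)"
    "b \<in> Basis \<Longrightarrow> continuous_on UNIV (\<lambda>p. frechet_derivative F (at p) b)"
    "continuous_on UNIV F"
proof -
  have D: "(F has_derivative frechet_derivative F (at p)) (at p)" for p
    using assms unfolding One_nat_def C_k.simps frechet_derivative_works by blast
  have lin: "frechet_derivative F (at p) (c, 0) = c * frechet_derivative F (at p) (1, 0)"
      "frechet_derivative F (at p) (0, c) = c * frechet_derivative F (at p) (0, 1)" for p c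
    using linear_scale[OF has_derivative_linear[OF D], of p c "(1, 0)"]
      linear_scale[OF has_derivative_linear[OF D], of p c "(0, 1)"] by simp_all
  have "((\<lambda>x. (x, y)) has_derivative (\<lambda>c. (c, 0))) (at x)"
    by (intro derivative_intros)
  from has_derivative_compose[OF this D]
  show "((\<lambda>x. F (x, y)) has_real_derivative frechet_derivative F (at (x, y)) (1, 0)) (at x)"
    by (rule has_derivative_imp_has_field_derivative) (simp add: lin(1)[symmetric])
  have "((\<lambda>y. (x, y)) has_derivative (\<lambda>c. (0, c))) (at y)"
    by (intro derivative_intros)
  from has_derivative_compose[OF this D]
  show "((\<lambda>y. F (x, y)) has_real_derivative frechet_derivative F (at (x, y)) (0, 1)) (at y)"
    by (rule has_derivative_imp_has_field_derivative) (simp add: lin(2)[symmetric])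
  show "b \<in> Basis \<Longrightarrow> continuous_on UNIV (\<lambda>p. frechet_derivative F (at p) b)"
    using assms by auto
  show "continuous_on UNIV F"
    using C_k_SucD[of 0 F] assms by auto
qed

lemma continuous_on_slice:
  fixes f :: "real \<times> real \<Rightarrow> real"
  assumes "continuous_on UNIV f"
  shows "continuous_on S (\<lambda>x. f (x, y))" "continuous_on S (\<lambda>y. f (x, y))"
  by (auto intro!: continuous_on_compose2[OF assms] continuous_intros)

text \<open>Fundamental theorem of calculus on each line parallel to the axis, then Fubini. Applied
  to the product with a test function this is integration by parts without boundary terms.\<close>

lemma integral_partial_compact_support:
  fixes F :: "real \<times> real \<Rightarrow> real"
  assumes F: "C_k 1 F" and K: "compact K" "K \<subseteq> \<Omega> L" "\<And>p. p \<notin> K \<Longrightarrow> F p = 0" and b: "b \<in> Basis"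
  shows "(\<integral>p. frechet_derivative F (at p) b \<partial>lborel) = 0"
proof -
  let ?f = "\<lambda>p. frechet_derivative F (at p) b"
  note C = C_1_partials[OF F]
  have zero: "?f p = 0" if "p \<notin> K" for p
    by (rule frechet_derivative_zero_off_support[OF compact_imp_closed[OF K(1)] K(3) that])
  have "integrable lborel (\<lambda>p. indicator K p *\<^sub>R ?f p)"
    using C(3)[OF b] K(1) by (intro borel_integrable_compact) (auto intro: continuous_on_subset)
  moreover have "(\<lambda>p. indicator K p *\<^sub>R ?f p) = ?f"
    using zero by (auto simp: indicator_def fun_eq_iff)
  ultimately have "integrable lborel ?f"
    by metis
  then have int: "integrable (lborel \<Otimes>\<^sub>M lborel) (case_prod (\<lambda>x y. ?f (x, y)))"
    by (simp add: lborel_prod case_prod_beta')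
  have out: "F (x, y) = 0" "?f (x, y) = 0" if "x \<le> 0 \<or> L \<le> x \<or> y \<le> 0 \<or> L \<le> y" for x y
  proof -
    have "(x, y) \<notin> K"
      using K(2) that by (auto simp: \<Omega>_def)
    then show "F (x, y) = 0" "?f (x, y) = 0"
      using zero K(3) by blast+
  qed
  have cont: "isCont (\<lambda>x. ?f (x, y)) x" "isCont (\<lambda>y. ?f (x, y)) y" for x y
    using continuous_on_slice[OF C(3)[OF b], of UNIV] by (auto simp: continuous_on_eq_continuous_at)
  \<comment> \<open>The sign of \<open>L\<close> is open here. For \<open>L\<close> \<le> 0 the
    square is empty and \<open>F\<close> is zero, and the absolute value covers both cases with one
    interval.\<close>
  have L: "0 \<le> \<bar>L\<bar>" by simp
  have "b = (1, 0) \<or> b = (0, 1)"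
    using b by (auto simp: Basis_real_prod)
  then show ?thesis
  proof
    assume "b = (1, 0)"
    have "(\<integral>x. ?f (x, y) \<partial>lborel) = 0" for y
    proof -
      have "(\<lambda>x. ?f (x, y) * indicator {0..\<bar>L\<bar>} x) = (\<lambda>x. ?f (x, y))"
        using out(2)[of _ y] by (auto simp: indicator_def fun_eq_iff) (meson linear abs_ge_self order_trans)+
      moreover have "(\<integral>x. ?f (x, y) * indicator {0..\<bar>L\<bar>} x \<partial>lborel) = F (\<bar>L\<bar>, y) - F (0, y)"
        by (rule integral_FTC_Icc_real[OF L]) (use C(1) \<open>b = (1, 0)\<close> cont in auto)
      ultimately show ?thesis
        using out(1)[of "\<bar>L\<bar>" y] out(1)[of 0 y] abs_ge_self[of L] by simp
    qed
    then show ?thesis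
      using lborel_pair.integral_snd[OF int] by (simp add: lborel_prod case_prod_beta')
  next
    assume "b = (0, 1)"
    have "(\<integral>y. ?f (x, y) \<partial>lborel) = 0" for x
    proof -
      have "(\<lambda>y. ?f (x, y) * indicator {0..\<bar>L\<bar>} y) = (\<lambda>y. ?f (x, y))"
        using out(2)[of x] by (auto simp: indicator_def fun_eq_iff) (meson linear abs_ge_self order_trans)+
      moreover have "(\<integral>y. ?f (x, y) * indicator {0..\<bar>L\<bar>} y \<partial>lborel) = F (x, \<bar>L\<bar>) - F (x, 0)"
        by (rule integral_FTC_Icc_real[OF L]) (use C(2) \<open>b = (0, 1)\<close> cont in auto)
      ultimately show ?thesis
        using out(1)[of x "\<bar>L\<bar>"] out(1)[of x 0] abs_ge_self[of L] by simp
    qed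
    then show ?thesis
      using lborel_pair.integral_fst[OF int] by (simp add: lborel_prod case_prod_beta')
  qed
qed

lemma continuous_square_integrable:
  assumes "continuous_on UNIV f"
  shows "square_integrable (lebesgue_on (\<Omega> L)) f"
proof -
  have m: "f \<in> borel_measurable borel"
    using assms by (rule borel_measurable_continuous_onI)
  have b: "integrable lborel (\<lambda>p. indicator ({0..L} \<times> {0..L}) p *\<^sub>R (f p)\<^sup>2)"
    by (intro borel_integrable_compact continuous_intros continuous_on_subset[OF assms] compact_Times) auto
  have "integrable lborel (\<lambda>p. indicator (\<Omega> L) p *\<^sub>R (indicator ({0..L} \<times> {0..L}) p *\<^sub>R (f p)\<^sup>2))"
    by (intro integrable_mult_indicator b) auto
  moreover have "(\<lambda>p. indicator (\<Omega> L) p *\<^sub>R (indicator ({0..L} \<times> {0..L}) p *\<^sub>R (f p)\<^sup>2))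
      = (\<lambda>p. indicator (\<Omega> L) p * (f p)\<^sup>2)"
    by (auto simp: indicator_def \<Omega>_def fun_eq_iff)
  ultimately have "integrable (lebesgue_on (\<Omega> L)) (\<lambda>p. (f p)\<^sup>2)"
    using m by (subst borel_rep_integral(2)[OF square_borel borel_rep_borel[OF square_borel]]) auto
  then show ?thesis
    using borel_rep_borel[OF square_borel m] by (auto simp: square_integrable_def borel_rep_def)
qed

lemma C_1_weak_partial:
  fixes w :: "real \<times> real \<Rightarrow> real"
  assumes w: "C_k 1 w" and b: "b \<in> Basis"
  shows "has_weak_partial (\<Omega> L) b w (\<lambda>p. frechet_derivative w (at p) b)"
  unfolding has_weak_partial_def
proof (intro conjI ballI)
  note C = C_1_partials[OF w]
  show "locally_integrable (\<Omega> L) w" "locally_integrable (\<Omega> L) (\<lambda>p. frechet_derivative w (at p) b)"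
    by (intro square_integrable_locally_integrable continuous_square_integrable C(3)[OF b] C(4))+
  fix \<phi> assume \<phi>: "\<phi> \<in> test_functions (\<Omega> L)"
  obtain K where K: "compact K" "K \<subseteq> \<Omega> L" "\<And>x. x \<notin> K \<Longrightarrow> \<phi> x = 0" and C\<phi>: "C_k 1 \<phi>"
    using \<phi> unfolding test_functions_def by blast
  obtain B where B: "\<And>x. \<bar>\<phi> x\<bar> \<le> B" "\<And>x. \<bar>frechet_derivative \<phi> (at x) b\<bar> \<le> B"
    "continuous_on UNIV \<phi>" "continuous_on UNIV (\<lambda>x. frechet_derivative \<phi> (at x) b)"
    using test_function_bounded[OF \<phi> b] by blast
  have prod: "frechet_derivative (\<lambda>p. w p * \<phi> p) (at p) b
      = w p * frechet_derivative \<phi> (at p) b + frechet_derivative w (at p) b * \<phi> p" for p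
    using w C\<phi> unfolding One_nat_def C_k.simps by (intro frechet_derivative_times) blast+
  have z: "w p * frechet_derivative \<phi> (at p) b + frechet_derivative w (at p) b * \<phi> p = 0" if "p \<notin> \<Omega> L" for p
  proof -
    have "p \<notin> K"
      using that K(2) by blast
    then show ?thesis
      using K(3) frechet_derivative_zero_off_support[OF compact_imp_closed[OF K(1)] K(3)] by simp
  qed
  have "continuous_on UNIV (\<lambda>p. w p * frechet_derivative \<phi> (at p) b + frechet_derivative w (at p) b * \<phi> p)"
    using C(3)[OF b] C(4) B by (intro continuous_intros)
  then have m: "(\<lambda>p. w p * frechet_derivative \<phi> (at p) b + frechet_derivative w (at p) b * \<phi> p) \<in> borel_measurable borel"
    by (rule borel_measurable_continuous_onI)
  have "0 = (\<integral>p. frechet_derivative (\<lambda>p. w p * \<phi> p) (at p) b \<partial>lborel)"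
    using integral_partial_compact_support[OF C_k_mult[OF w C\<phi>] K(1,2) _ b] K(3) by simp
  also have "\<dots> = (LINT p|lebesgue_on (\<Omega> L). w p * frechet_derivative \<phi> (at p) b + frechet_derivative w (at p) b * \<phi> p)"
    unfolding prod by (rule integral_lebesgue_on_borel(1)[OF square_borel m z, symmetric])
  also have "\<dots> = (LINT p|lebesgue_on (\<Omega> L). w p * frechet_derivative \<phi> (at p) b)
      + (LINT p|lebesgue_on (\<Omega> L). frechet_derivative w (at p) b * \<phi> p)"
    using C b B by (intro Bochner_Integration.integral_add integrable_times_continuous_bounded continuous_square_integrable)
  finally show "(LINT p|lebesgue_on (\<Omega> L). w p * frechet_derivative \<phi> (at p) b)
      = - (LINT p|lebesgue_on (\<Omega> L). frechet_derivative w (at p) b * \<phi> p)"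
    by simp
qed

lemma C_1_in_H1:
  fixes w :: "real \<times> real \<Rightarrow> real"
  assumes "C_k 1 w"
  shows "w \<in> H1 (\<Omega> L)"
  using C_1_weak_partial[OF assms] C_1_partials(3,4)[OF assms]
  unfolding H1_def by (blast intro: continuous_square_integrable)

section \<open>Iterated integrals\<close>

lemma integrable_lborel_prod:
  fixes f g :: "real \<Rightarrow> real"
  assumes f: "integrable lborel f" and g: "integrable lborel g"
  shows "integrable lborel (\<lambda>p. f (fst p) * g (snd p))"
    "(\<integral>p. f (fst p) * g (snd p) \<partial>lborel) = (\<integral>x. f x \<partial>lborel) * (\<integral>x. g x \<partial>lborel)"
proof -
  have [measurable]: "f \<in> borel_measurable borel" "g \<in> borel_measurable borel"
    using f g by auto
  have i: "integrable (lborel \<Otimes>\<^sub>M lborel) (\<lambda>p. f (fst p) * g (snd p))"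
  proof (rule lborel_pair.Fubini_integrable)
    show "integrable lborel (\<lambda>x. \<integral>y. norm (f (fst (x, y)) * g (snd (x, y))) \<partial>lborel)"
      using f g by (simp add: abs_mult)
  qed (use g in \<open>auto simp: lborel_prod\<close>)
  then show "integrable lborel (\<lambda>p. f (fst p) * g (snd p))"
    by (simp add: lborel_prod)
  have "(\<integral>x. (\<integral>y. f x * g y \<partial>lborel) \<partial>lborel) = (\<integral>p. f (fst p) * g (snd p) \<partial>lborel)"
    using lborel_pair.integral_fst'[OF i] by (simp add: lborel_prod)
  then show "(\<integral>p. f (fst p) * g (snd p) \<partial>lborel) = (\<integral>x. f x \<partial>lborel) * (\<integral>x. g x \<partial>lborel)"
    by simp
qed

lemma lborel_Fubini:
  fixes f :: "real \<times> real \<Rightarrow> real"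
  assumes "integrable lborel f"
  shows "(\<integral>x. (\<integral>y. f (x, y) \<partial>lborel) \<partial>lborel) = integral\<^sup>L lborel f"
    and "(\<integral>y. (\<integral>x. f (x, y) \<partial>lborel) \<partial>lborel) = integral\<^sup>L lborel f"
    and "AE x in lborel. integrable lborel (\<lambda>y. f (x, y))"
    and "AE y in lborel. integrable lborel (\<lambda>x. f (x, y))"
    and "integrable lborel (\<lambda>x. \<integral>y. f (x, y) \<partial>lborel)"
    and "integrable lborel (\<lambda>y. \<integral>x. f (x, y) \<partial>lborel)"
proof -
  have i: "integrable (lborel \<Otimes>\<^sub>M lborel) f" "integrable (lborel \<Otimes>\<^sub>M lborel) (case_prod (\<lambda>x y. f (x, y)))"
    using assms by (simp_all add: lborel_prod case_prod_beta')
  show "(\<integral>x. (\<integral>y. f (x, y) \<partial>lborel) \<partial>lborel) = integral\<^sup>L lborel f"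
    using lborel_pair.integral_fst'[OF i(1)] by (simp add: lborel_prod)
  show "(\<integral>y. (\<integral>x. f (x, y) \<partial>lborel) \<partial>lborel) = integral\<^sup>L lborel f"
    using lborel_pair.integral_snd[OF i(2)] by (simp add: lborel_prod case_prod_beta')
  show "AE x in lborel. integrable lborel (\<lambda>y. f (x, y))"
    using lborel_pair.AE_integrable_fst'[OF i(1)] .
  show "AE y in lborel. integrable lborel (\<lambda>x. f (x, y))"
    using lborel_pair.AE_integrable_snd[OF i(2)] .
  show "integrable lborel (\<lambda>x. \<integral>y. f (x, y) \<partial>lborel)"
    using lborel_pair.integrable_fst'[OF i(1)] .
  show "integrable lborel (\<lambda>y. \<integral>x. f (x, y) \<partial>lborel)"
    using lborel_pair.integrable_snd[OF i(2)] .
qed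

text \<open>Invariance under the exchange of coordinates transfers results for the second variable
  to the first.\<close>

lemma distr_lborel_swap: "distr lborel borel prod.swap = (lborel :: (real \<times> real) measure)"
proof -
  have "(lborel :: (real \<times> real) measure) = distr (lborel \<Otimes>\<^sub>M lborel) (lborel \<Otimes>\<^sub>M lborel) (\<lambda>(x, y). (y, x))"
    using lborel_pair.distr_pair_swap by (simp add: lborel_prod)
  also have "\<dots> = distr lborel lborel prod.swap"
    unfolding lborel_prod by (rule distr_cong) auto
  also have "\<dots> = distr lborel borel prod.swap"
    by (rule distr_cong) auto
  finally show ?thesis ..
qed

lemma swap_borel [measurable]: "prod.swap \<in> borel \<rightarrow>\<^sub>M (borel :: (real \<times> real) measure)"
  by (intro borel_measurable_continuous_onI) (auto simp: prod.swap_def intro!: continuous_intros)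

lemma lborel_swap:
  fixes f :: "real \<times> real \<Rightarrow> real"
  assumes "f \<in> borel_measurable borel"
  shows "(\<integral>p. f (prod.swap p) \<partial>lborel) = integral\<^sup>L lborel f"
    and "integrable lborel (\<lambda>p. f (prod.swap p)) \<longleftrightarrow> integrable lborel f"
  using integral_distr[of prod.swap lborel borel f] integrable_distr_eq[of prod.swap lborel borel f] assms
  by (simp_all add: distr_lborel_swap)

lemma AE_lborel_swap:
  assumes "AE p in lborel. P (prod.swap p)"
  shows "AE p :: real \<times> real in lborel. P p"
proof -
  obtain N where N: "N \<in> null_sets lborel" "{p \<in> space lborel. \<not> P (prod.swap p)} \<subseteq> N"
    using assms by (auto simp: eventually_ae_filter)
  have "emeasure lborel (prod.swap -` N) = emeasure (distr lborel borel prod.swap) N"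
    using N(1) by (subst emeasure_distr) auto
  then have "prod.swap -` N \<in> null_sets lborel"
    using N(1) measurable_sets[OF swap_borel, of N] by (auto simp: distr_lborel_swap null_sets_def)
  then show ?thesis
    by (rule AE_I') (use N(2) in force)
qed

lemma AE_lborel_fst_snd:
  assumes "AE x in lborel. P (x :: real)"
  shows "AE p in lborel. P (fst (p :: real \<times> real))" "AE p in lborel. P (snd (p :: real \<times> real))"
proof -
  obtain N where N: "N \<in> null_sets lborel" "{x \<in> space lborel. \<not> P x} \<subseteq> N"
    using assms by (auto simp: eventually_ae_filter)
  then have [measurable]: "N \<in> sets borel"
    by auto
  have "AE x in lborel. x \<notin> N"
    using AE_not_in[OF N(1)] .
  moreover have "{p \<in> space (lborel \<Otimes>\<^sub>M lborel). fst p \<notin> N} \<in> sets (lborel \<Otimes>\<^sub>M (lborel :: real measure))"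
    by measurable
  ultimately have "AE p in lborel \<Otimes>\<^sub>M (lborel :: real measure). fst p \<notin> N"
    by (intro lborel_pair.AE_pair_measure) auto
  then have *: "AE p in (lborel :: (real \<times> real) measure). fst p \<notin> N"
    unfolding lborel_prod .
  then show "AE p in lborel. P (fst (p :: real \<times> real))"
    by eventually_elim (use N(2) in auto)
  from * have "AE p in (lborel :: (real \<times> real) measure). snd p \<notin> N"
    using AE_lborel_swap[of "\<lambda>p. snd p \<notin> N"] by simp
  then show "AE p in lborel. P (snd (p :: real \<times> real))"
    by eventually_elim (use N(2) in auto)
qed

lemma AE_lborel_pairD:
  assumes "AE p in lborel. P (p :: real \<times> real)"
  shows "AE x in lborel. AE y in lborel. P (x, y)" "AE y in lborel. AE x in lborel. P (x, y)"
proof -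
  have "AE x in lborel. AE y in lborel. Q (x, y)" if "AE p in lborel. Q p" for Q :: "real \<times> real \<Rightarrow> bool"
    using that by (rule lborel_pair.AE_pair[of Q, unfolded lborel_prod])
  moreover have "AE p in lborel. P (prod.swap p)"
    using AE_lborel_swap[of "\<lambda>p. P (prod.swap p)"] assms by simp
  ultimately show "AE x in lborel. AE y in lborel. P (x, y)" "AE y in lborel. AE x in lborel. P (x, y)"
    using assms by fastforce+
qed

subsection \<open>Integrals over the segment from a to x\<close>

text \<open>Weight that turns the oriented integral from \<open>a\<close> to \<open>x\<close> into
  an integral over the line, with negative sign when x < a. Fubini then applies without cases on the
  order of the end points; the reversed orientation occurs for the right side, where integration
  starts at \<open>L\<close>.\<close>

definition oriented_ind :: "real \<Rightarrow> real \<Rightarrow> real \<Rightarrow> real" where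
  "oriented_ind a x s = (if a < s \<and> s < x then 1 else 0) - (if x < s \<and> s < a then 1 else 0)"

definition segment_int :: "real \<Rightarrow> real \<Rightarrow> (real \<Rightarrow> real) \<Rightarrow> real" where
  "segment_int a x f = (\<integral>s. oriented_ind a x s * f s \<partial>lborel)"

lemma oriented_ind_measurable [measurable]:
  assumes [measurable]: "f \<in> borel_measurable M" "g \<in> borel_measurable M" "h \<in> borel_measurable M"
  shows "(\<lambda>x. oriented_ind (f x) (g x) (h x)) \<in> borel_measurable M"
  unfolding oriented_ind_def by measurable

lemma abs_oriented_ind: "\<bar>oriented_ind a x s\<bar> \<le> 1"
  by (auto simp: oriented_ind_def)

lemma borel_measurable_lborel_param:
  fixes f :: "'a::second_countable_topology \<Rightarrow> real \<Rightarrow> real"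
  assumes "(\<lambda>p. f (fst p) (snd p)) \<in> borel_measurable borel"
  shows "(\<lambda>x. \<integral>s. f x s \<partial>lborel) \<in> borel_measurable borel"
proof (rule lborel.borel_measurable_lebesgue_integral)
  have "sets (borel \<Otimes>\<^sub>M lborel) = sets (borel :: ('a \<times> real) measure)"
    by (simp add: borel_prod[symmetric] cong: sets_pair_measure_cong)
  then show "(\<lambda>(x, s). f x s) \<in> borel_measurable (borel \<Otimes>\<^sub>M lborel)"
    using assms by (simp add: case_prod_beta' cong: measurable_cong_sets)
qed

lemma segment_int_measurable [measurable]:
  fixes h :: "real \<times> real \<Rightarrow> real"
  assumes [measurable]: "h \<in> borel_measurable borel"
  shows "(\<lambda>p. segment_int a (fst p) (\<lambda>s. h (s, snd p))) \<in> borel_measurable borel"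
    and "(\<lambda>p. segment_int a (snd p) (\<lambda>s. h (fst p, s))) \<in> borel_measurable borel"
  unfolding segment_int_def by (rule borel_measurable_lborel_param; measurable)+

lemma integrable_oriented_ind:
  assumes "integrable lborel f"
  shows "integrable lborel (\<lambda>s. oriented_ind a x s * f s)"
  by (rule Bochner_Integration.integrable_bound[OF assms])
    (use assms abs_oriented_ind in \<open>auto simp: abs_mult intro!: mult_left_le_one_le\<close>)

lemma segment_int_bound:
  assumes "integrable lborel f"
  shows "\<bar>segment_int a x f\<bar> \<le> (\<integral>s. \<bar>f s\<bar> \<partial>lborel)"
proof -
  have "\<bar>segment_int a x f\<bar> \<le> (\<integral>s. \<bar>oriented_ind a x s * f s\<bar> \<partial>lborel)"
    unfolding segment_int_def by (rule integral_abs_bound)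
  also have "\<dots> \<le> (\<integral>s. \<bar>f s\<bar> \<partial>lborel)"
    using abs_oriented_ind integrable_oriented_ind[OF assms] assms
    by (intro integral_mono integrable_abs) (auto simp: abs_mult intro!: mult_left_le_one_le)
  finally show ?thesis .
qed

text \<open>By Fubini the operator of integration from 0 has as adjoint the integration over what
  lies beyond: for s > 0 the inner integral on the right is that of \<alpha> over x > s.\<close>

lemma segment_int_duality:
  fixes f \<alpha> :: "real \<Rightarrow> real"
  assumes f: "integrable lborel f" and \<alpha>: "integrable lborel \<alpha>"
  shows "(\<integral>x. segment_int 0 x f * \<alpha> x \<partial>lborel)
    = (\<integral>s. f s * (\<integral>x. oriented_ind 0 x s * \<alpha> x \<partial>lborel) \<partial>lborel)"
proof -
  have [measurable]: "f \<in> borel_measurable borel" "\<alpha> \<in> borel_measurable borel"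
    using f \<alpha> by auto
  have "integrable lborel (\<lambda>p. oriented_ind 0 (snd p) (fst p) * f (fst p) * \<alpha> (snd p))"
  proof (rule Bochner_Integration.integrable_bound[OF integrable_lborel_prod(1)[OF f \<alpha>]])
    show "AE p in lborel. norm (oriented_ind 0 (snd p) (fst p) * f (fst p) * \<alpha> (snd p)) \<le> norm (f (fst p) * \<alpha> (snd p))"
      using abs_oriented_ind by (auto simp: abs_mult mult.assoc intro!: mult_left_le_one_le)
  qed simp
  note F = lborel_Fubini(1,2)[OF this]
  have "(\<integral>x. segment_int 0 x f * \<alpha> x \<partial>lborel) = (\<integral>x. (\<integral>s. oriented_ind 0 x s * f s * \<alpha> x \<partial>lborel) \<partial>lborel)"
    by (simp add: segment_int_def)
  also have "\<dots> = (\<integral>s. (\<integral>x. oriented_ind 0 x s * f s * \<alpha> x \<partial>lborel) \<partial>lborel)"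
    using F by simp
  also have "\<dots> = (\<integral>s. f s * (\<integral>x. oriented_ind 0 x s * \<alpha> x \<partial>lborel) \<partial>lborel)"
    by (simp add: mult.assoc mult.left_commute)
  finally show ?thesis .
qed

text \<open>For s in (0, \<open>L\<close>) the weighted integral is that of the derivative from s to
  \<open>L\<close>, and \<beta> vanishes at \<open>L\<close>. Together with the duality formula this
  says that \<open>segment_int 0\<close> produces a primitive in the weak sense.\<close>

lemma bumps_segment_weight:
  assumes \<beta>: "\<beta> \<in> bumps L"
  shows "(\<integral>x. oriented_ind 0 x s * deriv \<beta> x \<partial>lborel) = - \<beta> s"
proof -
  have cont: "isCont (deriv \<beta>) x" for x
    using bumps_continuous[OF bumps_deriv[OF \<beta>], of UNIV] by (simp add: continuous_on_eq_continuous_at)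
  have FTC: "(\<integral>x. deriv \<beta> x * indicator {a..b} x \<partial>lborel) = \<beta> b - \<beta> a" if "a \<le> b" for a b
    by (rule integral_FTC_Icc_real[OF that bumps_DERIV[OF \<beta>] cont])
  have z: "deriv \<beta> x = 0" if "x \<le> 0 \<or> L \<le> x" for x
    using bumps_zero[OF bumps_deriv[OF \<beta>] that] .
  show ?thesis
  proof (cases "0 < s \<and> s < L")
    case True
    have "(\<integral>x. oriented_ind 0 x s * deriv \<beta> x \<partial>lborel) = (\<integral>x. deriv \<beta> x * indicator {s..L} x \<partial>lborel)"
    proof (rule integral_cong_AE)
      show "AE x in lborel. oriented_ind 0 x s * deriv \<beta> x = deriv \<beta> x * indicator {s..L} x"
        using AE_lborel_singleton[of s] by eventually_elim (use True z in \<open>auto simp: oriented_ind_def indicator_def\<close>)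
    qed (use bumps_borel[OF bumps_deriv[OF \<beta>]] in measurable)
    then show ?thesis
      using FTC[of s L] True bumps_zero[OF \<beta>, of L] by simp
  next
    case False
    then have "(\<lambda>x. oriented_ind 0 x s * deriv \<beta> x) = (\<lambda>x. 0)"
      using z by (auto simp: oriented_ind_def fun_eq_iff)
    then show ?thesis
      using bumps_zero[OF \<beta>, of s] False by auto
  qed
qed

lemma segment_int_integrable:
  fixes f :: "real \<times> real \<Rightarrow> real"
  assumes f: "integrable lborel f" and k: "k \<in> borel_measurable borel" "\<And>x. \<bar>k x\<bar> \<le> B" "integrable lborel \<alpha>"
  shows "integrable lborel (\<lambda>p. segment_int a (snd p) (\<lambda>t. f (fst p, t)) * (k (fst p) * \<alpha> (snd p)))"
proof -
  have [measurable]: "f \<in> borel_measurable borel" "\<alpha> \<in> borel_measurable borel" "k \<in> borel_measurable borel"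
    using f k by auto
  have B: "B \<ge> 0"
    using k(2)[of 0] by linarith
  have "integrable lborel (\<lambda>x. \<integral>t. \<bar>f (x, t)\<bar> \<partial>lborel)"
    using lborel_Fubini(5)[OF integrable_abs[OF f]] .
  then have "integrable lborel (\<lambda>p. (\<integral>t. \<bar>f (fst p, t)\<bar> \<partial>lborel) * (B * \<bar>\<alpha> (snd p)\<bar>))"
    using k(3) by (intro integrable_lborel_prod) auto
  then show ?thesis
  proof (rule Bochner_Integration.integrable_bound)
    show "AE p in lborel. norm (segment_int a (snd p) (\<lambda>t. f (fst p, t)) * (k (fst p) * \<alpha> (snd p)))
        \<le> norm ((\<integral>t. \<bar>f (fst p, t)\<bar> \<partial>lborel) * (B * \<bar>\<alpha> (snd p)\<bar>))"
      using AE_lborel_fst_snd(1)[OF lborel_Fubini(3)[OF f]] by eventually_elim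
        (use k B segment_int_bound in \<open>auto simp: abs_mult integral_nonneg_AE intro!: mult_mono mult_right_mono\<close>)
  qed measurable
qed

lemma segment_weight_measurable:
  assumes [measurable]: "\<alpha> \<in> borel_measurable borel"
  shows "(\<lambda>s. \<integral>x. oriented_ind 0 x s * \<alpha> x \<partial>lborel) \<in> borel_measurable borel"
  by (rule borel_measurable_lborel_param) measurable

lemma segment_weight_bound:
  assumes \<alpha>: "integrable lborel \<alpha>"
  shows "\<bar>\<integral>x. oriented_ind 0 x s * \<alpha> x \<partial>lborel\<bar> \<le> (\<integral>x. \<bar>\<alpha> x\<bar> \<partial>lborel)"
proof -
  have i: "integrable lborel (\<lambda>x. oriented_ind 0 x s * \<alpha> x)"
    by (rule Bochner_Integration.integrable_bound[OF \<alpha>])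
      (use \<alpha> abs_oriented_ind in \<open>auto simp: abs_mult intro!: mult_left_le_one_le\<close>)
  have "\<bar>\<integral>x. oriented_ind 0 x s * \<alpha> x \<partial>lborel\<bar> \<le> (\<integral>x. \<bar>oriented_ind 0 x s * \<alpha> x\<bar> \<partial>lborel)"
    by (rule integral_abs_bound)
  also have "\<dots> \<le> (\<integral>x. \<bar>\<alpha> x\<bar> \<partial>lborel)"
    using abs_oriented_ind i \<alpha> by (intro integral_mono integrable_abs) (auto simp: abs_mult intro!: mult_left_le_one_le)
  finally show ?thesis .
qed

text \<open>The factor \<open>k\<close> in the other variable is allowed to be any bounded Borel
  function, because the formula is later applied with a \<open>k\<close> that is itself a weight
  from an earlier duality and in general no bump.\<close>

lemma segment_int_duality_snd:
  fixes f :: "real \<times> real \<Rightarrow> real"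
  assumes f: "integrable lborel f" and k: "k \<in> borel_measurable borel" "\<And>x. \<bar>k x\<bar> \<le> B"
    and \<alpha>: "integrable lborel \<alpha>"
  shows "(\<integral>p. segment_int 0 (snd p) (\<lambda>t. f (fst p, t)) * (k (fst p) * \<alpha> (snd p)) \<partial>lborel)
    = (\<integral>p. f p * (k (fst p) * (\<integral>x. oriented_ind 0 x (snd p) * \<alpha> x \<partial>lborel)) \<partial>lborel)"
proof -
  have [measurable]: "f \<in> borel_measurable borel" "\<alpha> \<in> borel_measurable borel" "k \<in> borel_measurable borel"
    using f \<alpha> k by auto
  have B: "B \<ge> 0"
    using k(2)[of 0] by linarith
  define A where "A s = (\<integral>x. oriented_ind 0 x s * \<alpha> x \<partial>lborel)" for s
  have [measurable]: "A \<in> borel_measurable borel"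
    unfolding A_def by (rule segment_weight_measurable) simp
  have A: "\<bar>A s\<bar> \<le> (\<integral>x. \<bar>\<alpha> x\<bar> \<partial>lborel)" for s
    unfolding A_def by (rule segment_weight_bound[OF \<alpha>])
  have int: "integrable lborel (\<lambda>p. f p * (k (fst p) * A (snd p)))"
  proof (rule Bochner_Integration.integrable_bound)
    show "integrable lborel (\<lambda>p. f p * (B * (\<integral>x. \<bar>\<alpha> x\<bar> \<partial>lborel)))"
      using f by simp
    show "AE p in lborel. norm (f p * (k (fst p) * A (snd p))) \<le> norm (f p * (B * (\<integral>x. \<bar>\<alpha> x\<bar> \<partial>lborel)))"
      using k A B by (auto simp: abs_mult integral_nonneg_AE intro!: mult_left_mono mult_mono)
  qed simp
  have "(\<integral>p. segment_int 0 (snd p) (\<lambda>t. f (fst p, t)) * (k (fst p) * \<alpha> (snd p)) \<partial>lborel)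
    = (\<integral>x. (\<integral>y. segment_int 0 y (\<lambda>t. f (x, t)) * (k x * \<alpha> y) \<partial>lborel) \<partial>lborel)"
    using lborel_Fubini(1)[OF segment_int_integrable[OF f k \<alpha>], of 0] by simp
  also have "\<dots> = (\<integral>x. k x * (\<integral>y. segment_int 0 y (\<lambda>t. f (x, t)) * \<alpha> y \<partial>lborel) \<partial>lborel)"
    by (simp add: mult.left_commute)
  also have "\<dots> = (\<integral>x. k x * (\<integral>t. f (x, t) * A t \<partial>lborel) \<partial>lborel)"
  proof (rule integral_cong_AE)
    show "AE x in lborel. k x * (\<integral>y. segment_int 0 y (\<lambda>t. f (x, t)) * \<alpha> y \<partial>lborel) = k x * (\<integral>t. f (x, t) * A t \<partial>lborel)"
      using lborel_Fubini(3)[OF f] by eventually_elim (simp add: segment_int_duality \<alpha> A_def)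
    show "(\<lambda>x. k x * (\<integral>y. segment_int 0 y (\<lambda>t. f (x, t)) * \<alpha> y \<partial>lborel)) \<in> borel_measurable lborel"
      "(\<lambda>x. k x * (\<integral>t. f (x, t) * A t \<partial>lborel)) \<in> borel_measurable lborel"
      by (simp_all, (intro borel_measurable_times borel_measurable_lborel_param; measurable)+)
  qed
  also have "\<dots> = (\<integral>x. (\<integral>t. f (x, t) * (k x * A t) \<partial>lborel) \<partial>lborel)"
    by (simp add: mult.left_commute)
  also have "\<dots> = (\<integral>p. f p * (k (fst p) * A (snd p)) \<partial>lborel)"
    using lborel_Fubini(1)[OF int] by simp
  finally show ?thesis
    by (simp add: A_def)
qed

lemma segment_int_duality_fst:
  fixes f :: "real \<times> real \<Rightarrow> real"
  assumes f: "integrable lborel f" and k: "k \<in> borel_measurable borel" "\<And>x. \<bar>k x\<bar> \<le> B"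
    and \<alpha>: "integrable lborel \<alpha>"
  shows "(\<integral>p. segment_int 0 (fst p) (\<lambda>t. f (t, snd p)) * (\<alpha> (fst p) * k (snd p)) \<partial>lborel)
    = (\<integral>p. f p * ((\<integral>x. oriented_ind 0 x (fst p) * \<alpha> x \<partial>lborel) * k (snd p)) \<partial>lborel)"
proof -
  have [measurable]: "f \<in> borel_measurable borel" "\<alpha> \<in> borel_measurable borel" "k \<in> borel_measurable borel"
    using f \<alpha> k by auto
  define A where "A s = (\<integral>x. oriented_ind 0 x s * \<alpha> x \<partial>lborel)" for s
  have [measurable]: "A \<in> borel_measurable borel"
    unfolding A_def by (rule segment_weight_measurable) simp
  have f': "integrable lborel (\<lambda>p. f (prod.swap p))"
    using f by (simp add: lborel_swap)
  have "(\<lambda>p. segment_int 0 (fst p) (\<lambda>t. f (t, snd p)) * (\<alpha> (fst p) * k (snd p))) \<in> borel_measurable borel"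
    "(\<lambda>p. f p * (A (fst p) * k (snd p))) \<in> borel_measurable borel"
    by measurable
  from this[THEN lborel_swap(1)] segment_int_duality_snd[OF f' k \<alpha>] show ?thesis
    by (simp add: A_def mult.commute[of "k _"])
qed

section \<open>Functions with a weak derivative are integrals\<close>

lemma integrable_indicator_bounded: "bounded A \<Longrightarrow> A \<in> sets borel \<Longrightarrow> integrable lborel (indicator A :: 'a::euclidean_space \<Rightarrow> real)"
  by (intro integrable_real_indicator emeasure_bounded_finite) auto

lemma exists_unit_bump:
  assumes "L > 0"
  obtains \<rho> where "\<rho> \<in> bumps L" "(\<integral>x. \<rho> x \<partial>lborel) = 1"
proof -
  let ?b = "bump (L/4) (3*L/4)"
  have b: "?b n \<in> bumps L" for n
    using assms by (intro bump_in_bumps) auto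
  note [measurable] = bumps_borel[OF b]
  have "(\<lambda>n. \<integral>x. ?b n x \<partial>lborel) \<longlonglongrightarrow> (\<integral>x. indicator {L/4<..<3*L/4} x \<partial>lborel)"
  proof (rule integral_dominated_convergence[where w = "indicator {0..L}"])
    show "AE x in lborel. norm (?b n x) \<le> indicator {0..L} x" for n
    proof (rule AE_I2)
      fix x :: real
      show "norm (?b n x) \<le> indicator {0..L} x"
        using bump_bounds[of "L/4" "3*L/4" n x] bumps_zero[OF b, of x n] by (cases "x \<in> {0..L}") auto
    qed
  qed (auto intro: bump_LIMSEQ integrable_indicator_bounded)
  moreover have "(\<integral>x. indicator {L/4<..<3*L/4} x \<partial>lborel) = L/2"
    using assms by simp
  ultimately have "eventually (\<lambda>n. (\<integral>x. ?b n x \<partial>lborel) > 0) sequentially"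
    using assms by (intro order_tendstoD(1)[of _ "L/2"]) auto
  then obtain n where n: "(\<integral>x. ?b n x \<partial>lborel) > 0"
    by (auto simp: eventually_sequentially)
  define c where "c = (\<integral>x. ?b n x \<partial>lborel)"
  \<comment> \<open>This difference is \<open>?b n\<close> divided by \<open>c\<close>, written so
    that \<open>bumps_diff_cmult\<close> applies.\<close>
  have "(\<lambda>x. ?b n x - (1 - 1 / c) * ?b n x) \<in> bumps L"
    by (intro bumps_diff_cmult b)
  then have "(\<lambda>x. ?b n x / c) \<in> bumps L"
    by (simp add: algebra_simps)
  moreover have "(\<integral>x. ?b n x / c \<partial>lborel) = 1"
    using n by (simp add: c_def)
  ultimately show ?thesis
    using that by blast
qed

lemma bumps_off_square:
  assumes "\<alpha> \<in> bumps L" "\<beta> \<in> bumps L" "p \<notin> \<Omega> L"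
  shows "\<alpha> (fst p) * \<beta> (snd p) = 0"
  using bumps_zero[OF assms(1), of "fst p"] bumps_zero[OF assms(2), of "snd p"] assms(3)
  by (auto simp: \<Omega>_def mem_Times_iff)

lemma integrable_lborel_times_bumps:
  fixes f :: "real \<times> real \<Rightarrow> real"
  assumes "integrable lborel f" "\<alpha> \<in> bumps L" "\<beta> \<in> bumps L"
  shows "integrable lborel (\<lambda>p. f p * (\<alpha> (fst p) * \<beta> (snd p)))"
  using assms by (intro integrable_times_bumps) (auto simp: compact_imp_closed intro!: integrable_mult_indicator[where f = f, simplified])

text \<open>The remainder \<open>E\<close> = \<open>u\<close> - \<open>G\<close> has weak derivative
  zero in the second variable. Its pairing with a product of bumps \<alpha>, \<beta> therefore
  depends on \<beta> only through the integral of \<beta>, which means that \<open>E\<close> is a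
  function of the first variable alone. Averaging \<open>E\<close> against a bump \<rho> of integral
  1 recovers that function.\<close>

lemma weak_partial_snd_representation:
  fixes u g :: "real \<times> real \<Rightarrow> real"
  assumes L: "L > 0" and u: "integrable lborel u" and g: "integrable lborel g"
    and w: "\<And>\<alpha> \<beta>. \<alpha> \<in> bumps L \<Longrightarrow> \<beta> \<in> bumps L \<Longrightarrow>
      (\<integral>p. u p * (\<alpha> (fst p) * deriv \<beta> (snd p)) \<partial>lborel) = - (\<integral>p. g p * (\<alpha> (fst p) * \<beta> (snd p)) \<partial>lborel)"
  obtains p0 where "integrable lborel p0"
    "AE p in lborel. p \<in> \<Omega> L \<longrightarrow> u p = p0 (fst p) + segment_int 0 (snd p) (\<lambda>t. g (fst p, t))"
proof -
  have [measurable]: "u \<in> borel_measurable borel" "g \<in> borel_measurable borel"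
    using u g by auto
  define G where "G p = segment_int 0 (snd p) (\<lambda>t. g (fst p, t))" for p
  have [measurable]: "G \<in> borel_measurable borel"
    unfolding G_def by measurable
  define E where "E p = indicator (\<Omega> L) p * (u p - G p)" for p
  have E: "integrable lborel E"
  proof -
    have "integrable lborel (\<lambda>p. G p * (indicator {0<..<L} (fst p) * indicator {0<..<L} (snd p)))"
      unfolding G_def by (rule segment_int_integrable[where B = 1]) (auto simp: g intro!: integrable_indicator_bounded)
    then have "integrable lborel (\<lambda>p. indicator (\<Omega> L) p * u p - G p * (indicator {0<..<L} (fst p) * indicator {0<..<L} (snd p)))"
      using integrable_mult_indicator[OF _ u, of "\<Omega> L"] by auto
    then show ?thesis
      unfolding E_def by (rule back_subst[of "integrable lborel"]) (auto simp: fun_eq_iff \<Omega>_def indicator_def)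
  qed
  have [measurable]: "E \<in> borel_measurable borel"
    using E by auto
  have E_test: "(\<integral>p. E p * (\<alpha> (fst p) * deriv \<theta> (snd p)) \<partial>lborel) = 0" if tt: "\<alpha> \<in> bumps L" "\<theta> \<in> bumps L" for \<alpha> \<theta>
  proof -
    obtain B where B: "\<And>x. \<bar>\<alpha> x\<bar> \<le> B"
      using bumps_bounded[OF tt(1)] by blast
    note d = bumps_deriv[OF tt(2)]
    have "(\<integral>p. G p * (\<alpha> (fst p) * deriv \<theta> (snd p)) \<partial>lborel) = - (\<integral>p. g p * (\<alpha> (fst p) * \<theta> (snd p)) \<partial>lborel)"
      unfolding G_def segment_int_duality_snd[OF g bumps_borel[OF tt(1)] B bumps_integrable[OF d]]
      by (simp add: bumps_segment_weight[OF tt(2)])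
    moreover have "(\<integral>p. E p * (\<alpha> (fst p) * deriv \<theta> (snd p)) \<partial>lborel)
      = (\<integral>p. u p * (\<alpha> (fst p) * deriv \<theta> (snd p)) - G p * (\<alpha> (fst p) * deriv \<theta> (snd p)) \<partial>lborel)"
      using bumps_off_square[OF tt(1) d]
      by (intro Bochner_Integration.integral_cong refl) (auto simp: E_def indicator_def left_diff_distrib)
    moreover have "integrable lborel (\<lambda>p. G p * (\<alpha> (fst p) * deriv \<theta> (snd p)))"
      unfolding G_def by (rule segment_int_integrable[OF g bumps_borel[OF tt(1)] B bumps_integrable[OF d]])
    ultimately show ?thesis
      using w[OF tt] integrable_lborel_times_bumps[OF u tt(1) d] by simp
  qed
  obtain \<rho> where \<rho>: "\<rho> \<in> bumps L" "(\<integral>x. \<rho> x \<partial>lborel) = 1"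
    using exists_unit_bump[OF L] .
  obtain R where R: "\<And>x. \<bar>\<rho> x\<bar> \<le> R" "R \<ge> 0"
    by (rule bumps_bounded[OF \<rho>(1)]) (rule that)
  note [measurable] = bumps_borel[OF \<rho>(1)]
  define p0 where "p0 x = (\<integral>y. E (x, y) * \<rho> y \<partial>lborel)" for x
  have "integrable lborel (\<lambda>p. E p * \<rho> (snd p))"
  proof (rule Bochner_Integration.integrable_bound)
    show "integrable lborel (\<lambda>p. E p * R)"
      using E by simp
    have "\<bar>\<rho> x\<bar> \<le> \<bar>R\<bar>" for x
      using R(1)[of x] by linarith
    then show "AE p in lborel. norm (E p * \<rho> (snd p)) \<le> norm (E p * R)"
      by (auto simp: abs_mult intro!: mult_left_mono)
  qed simp
  from lborel_Fubini(5)[OF this] have p0: "integrable lborel p0"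
    by (simp add: p0_def[abs_def])
  then have [measurable]: "p0 \<in> borel_measurable borel"
    by auto
  define h where "h p = E p - indicator (\<Omega> L) p * p0 (fst p)" for p
  have ip: "integrable lborel (\<lambda>p. indicator (\<Omega> L) p * p0 (fst p))"
  proof -
    have "integrable lborel (\<lambda>p. (indicator {0<..<L} (fst p) * p0 (fst p)) * indicator {0<..<L} (snd p))"
      using integrable_mult_indicator[OF _ p0, of "{0<..<L}"] by (intro integrable_lborel_prod integrable_indicator_bounded) auto
    then show ?thesis
      by (rule back_subst[of "integrable lborel"]) (auto simp: fun_eq_iff \<Omega>_def indicator_def)
  qed
  have h: "integrable lborel h"
    unfolding h_def using E ip by simp
  have "AE p in lborel. p \<in> \<Omega> L \<longrightarrow> h p = 0"
  proof (rule fundamental_lemma)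
    show "h \<in> borel_measurable borel"
      using h by auto
    show "integrable lborel (\<lambda>p. indicator K p * h p)" if "compact K" "K \<subseteq> \<Omega> L" for K
      using integrable_mult_indicator[OF _ h, of K] that(1) by (simp add: compact_imp_closed)
    fix \<alpha> \<beta> assume ab: "\<alpha> \<in> bumps L" "\<beta> \<in> bumps L"
    note [measurable] = ab[THEN bumps_borel]
    define c where "c = (\<integral>x. \<beta> x \<partial>lborel)"
    \<comment> \<open>Subtracting the right multiple of \<rho> makes the mean zero, so the
      difference is the derivative of a bump \<theta>, and \<open>E_test\<close> annihilates
      it.\<close>
    have "(\<lambda>x. \<beta> x - c * \<rho> x) \<in> bumps L" "(\<integral>x. \<beta> x - c * \<rho> x \<partial>lborel) = 0"
      using ab \<rho> by (auto simp: c_def bumps_diff_cmult bumps_integrable)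
    then obtain \<theta> where \<theta>: "\<theta> \<in> bumps L" "deriv \<theta> = (\<lambda>x. \<beta> x - c * \<rho> x)"
      using bumps_antiderivative by blast
    have "(\<integral>p. indicator (\<Omega> L) p * p0 (fst p) * (\<alpha> (fst p) * \<beta> (snd p)) \<partial>lborel)
      = (\<integral>p. (p0 (fst p) * \<alpha> (fst p)) * \<beta> (snd p) \<partial>lborel)"
      using bumps_off_square[OF ab] by (intro Bochner_Integration.integral_cong refl) (auto simp: indicator_def)
    also have "\<dots> = (\<integral>x. p0 x * \<alpha> x \<partial>lborel) * c"
    proof -
      obtain B where B: "\<And>x. \<bar>\<alpha> x\<bar> \<le> B"
        using bumps_bounded[OF ab(1)] by blast
      have "integrable lborel (\<lambda>x. p0 x * \<alpha> x)"
      proof (rule Bochner_Integration.integrable_bound)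
        show "integrable lborel (\<lambda>x. p0 x * B)"
          using p0 by simp
        have "\<bar>\<alpha> x\<bar> \<le> \<bar>B\<bar>" for x
          using B[of x] by linarith
        then show "AE x in lborel. norm (p0 x * \<alpha> x) \<le> norm (p0 x * B)"
          by (auto simp: abs_mult intro!: mult_left_mono)
      qed simp
      then show ?thesis
        unfolding c_def by (rule integrable_lborel_prod(2)) (rule bumps_integrable[OF ab(2)])
    qed
    also have "(\<integral>x. p0 x * \<alpha> x \<partial>lborel) = (\<integral>x. (\<integral>y. E (x, y) * (\<alpha> x * \<rho> y) \<partial>lborel) \<partial>lborel)"
      unfolding p0_def by (simp add: mult.left_commute[of _ "\<alpha> _"] mult.commute[of _ "\<alpha> _"])
    also have "\<dots> = (\<integral>p. E p * (\<alpha> (fst p) * \<rho> (snd p)) \<partial>lborel)"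
      using lborel_Fubini(1)[OF integrable_lborel_times_bumps[OF E ab(1) \<rho>(1)]] by simp
    finally have 1: "(\<integral>p. indicator (\<Omega> L) p * p0 (fst p) * (\<alpha> (fst p) * \<beta> (snd p)) \<partial>lborel)
      = (\<integral>p. E p * (\<alpha> (fst p) * \<rho> (snd p)) \<partial>lborel) * c" .
    have "(\<integral>p. E p * (\<alpha> (fst p) * \<beta> (snd p)) - (E p * (\<alpha> (fst p) * \<rho> (snd p))) * c \<partial>lborel) = 0"
      using E_test[OF ab(1) \<theta>(1)] unfolding \<theta>(2) by (simp add: algebra_simps)
    then have 2: "(\<integral>p. E p * (\<alpha> (fst p) * \<beta> (snd p)) \<partial>lborel) = (\<integral>p. E p * (\<alpha> (fst p) * \<rho> (snd p)) \<partial>lborel) * c"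
      using integrable_lborel_times_bumps[OF E ab] integrable_lborel_times_bumps[OF E ab(1) \<rho>(1)] by simp
    show "(\<integral>p. h p * (\<alpha> (fst p) * \<beta> (snd p)) \<partial>lborel) = 0"
      unfolding h_def left_diff_distrib
      using 1 2 integrable_lborel_times_bumps[OF E ab] integrable_lborel_times_bumps[OF ip ab] by simp
  qed
  then have "AE p in lborel. p \<in> \<Omega> L \<longrightarrow> u p = p0 (fst p) + segment_int 0 (snd p) (\<lambda>t. g (fst p, t))"
    by eventually_elim (auto simp: h_def E_def G_def)
  with p0 show ?thesis
    using that by blast
qed

lemma weak_partial_fst_representation:
  fixes u g :: "real \<times> real \<Rightarrow> real"
  assumes L: "L > 0" and u: "integrable lborel u" and g: "integrable lborel g"
    and w: "\<And>\<alpha> \<beta>. \<alpha> \<in> bumps L \<Longrightarrow> \<beta> \<in> bumps L \<Longrightarrow>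
      (\<integral>p. u p * (deriv \<alpha> (fst p) * \<beta> (snd p)) \<partial>lborel) = - (\<integral>p. g p * (\<alpha> (fst p) * \<beta> (snd p)) \<partial>lborel)"
  obtains p0 where "integrable lborel p0"
    "AE p in lborel. p \<in> \<Omega> L \<longrightarrow> u p = p0 (snd p) + segment_int 0 (fst p) (\<lambda>t. g (t, snd p))"
proof -
  have [measurable]: "u \<in> borel_measurable borel" "g \<in> borel_measurable borel"
    using u g by auto
  have i: "integrable lborel (\<lambda>p. u (prod.swap p))" "integrable lborel (\<lambda>p. g (prod.swap p))"
    using u g by (simp_all add: lborel_swap)
  have w': "(\<integral>p. u (prod.swap p) * (\<alpha> (fst p) * deriv \<beta> (snd p)) \<partial>lborel)
      = - (\<integral>p. g (prod.swap p) * (\<alpha> (fst p) * \<beta> (snd p)) \<partial>lborel)"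
    if "\<alpha> \<in> bumps L" "\<beta> \<in> bumps L" for \<alpha> \<beta>
  proof -
    note [measurable] = that[THEN bumps_borel] that[THEN bumps_deriv, THEN bumps_borel]
    have "(\<lambda>p. u p * (deriv \<beta> (fst p) * \<alpha> (snd p))) \<in> borel_measurable borel"
      "(\<lambda>p. g p * (\<beta> (fst p) * \<alpha> (snd p))) \<in> borel_measurable borel"
      by measurable
    from this[THEN lborel_swap(1)] w[OF that(2,1)] show ?thesis
      by (simp add: mult.commute[of "\<alpha> _"])
  qed
  obtain p0 where p0: "integrable lborel p0"
    "AE p in lborel. p \<in> \<Omega> L \<longrightarrow> u (prod.swap p) = p0 (fst p) + segment_int 0 (snd p) (\<lambda>t. g (prod.swap (fst p, t)))"
    using weak_partial_snd_representation[OF L i w'] by blast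
  have "AE p in lborel. p \<in> \<Omega> L \<longrightarrow> u p = p0 (snd p) + segment_int 0 (fst p) (\<lambda>t. g (t, snd p))"
    by (rule AE_lborel_swap, use p0(2) in eventually_elim) (auto simp: \<Omega>_def)
  with p0(1) show ?thesis
    using that by blast
qed

text \<open>Cauchy-Schwarz against the constant 1. With V the measure of \<open>A\<close>, m the
  integral of |f| and I that of f^2, the nonnegative integral of (V |f| - m)^2 over \<open>A\<close>
  equals V (V I - m^2); cancelling V forces a separate case for null sets.\<close>

lemma integral_abs_power2_le:
  assumes f: "f \<in> borel_measurable M" and A: "A \<in> sets M" "emeasure M A < \<infinity>"
    and i: "integrable M (\<lambda>x. indicator A x * (f x)\<^sup>2)"
  shows "integrable M (\<lambda>x. indicator A x * \<bar>f x :: real\<bar>)"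
    and "(\<integral>x. indicator A x * \<bar>f x\<bar> \<partial>M)\<^sup>2 \<le> measure M A * (\<integral>x. indicator A x * (f x)\<^sup>2 \<partial>M)"
proof -
  note [measurable] = f A(1)
  have iA: "integrable M (indicator A :: _ \<Rightarrow> real)"
    using A by simp
  show ia: "integrable M (\<lambda>x. indicator A x * \<bar>f x\<bar>)"
  proof (rule Bochner_Integration.integrable_bound)
    show "integrable M (\<lambda>x. indicator A x + indicator A x * (f x)\<^sup>2)"
      using iA i by simp
    show "AE x in M. norm (indicator A x * \<bar>f x\<bar>) \<le> norm (indicator A x + indicator A x * (f x)\<^sup>2)"
    proof (rule AE_I2)
      fix x
      have "0 \<le> (\<bar>f x\<bar> - 1)\<^sup>2" "0 \<le> (f x)\<^sup>2"
        by simp_all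
      then have "\<bar>f x\<bar> \<le> 1 + (f x)\<^sup>2"
        by (simp add: power2_diff)
      then show "norm (indicator A x * \<bar>f x\<bar>) \<le> norm (indicator A x + indicator A x * (f x)\<^sup>2)"
        by (auto simp: indicator_def)
    qed
  qed simp
  define V where "V = measure M A"
  define m where "m = (\<integral>x. indicator A x * \<bar>f x\<bar> \<partial>M)"
  define I where "I = (\<integral>x. indicator A x * (f x)\<^sup>2 \<partial>M)"
  have "m\<^sup>2 \<le> V * I"
  proof (cases "V = 0")
    case True
    then have "emeasure M A = 0"
      using A by (simp add: V_def emeasure_eq_ennreal_measure)
    then have "AE x in M. x \<notin> A"
      using A(1) by (intro AE_not_in) auto
    then have "m = (\<integral>x. 0 \<partial>M)"
      unfolding m_def by (intro integral_cong_AE) (auto elim!: eventually_mono)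
    then show ?thesis
      using True by simp
  next
    case False
    then have V: "V > 0"
      using measure_nonneg[of M A] by (simp add: V_def less_le)
    have "0 \<le> (\<integral>x. indicator A x * (V * \<bar>f x\<bar> - m)\<^sup>2 \<partial>M)"
      by simp
    also have "\<dots> = (\<integral>x. V\<^sup>2 * (indicator A x * (f x)\<^sup>2) - (2 * V * m) * (indicator A x * \<bar>f x\<bar>) + m\<^sup>2 * indicator A x \<partial>M)"
      by (intro Bochner_Integration.integral_cong) (auto simp: indicator_def power2_diff power_mult_distrib algebra_simps)
    also have "\<dots> = V\<^sup>2 * I - (2 * V * m) * m + m\<^sup>2 * V"
      using iA i ia A by (simp add: I_def m_def V_def)
    also have "\<dots> = V * (V * I - m\<^sup>2)"
      by (simp add: power2_eq_square algebra_simps)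
    finally show ?thesis
      using V by (simp add: zero_le_mult_iff)
  qed
  then show "(\<integral>x. indicator A x * \<bar>f x\<bar> \<partial>M)\<^sup>2 \<le> measure M A * (\<integral>x. indicator A x * (f x)\<^sup>2 \<partial>M)"
    by (simp add: m_def I_def V_def)
qed

lemma segment_int_add:
  assumes "integrable lborel f" "integrable lborel g"
  shows "segment_int a x (\<lambda>s. f s + g s) = segment_int a x f + segment_int a x g"
  using integrable_oriented_ind[OF assms(1)] integrable_oriented_ind[OF assms(2)]
  by (simp add: segment_int_def distrib_left)

lemma segment_int_FTC:
  assumes F: "\<And>x. (F has_real_derivative f x) (at x)" and f: "continuous_on UNIV f"
  shows "segment_int a x f = F x - F a"
proof -
  have [measurable]: "f \<in> borel_measurable borel"
    using f by (rule borel_measurable_continuous_onI)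
  have FTC: "(\<integral>x. f x * indicator {a..b} x \<partial>lborel) = F b - F a" if "a \<le> b" for a b
    using f by (intro integral_FTC_Icc_real[OF that F]) (auto simp: continuous_on_eq_continuous_at)
  show ?thesis
  proof (cases "a \<le> x")
    case True
    have "segment_int a x f = (\<integral>s. f s * indicator {a..x} s \<partial>lborel)"
      unfolding segment_int_def
    proof (rule integral_cong_AE)
      show "AE s in lborel. oriented_ind a x s * f s = f s * indicator {a..x} s"
        using AE_lborel_singleton[of a] AE_lborel_singleton[of x]
        by eventually_elim (use True in \<open>auto simp: oriented_ind_def indicator_def\<close>)
    qed auto
    then show ?thesis
      using FTC[OF True] by simp
  next
    case False
    then have xa: "x \<le> a" by simp
    have "segment_int a x f = (\<integral>s. - (f s * indicator {x..a} s) \<partial>lborel)"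
      unfolding segment_int_def
    proof (rule integral_cong_AE)
      show "AE s in lborel. oriented_ind a x s * f s = - (f s * indicator {x..a} s)"
        using AE_lborel_singleton[of a] AE_lborel_singleton[of x]
        by eventually_elim (use False in \<open>auto simp: oriented_ind_def indicator_def\<close>)
    qed auto
    then show ?thesis
      using FTC[OF xa] by simp
  qed
qed

lemma borel_rep_zero: "borel_rep S f g \<Longrightarrow> x \<notin> S \<Longrightarrow> g x = 0"
  by (simp add: borel_rep_def)

section \<open>Traces on vertical sides\<close>

text \<open>Common form of the two boundary measures, so that results on traces are proved once and
  used with \<open>a\<close> = 0 and \<open>a\<close> = \<open>L\<close>.\<close>

definition side :: "real \<Rightarrow> real \<Rightarrow> (real \<times> real) measure" where
  "side L a = restrict_space (vertical_length a) ({a} \<times> {0..L})"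

lemma ds_eq_side: "L > 0 \<Longrightarrow> ds\<^sub>1 L = side L 0" "L > 0 \<Longrightarrow> ds\<^sub>3 L = side L L"
  by (simp_all add: ds\<^sub>1_def ds\<^sub>3_def side_def \<Gamma>\<^sub>1_eq \<Gamma>\<^sub>3_eq)

lemma side_integral:
  fixes f :: "real \<times> real \<Rightarrow> real"
  assumes f: "f \<in> borel_measurable (side L a)"
  shows "(\<lambda>y. indicator {0..L} y * f (a, y)) \<in> borel_measurable borel"
    and "(LINT p|side L a. f p) = (\<integral>y. indicator {0..L} y * f (a, y) \<partial>lborel)"
    and "integrable (side L a) f \<longleftrightarrow> integrable lborel (\<lambda>y. indicator {0..L} y * f (a, y))"
proof -
  let ?S = "{a} \<times> {0..L}"
  have S: "?S \<inter> space (vertical_length a) \<in> sets (vertical_length a)"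
    by (auto simp: vertical_length_def intro!: borel_closed closed_Times)
  have [measurable]: "Pair a \<in> borel \<rightarrow>\<^sub>M borel"
    by (intro borel_measurable_continuous_onI continuous_intros)
  have m: "(\<lambda>p. indicator ?S p * f p) \<in> borel_measurable borel"
    using f S by (simp add: side_def borel_measurable_restrict_space_iff vertical_length_def)
  have eq: "indicator ?S (a, y) * f (a, y) = indicator {0..L} y * f (a, y)" for y
    by (simp add: indicator_def)
  show "(\<lambda>y. indicator {0..L} y * f (a, y)) \<in> borel_measurable borel"
    using measurable_compose[OF _ m, of "Pair a" borel] by (simp add: eq)
  show "(LINT p|side L a. f p) = (\<integral>y. indicator {0..L} y * f (a, y) \<partial>lborel)"
    using m integral_restrict_space[OF S, of f] by (simp add: side_def vertical_length_def integral_distr eq)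
  show "integrable (side L a) f \<longleftrightarrow> integrable lborel (\<lambda>y. indicator {0..L} y * f (a, y))"
    using m integrable_restrict_space[OF S, of f] by (simp add: side_def vertical_length_def integrable_distr_eq eq)
qed

lemma continuous_square_integrable_side:
  assumes w: "continuous_on UNIV w"
  shows "square_integrable (side L a) w"
proof -
  have m: "w \<in> borel_measurable (side L a)"
    unfolding side_def using borel_measurable_continuous_onI[OF w]
    by (intro measurable_restrict_space1) (simp add: vertical_length_def)
  have "integrable lborel (\<lambda>y. indicator {0..L} y *\<^sub>R (w (a, y))\<^sup>2)"
    by (intro borel_integrable_compact continuous_intros continuous_on_slice[OF w]) auto
  then have "integrable (side L a) (\<lambda>p. (w p)\<^sup>2)"
    using m by (subst side_integral(3)) auto
  then show ?thesis
    using m by (simp add: square_integrable_def)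
qed

lemma measure_square: "emeasure lborel (\<Omega> L) < \<infinity>"
  by (intro emeasure_bounded_finite[unfolded less_top]) (auto simp: \<Omega>_def intro: bounded_Times)

lemma square_integrable_rep:
  assumes u: "square_integrable (lebesgue_on (\<Omega> L)) u" and r: "borel_rep (\<Omega> L) u u'"
  shows "integrable lborel u'" "integrable lborel (\<lambda>p. (u' p)\<^sup>2)"
    "(\<integral>p. (u' p)\<^sup>2 \<partial>lborel) = (L2_norm (lebesgue_on (\<Omega> L)) u)\<^sup>2"
  using square_integrable_imp_integrable[OF finite_measure_square u] u borel_rep_integral[OF square_borel r]
    borel_rep_integral[OF square_borel borel_rep_power2[OF r]]
  by (auto simp: square_integrable_def L2_norm_sq)

lemma integral_abs_le_L2_norm:
  assumes u: "square_integrable (lebesgue_on (\<Omega> L)) u" and r: "borel_rep (\<Omega> L) u u'"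
  shows "(\<integral>p. \<bar>u' p\<bar> \<partial>lborel) \<le> sqrt (measure lborel (\<Omega> L)) * L2_norm (lebesgue_on (\<Omega> L)) u"
proof -
  have z: "indicator (\<Omega> L) p * (u' p)\<^sup>2 = (u' p)\<^sup>2" "indicator (\<Omega> L) p * \<bar>u' p\<bar> = \<bar>u' p\<bar>" for p
    using borel_rep_zero[OF r, of p] by (cases "p \<in> \<Omega> L"; simp)+
  have "(\<integral>p. \<bar>u' p\<bar> \<partial>lborel)\<^sup>2 \<le> measure lborel (\<Omega> L) * (L2_norm (lebesgue_on (\<Omega> L)) u)\<^sup>2"
    using integral_abs_power2_le(2)[of u' lborel "\<Omega> L"] square_integrable_rep[OF u r] measure_square r
    by (simp add: z borel_rep_def)
  then have "(\<integral>p. \<bar>u' p\<bar> \<partial>lborel) \<le> sqrt (measure lborel (\<Omega> L) * (L2_norm (lebesgue_on (\<Omega> L)) u)\<^sup>2)"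
    by (rule real_le_rsqrt)
  then show ?thesis
    by (simp add: real_sqrt_mult L2_norm_def)
qed

lemma L2_norm_nonneg: "L2_norm M u \<ge> 0"
  by (simp add: L2_norm_def)

lemma L2_norm_le_H1_norm:
  "L2_norm (lebesgue_on S) u \<le> H1_norm S u" "H1_seminorm S u \<le> H1_norm S u"
  unfolding H1_norm_def by (intro real_le_rsqrt; simp)+

lemma weak_partial_fst_le_H1_seminorm:
  assumes "u \<in> H1 (\<Omega> L)"
  shows "L2_norm (lebesgue_on (\<Omega> L)) (weak_partial (\<Omega> L) (1, 0) u) \<le> H1_seminorm (\<Omega> L) u"
proof (rule power2_le_imp_le)
  show "(L2_norm (lebesgue_on (\<Omega> L)) (weak_partial (\<Omega> L) (1, 0) u))\<^sup>2 \<le> (H1_seminorm (\<Omega> L) u)\<^sup>2"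
    unfolding H1_seminorm_sq[OF assms] by (simp add: L2_norm_sq)
qed (simp add: H1_seminorm_def L2_norm_nonneg)

lemma L2_norm_cong_AE:
  assumes "AE x in M. u x = v x" "u \<in> borel_measurable M" "v \<in> borel_measurable M"
  shows "L2_norm M u = L2_norm M v"
  unfolding L2_norm_def using assms by (auto intro!: arg_cong[where f = sqrt] integral_cong_AE elim!: eventually_mono)

text \<open>For continuously differentiable functions the formula is the fundamental theorem of
  calculus along rows. Each of its three terms is continuous in L1 of the square with respect to the
  convergences in \<open>has_trace\<close>, so the L1 norm of the defect \<open>E\<close> is bounded
  by a null sequence.\<close>

lemma has_trace_representation:
  assumes L: "L > 0" and a: "0 \<le> a" "a \<le> L"
    and t: "has_trace (\<Omega> L) (side L a) u g"
    and ux: "borel_rep (\<Omega> L) (weak_partial (\<Omega> L) (1, 0) u) ux"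
  shows "AE p in lborel. p \<in> \<Omega> L \<longrightarrow> u p = g (a, snd p) + segment_int a (fst p) (\<lambda>s. ux (s, snd p))"
proof -
  have u: "u \<in> H1 (\<Omega> L)" and g: "square_integrable (side L a) g"
    using t by (auto simp: has_trace_def)
  obtain w where w: "\<And>n::nat. C_k 1 (w n)"
    and lim1: "(\<lambda>n. H1_norm (\<Omega> L) (\<lambda>x. w n x - u x)) \<longlonglongrightarrow> 0"
    and lim2: "(\<lambda>n. L2_norm (side L a) (\<lambda>x. w n x - g x)) \<longlonglongrightarrow> 0"
    using t unfolding has_trace_def by blast
  have b: "(1, 0) \<in> (Basis :: (real \<times> real) set)"
    by (simp add: Basis_real_prod)
  have sq: "square_integrable (lebesgue_on (\<Omega> L)) u" "square_integrable (lebesgue_on (\<Omega> L)) (weak_partial (\<Omega> L) (1, 0) u)"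
    using u H1_D(2)[OF u b] by (auto simp: H1_def)
  obtain u' where u': "borel_rep (\<Omega> L) u u'"
    using borel_rep_exists[OF square_borel] sq(1) by (auto simp: square_integrable_def)
  define gb where "gb y = indicator {0..L} y * g (a, y)" for y
  have [measurable]: "gb \<in> borel_measurable borel" "ux \<in> borel_measurable borel" "u' \<in> borel_measurable borel"
    using side_integral(1)[of g L a] g ux u' by (auto simp: gb_def[abs_def] square_integrable_def borel_rep_def)
  have ux_i: "integrable lborel ux" and u'_i: "integrable lborel u'"
    using square_integrable_rep[OF sq(2) ux] square_integrable_rep[OF sq(1) u'] by auto
  define E where "E p = indicator (\<Omega> L) p * (u' p - gb (snd p) - segment_int a (fst p) (\<lambda>s. ux (s, snd p)))" for p
  have [measurable]: "E \<in> borel_measurable borel"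
    unfolding E_def by measurable
  \<comment> \<open>The terms bound the L1 norms of the defects of \<open>w n\<close>, of its
    boundary values and of its first partial. The square roots come from Cauchy-Schwarz; the outer
    factors \<open>L\<close> from integrating quantities that depend on y alone over x.\<close>
  define N where "N n = sqrt (measure lborel (\<Omega> L)) * H1_norm (\<Omega> L) (\<lambda>x. w n x - u x)
      + L * (sqrt L * L2_norm (side L a) (\<lambda>x. w n x - g x))
      + L * (sqrt (measure lborel (\<Omega> L)) * H1_norm (\<Omega> L) (\<lambda>x. w n x - u x))" for n
  have main: "integrable lborel E \<and> (\<integral>p. \<bar>E p\<bar> \<partial>lborel) \<le> N n" for n
  proof -
    let ?d = "\<lambda>p. frechet_derivative (w n) (at p) (1, 0)"
    note C = C_1_partials[OF w[of n]]
    note wH = C_1_in_H1[OF w[of n], of L]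
    have [measurable]: "w n \<in> borel_measurable borel" "?d \<in> borel_measurable borel"
      using C(3)[OF b] C(4) by (auto intro: borel_measurable_continuous_onI)
    define f where "f p = indicator (\<Omega> L) p * w n p - u' p" for p
    define e where "e p = indicator (\<Omega> L) p * ?d p - ux p" for p
    define k where "k y = w n (a, y) - g (a, y)" for y
    have f_rep: "borel_rep (\<Omega> L) (\<lambda>p. w n p - u p) f"
      unfolding f_def by (intro borel_rep_diff borel_rep_borel u') auto
    have e_rep: "borel_rep (\<Omega> L) (\<lambda>p. ?d p - weak_partial (\<Omega> L) (1, 0) u p) e"
      unfolding e_def by (intro borel_rep_diff borel_rep_borel ux) auto
    have fsq: "square_integrable (lebesgue_on (\<Omega> L)) (\<lambda>p. w n p - u p)"
      by (rule square_integrable_diff[OF continuous_square_integrable[OF C(4)] sq(1)])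
    have esq: "square_integrable (lebesgue_on (\<Omega> L)) (\<lambda>p. ?d p - weak_partial (\<Omega> L) (1, 0) u p)"
      by (rule square_integrable_diff[OF continuous_square_integrable[OF C(3)[OF b]] sq(2)])
    have fi: "integrable lborel f" and ei: "integrable lborel e"
      using square_integrable_rep[OF fsq f_rep] square_integrable_rep[OF esq e_rep] by auto
    have A: "(\<integral>p. \<bar>f p\<bar> \<partial>lborel) \<le> sqrt (measure lborel (\<Omega> L)) * H1_norm (\<Omega> L) (\<lambda>x. w n x - u x)"
      using integral_abs_le_L2_norm[OF fsq f_rep] L2_norm_le_H1_norm(1)
      by (smt (verit) mult_left_mono real_sqrt_ge_zero measure_nonneg)
    have "L2_norm (lebesgue_on (\<Omega> L)) (\<lambda>p. ?d p - weak_partial (\<Omega> L) (1, 0) u p)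
      = L2_norm (lebesgue_on (\<Omega> L)) (weak_partial (\<Omega> L) (1, 0) (\<lambda>x. w n x - u x))"
    proof (rule L2_norm_cong_AE)
      show "AE p in lebesgue_on (\<Omega> L). ?d p - weak_partial (\<Omega> L) (1, 0) u p
          = weak_partial (\<Omega> L) (1, 0) (\<lambda>x. w n x - u x) p"
        using H1_diff(2)[OF wH u b] H1_weak_partial_eq[OF wH b C_1_weak_partial[OF w b]]
        by eventually_elim simp
      show "weak_partial (\<Omega> L) (1, 0) (\<lambda>x. w n x - u x) \<in> borel_measurable (lebesgue_on (\<Omega> L))"
        using H1_D(2)[OF H1_diff(1)[OF wH u] b] by (simp add: square_integrable_def)
    qed (use esq in \<open>simp add: square_integrable_def\<close>)
    also have "\<dots> \<le> H1_norm (\<Omega> L) (\<lambda>x. w n x - u x)"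
      using weak_partial_fst_le_H1_seminorm[OF H1_diff(1)[OF wH u]] L2_norm_le_H1_norm(2) order_trans by blast
    finally have B: "(\<integral>p. \<bar>e p\<bar> \<partial>lborel) \<le> sqrt (measure lborel (\<Omega> L)) * H1_norm (\<Omega> L) (\<lambda>x. w n x - u x)"
      using integral_abs_le_L2_norm[OF esq e_rep]
      by (smt (verit) mult_left_mono real_sqrt_ge_zero measure_nonneg)
    define kb where "kb y = indicator {0..L} y * k y" for y
    have ksq: "square_integrable (side L a) (\<lambda>x. w n x - g x)"
      by (rule square_integrable_diff[OF continuous_square_integrable_side[OF C(4)] g])
    have km: "kb \<in> borel_measurable borel"
      using side_integral(1)[of "\<lambda>x. w n x - g x" L a] ksq by (simp add: kb_def[abs_def] k_def square_integrable_def)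
    have kk: "(\<lambda>y. indicator {0..L} y * (kb y)\<^sup>2) = (\<lambda>y. indicator {0..L} y * (w n (a, y) - g (a, y))\<^sup>2)"
      "(\<lambda>y. indicator {0..L} y * \<bar>kb y\<bar>) = (\<lambda>y. \<bar>kb y\<bar>)"
      by (auto simp: kb_def k_def indicator_def fun_eq_iff)
    have "integrable lborel (\<lambda>y. indicator {0..L} y * (kb y)\<^sup>2)"
      using ksq unfolding kk by (subst side_integral(3)[symmetric]) (auto simp: square_integrable_def)
    from integral_abs_power2_le[OF _ _ _ this] km L
    have ki: "integrable lborel (\<lambda>y. \<bar>kb y\<bar>)"
      and k2: "(\<integral>y. \<bar>kb y\<bar> \<partial>lborel)\<^sup>2 \<le> L * (\<integral>y. indicator {0..L} y * (kb y)\<^sup>2 \<partial>lborel)"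
      by (auto simp: kk(2))
    have "(\<integral>y. indicator {0..L} y * (kb y)\<^sup>2 \<partial>lborel) = (L2_norm (side L a) (\<lambda>x. w n x - g x))\<^sup>2"
      using ksq unfolding kk L2_norm_sq by (subst side_integral(2)) (auto simp: square_integrable_def)
    with k2 have "(\<integral>y. \<bar>kb y\<bar> \<partial>lborel) \<le> sqrt (L * (L2_norm (side L a) (\<lambda>x. w n x - g x))\<^sup>2)"
      by (intro real_le_rsqrt) simp
    then have D: "(\<integral>y. \<bar>kb y\<bar> \<partial>lborel) \<le> sqrt L * L2_norm (side L a) (\<lambda>x. w n x - g x)"
      by (simp add: real_sqrt_mult L2_norm_nonneg)
    define I :: "real \<Rightarrow> real" where "I = indicator {0<..<L}"
    have I: "integrable lborel I" "(\<integral>x. I x \<partial>lborel) = L"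
      using L by (auto simp: I_def intro!: integrable_indicator_bounded)
    define ea where "ea y = (\<integral>s. \<bar>e (s, y)\<bar> \<partial>lborel)" for y
    have eai: "integrable lborel ea" and eaI: "(\<integral>y. ea y \<partial>lborel) = (\<integral>p. \<bar>e p\<bar> \<partial>lborel)"
      unfolding ea_def using lborel_Fubini[OF integrable_abs[OF ei]] by auto
    define K where "K p = \<bar>f p\<bar> + I (fst p) * \<bar>kb (snd p)\<bar> + I (fst p) * ea (snd p)" for p
    have Ki: "integrable lborel K"
      unfolding K_def using fi by (intro Bochner_Integration.integrable_add integrable_lborel_prod I ki eai) auto
    have "(\<integral>p. K p \<partial>lborel) = (\<integral>p. \<bar>f p\<bar> \<partial>lborel) + L * (\<integral>y. \<bar>kb y\<bar> \<partial>lborel) + L * (\<integral>p. \<bar>e p\<bar> \<partial>lborel)"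
      unfolding K_def using fi integrable_lborel_prod[OF I(1) ki] integrable_lborel_prod[OF I(1) eai]
      by (simp add: I(2) eaI)
    then have KN: "(\<integral>p. K p \<partial>lborel) \<le> N n"
      unfolding N_def using A B D L by (smt (verit) mult_left_mono)
    have bound: "AE p in lborel. \<bar>E p\<bar> \<le> K p"
      using AE_lborel_fst_snd(2)[OF lborel_Fubini(4)[OF ei]] AE_lborel_fst_snd(2)[OF lborel_Fubini(4)[OF ux_i]]
    proof eventually_elim
      case (elim p)
      have nonneg: "0 \<le> K p"
        by (auto simp: K_def I_def ea_def integral_nonneg_AE)
      show ?case
      proof (cases "p \<in> \<Omega> L")
        case True
        then obtain x y where p: "p = (x, y)" "0 < x" "x < L" "0 < y" "y < L"
          by (auto simp: \<Omega>_def)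
        have "w n (x, y) - w n (a, y) = segment_int a x (\<lambda>s. ?d (s, y))"
          by (rule segment_int_FTC[symmetric, where F = "\<lambda>x. w n (x, y)"])
            (use C(1) continuous_on_slice(1)[OF C(3)[OF b]] in auto)
        \<comment> \<open>The weight is nonzero only strictly between \<open>a\<close> and
          \<open>x\<close>, so the points involved lie in the open square even when \<open>a\<close>
          is 0 or \<open>L\<close>. There the extensions by zero in \<open>e\<close> and
          \<open>ux\<close> are harmless.\<close>
        also have "\<dots> = segment_int a x (\<lambda>s. e (s, y) + ux (s, y))"
          unfolding segment_int_def using a p
          by (intro Bochner_Integration.integral_cong) (auto simp: oriented_ind_def e_def \<Omega>_def indicator_def)
        also have "\<dots> = segment_int a x (\<lambda>s. e (s, y)) + segment_int a x (\<lambda>s. ux (s, y))"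
          using elim by (intro segment_int_add) (auto simp: p)
        finally have "E p = - f p + kb y + segment_int a x (\<lambda>s. e (s, y))"
          using True p by (simp add: E_def f_def kb_def k_def gb_def)
        moreover have "\<bar>segment_int a x (\<lambda>s. e (s, y))\<bar> \<le> ea y"
          unfolding ea_def using elim by (intro segment_int_bound) (simp add: p)
        ultimately show ?thesis
          using p by (simp add: K_def I_def)
      next
        case False
        then show ?thesis
          using nonneg by (simp add: E_def)
      qed
    qed
    have Ei: "integrable lborel E"
      by (rule Bochner_Integration.integrable_bound[OF Ki]) (use bound in \<open>auto elim!: eventually_mono\<close>)
    have "(\<integral>p. \<bar>E p\<bar> \<partial>lborel) \<le> (\<integral>p. K p \<partial>lborel)"
      using Ei Ki bound by (intro integral_mono_AE) auto
    with KN Ei show ?thesis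
      by linarith
  qed
  have "N \<longlonglongrightarrow> sqrt (measure lborel (\<Omega> L)) * 0 + L * (sqrt L * 0) + L * (sqrt (measure lborel (\<Omega> L)) * 0)"
    unfolding N_def by (intro tendsto_intros lim1 lim2)
  then have "(\<integral>p. \<bar>E p\<bar> \<partial>lborel) \<le> 0"
    using main by (intro LIMSEQ_le_const[of N 0]) auto
  moreover have "0 \<le> (\<integral>p. \<bar>E p\<bar> \<partial>lborel)"
    by simp
  ultimately have "(\<integral>p. \<bar>E p\<bar> \<partial>lborel) = 0"
    by linarith
  then have "AE p in lborel. E p = 0"
    using main by (subst (asm) integral_nonneg_eq_0_iff_AE) auto
  moreover have "AE p in lborel. p \<in> \<Omega> L \<longrightarrow> u p = u' p"
    using u' by (simp add: borel_rep_def)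
  ultimately show ?thesis
    by eventually_elim (auto simp: E_def gb_def \<Omega>_def)
qed

lemma AE_interval_ex:
  assumes "AE x in lborel. x \<in> {a<..<b::real} \<longrightarrow> P x" "a < b"
  obtains x where "a < x" "x < b" "P x"
proof (rule ccontr)
  assume "\<not> thesis"
  with that have "\<not> P x" if "x \<in> {a<..<b}" for x
    using that by auto
  with assms(1) have "AE x in lborel. x \<notin> {a<..<b}"
    by (auto elim!: eventually_mono)
  then have "emeasure lborel {a<..<b} = 0"
    by (subst (asm) AE_iff_measurable[where N = "{a<..<b}"]) auto
  then show False
    using assms(2) by simp
qed

lemma AE_square_snd:
  assumes "AE p in lborel. p \<in> \<Omega> L \<longrightarrow> P (snd p)" "L > 0"
  shows "AE y in lborel. y \<in> {0<..<L} \<longrightarrow> P y"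
  using AE_lborel_pairD(2)[OF assms(1)]
proof eventually_elim
  case (elim y)
  show ?case
  proof
    assume "y \<in> {0<..<L}"
    with elim have "AE x in lborel. x \<in> {0<..<L} \<longrightarrow> P y"
      by (auto simp: \<Omega>_def elim!: eventually_mono)
    then show "P y"
      by (rule AE_interval_ex[of 0 L "\<lambda>_. P y"]) (use assms(2) in auto)
  qed
qed

text \<open>Two traces of one function enter the same representation formula, and the integral terms
  cancel. This gives access to \<open>boundary_trace\<close>, which is a choice.\<close>

lemma has_trace_unique:
  assumes L: "L > 0" and a: "0 \<le> a" "a \<le> L"
    and t: "has_trace (\<Omega> L) (side L a) u g" "has_trace (\<Omega> L) (side L a) u g'"
  shows "AE y in lborel. y \<in> {0<..<L} \<longrightarrow> g (a, y) = g' (a, y)"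
proof -
  have u: "u \<in> H1 (\<Omega> L)"
    using t by (auto simp: has_trace_def)
  obtain ux where ux: "borel_rep (\<Omega> L) (weak_partial (\<Omega> L) (1, 0) u) ux"
    using borel_rep_exists[OF square_borel] H1_D(2)[OF u, of "(1, 0)"]
    by (auto simp: square_integrable_def Basis_real_prod)
  have "AE p in lborel. p \<in> \<Omega> L \<longrightarrow> g (a, snd p) = g' (a, snd p)"
    using has_trace_representation[OF L a t(1) ux] has_trace_representation[OF L a t(2) ux]
    by eventually_elim auto
  then show ?thesis
    using L by (rule AE_square_snd)
qed

section \<open>Representation of H2 functions with the boundary conditions\<close>

lemma bumps_integral_deriv:
  assumes \<beta>: "\<beta> \<in> bumps L"
  shows "(\<integral>x. deriv \<beta> x \<partial>lborel) = 0"
proof -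
  have L: "0 \<le> \<bar>L\<bar>" by simp
  have cont: "isCont (deriv \<beta>) x" for x
    using bumps_continuous[OF bumps_deriv[OF \<beta>], of UNIV] by (simp add: continuous_on_eq_continuous_at)
  have "deriv \<beta> x = 0" if "x \<notin> {0..\<bar>L\<bar>}" for x
    using bumps_zero[OF bumps_deriv[OF \<beta>], of x] that by force
  then have "(\<lambda>x. deriv \<beta> x * indicator {0..\<bar>L\<bar>} x) = deriv \<beta>"
    by (auto simp: indicator_def fun_eq_iff)
  moreover have "(\<integral>x. deriv \<beta> x * indicator {0..\<bar>L\<bar>} x \<partial>lborel) = \<beta> \<bar>L\<bar> - \<beta> 0"
    by (rule integral_FTC_Icc_real[OF L bumps_DERIV[OF \<beta>] cont])
  ultimately show ?thesis
    using bumps_zero[OF \<beta>, of 0] bumps_zero[OF \<beta>, of "\<bar>L\<bar>"] abs_ge_self[of L] by simp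
qed

lemma oriented_ind_tendsto:
  assumes "y \<longlonglongrightarrow> y0" "s \<noteq> y0"
  shows "(\<lambda>n. oriented_ind a (y n) s) \<longlonglongrightarrow> oriented_ind a y0 s"
proof -
  consider "s < y0" | "y0 < s" using assms(2) by linarith
  then have "eventually (\<lambda>n. oriented_ind a (y n) s = oriented_ind a y0 s) sequentially"
  proof cases
    case 1
    from order_tendstoD(1)[OF assms(1) 1] show ?thesis
      by eventually_elim (use 1 in \<open>auto simp: oriented_ind_def\<close>)
  next
    case 2
    from order_tendstoD(2)[OF assms(1) 2] show ?thesis
      by eventually_elim (use 2 in \<open>auto simp: oriented_ind_def\<close>)
  qed
  then show ?thesis
    by (rule tendsto_eventually)
qed

lemma segment_int_tendsto:
  assumes f: "integrable lborel f" and y: "y \<longlonglongrightarrow> y0"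
  shows "(\<lambda>n. segment_int a (y n) f) \<longlonglongrightarrow> segment_int a y0 f"
  unfolding segment_int_def
proof (rule integral_dominated_convergence[where w = "\<lambda>s. \<bar>f s\<bar>"])
  show "AE s in lborel. (\<lambda>n. oriented_ind a (y n) s * f s) \<longlonglongrightarrow> oriented_ind a y0 s * f s"
    using AE_lborel_singleton[of y0] by eventually_elim (intro tendsto_intros oriented_ind_tendsto y)
  show "AE s in lborel. norm (oriented_ind a (y n) s * f s) \<le> \<bar>f s\<bar>" for n
    using abs_oriented_ind by (auto simp: abs_mult intro!: mult_left_le_one_le)
qed (use f in auto)

text \<open>Fubini yields identities for almost every height, while mesh nodes sit at particular
  heights, including 0 and \<open>L\<close>. Sequential continuity closes this gap.\<close>

lemma AE_zero_imp_zero: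
  fixes M :: "real \<Rightarrow> real"
  assumes ae: "AE y in lborel. y \<in> {0<..<L} \<longrightarrow> M y = 0" and L: "L > 0" and y0: "y0 \<in> {0..L}"
    and cont: "\<And>y. y \<longlonglongrightarrow> y0 \<Longrightarrow> (\<lambda>n. M (y n)) \<longlonglongrightarrow> M y0"
  shows "M y0 = 0"
proof -
  have "\<exists>y. \<bar>y - y0\<bar> < inverse (real (Suc n)) \<and> M y = 0" for n
  proof -
    define r where "r = inverse (real (Suc n))"
    have r: "r > 0" by (simp add: r_def)
    \<comment> \<open>Clipping to (0, \<open>L\<close>) covers the end points, near which only
      one-sided neighbourhoods are available.\<close>
    have "AE y in lborel. y \<in> {max 0 (y0 - r)<..<min L (y0 + r)} \<longrightarrow> M y = 0"
      using ae by (auto elim!: eventually_mono)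
    moreover have "max 0 (y0 - r) < min L (y0 + r)"
      using r y0 L by auto
    ultimately obtain y where "max 0 (y0 - r) < y" "y < min L (y0 + r)" "M y = 0"
      by (rule AE_interval_ex)
    then show ?thesis
      unfolding r_def[symmetric] by (intro exI[of _ y]) auto
  qed
  then obtain y where y: "\<And>n. \<bar>y n - y0\<bar> < inverse (real (Suc n))" "\<And>n. M (y n) = 0"
    by metis
  have "(\<lambda>n. y n - y0) \<longlonglongrightarrow> 0"
    by (rule Lim_null_comparison[OF _ LIMSEQ_inverse_real_of_nat]) (use y(1) in \<open>auto intro!: always_eventually less_imp_le\<close>)
  then have "y \<longlonglongrightarrow> y0"
    by (simp add: LIM_zero_iff)
  from cont[OF this] have "(\<lambda>n. 0) \<longlonglongrightarrow> M y0"
    by (simp add: y(2))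
  then show ?thesis
    using LIMSEQ_unique[OF tendsto_const] by metis
qed

lemma Basis_real_prod_mem: "(1, 0) \<in> (Basis :: (real \<times> real) set)" "(0, 1) \<in> (Basis :: (real \<times> real) set)"
  by (auto simp: Basis_real_prod)

lemma H1_rep_bumps:
  assumes u: "u \<in> H1 (\<Omega> L)" and r: "borel_rep (\<Omega> L) u u'" "borel_rep (\<Omega> L) (weak_partial (\<Omega> L) b u) g" "b \<in> Basis"
    and ab: "\<alpha> \<in> bumps L" "\<beta> \<in> bumps L"
  shows "b = (1, 0) \<Longrightarrow> (\<integral>p. u' p * (deriv \<alpha> (fst p) * \<beta> (snd p)) \<partial>lborel)
      = - (\<integral>p. g p * (\<alpha> (fst p) * \<beta> (snd p)) \<partial>lborel)"
    and "b = (0, 1) \<Longrightarrow> (\<integral>p. u' p * (\<alpha> (fst p) * deriv \<beta> (snd p)) \<partial>lborel)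
      = - (\<integral>p. g p * (\<alpha> (fst p) * \<beta> (snd p)) \<partial>lborel)"
  using weak_partial_bumps[OF H1_D(1)[OF u r(3)] r(1,2) ab] by auto

lemma H1_rep_integrable:
  assumes u: "u \<in> H1 (\<Omega> L)" and b: "b \<in> Basis" and r: "borel_rep (\<Omega> L) (weak_partial (\<Omega> L) b u) g"
  shows "integrable lborel g" "integrable lborel (\<lambda>p. (g p)\<^sup>2)"
  using square_integrable_rep[OF H1_D(2)[OF u b] r] by auto

text \<open>Here \<open>H\<close> is the derivative of \<open>F\<close> in the second variable and
  \<open>q\<close> the mixed derivative. No additive function of y appears in the conclusion because
  \<open>F\<close> is constant on the left side, so its tangential derivative vanishes there. In the
  weak form the integral in x is moved to the test function, \<open>P\<close> is replaced by its own
  representation, and the integral in y is moved as well; the terms with \<open>c\<close> and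
  \<open>p0\<close> drop out since the derivative of \<beta> has mean zero.\<close>

lemma mixed_partial_representation:
  assumes i: "integrable lborel F" "integrable lborel P" "integrable lborel H" "integrable lborel q" "integrable lborel p0"
    and FH: "\<And>\<alpha> \<beta>. \<alpha> \<in> bumps L \<Longrightarrow> \<beta> \<in> bumps L \<Longrightarrow>
      (\<integral>p. F p * (\<alpha> (fst p) * deriv \<beta> (snd p)) \<partial>lborel) = - (\<integral>p. H p * (\<alpha> (fst p) * \<beta> (snd p)) \<partial>lborel)"
    and FP: "AE p in lborel. p \<in> \<Omega> L \<longrightarrow> F p = c + segment_int 0 (fst p) (\<lambda>s. P (s, snd p))"
    and Pq: "AE p in lborel. p \<in> \<Omega> L \<longrightarrow> P p = p0 (fst p) + segment_int 0 (snd p) (\<lambda>t. q (fst p, t))"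
  shows "AE p in lborel. p \<in> \<Omega> L \<longrightarrow> H p = segment_int 0 (fst p) (\<lambda>s. q (s, snd p))"
proof -
  have [measurable]: "F \<in> borel_measurable borel" "P \<in> borel_measurable borel" "H \<in> borel_measurable borel"
    "q \<in> borel_measurable borel" "p0 \<in> borel_measurable borel"
    using i by auto
  define Q where "Q p = segment_int 0 (fst p) (\<lambda>s. q (s, snd p))" for p
  have [measurable]: "Q \<in> borel_measurable borel"
    unfolding Q_def by measurable
  define h where "h p = indicator (\<Omega> L) p * (H p - Q p)" for p
  have iq: "integrable lborel (\<lambda>p. q (prod.swap p))"
    using i by (simp add: lborel_swap)
  have Qi: "integrable lborel (\<lambda>p. Q p * (\<alpha> (fst p) * k (snd p)))"
    if "integrable lborel \<alpha>" "k \<in> borel_measurable borel" "\<And>x. \<bar>k x\<bar> \<le> B" for \<alpha> k B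
  proof -
    have [measurable]: "\<alpha> \<in> borel_measurable borel" "k \<in> borel_measurable borel"
      using that by auto
    have "(\<lambda>p. Q p * (\<alpha> (fst p) * k (snd p))) \<in> borel_measurable borel"
      by measurable
    from lborel_swap(2)[OF this] segment_int_integrable[OF iq that(2,3,1)] show ?thesis
      by (simp add: Q_def mult.commute[of "k _"])
  qed
  have h: "integrable lborel h"
  proof -
    have "integrable lborel (\<lambda>p. Q p * (indicator {0<..<L} (fst p) * indicator {0<..<L} (snd p)))"
      by (rule Qi[where B = 1]) (auto intro!: integrable_indicator_bounded)
    then have "integrable lborel (\<lambda>p. indicator (\<Omega> L) p * H p - Q p * (indicator {0<..<L} (fst p) * indicator {0<..<L} (snd p)))"
      using integrable_mult_indicator[OF _ i(3), of "\<Omega> L"] by auto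
    then show ?thesis
      unfolding h_def by (rule back_subst[of "integrable lborel"]) (auto simp: fun_eq_iff \<Omega>_def indicator_def)
  qed
  have "AE p in lborel. p \<in> \<Omega> L \<longrightarrow> h p = 0"
  proof (rule fundamental_lemma)
    show "h \<in> borel_measurable borel"
      using h by auto
    show "integrable lborel (\<lambda>p. indicator K p * h p)" if "compact K" "K \<subseteq> \<Omega> L" for K
      using integrable_mult_indicator[OF _ h, of K] that(1) by (simp add: compact_imp_closed)
    fix \<alpha> \<beta> assume ab: "\<alpha> \<in> bumps L" "\<beta> \<in> bumps L"
    note d = bumps_deriv[OF ab(2)]
    note [measurable] = ab[THEN bumps_borel] d[THEN bumps_borel]
    obtain B where B: "\<And>x. \<bar>\<beta> x\<bar> \<le> B" "B \<ge> 0"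
      by (rule bumps_bounded[OF ab(2)]) (rule that)
    obtain B' where B': "\<And>x. \<bar>deriv \<beta> x\<bar> \<le> B'" "B' \<ge> 0"
      by (rule bumps_bounded[OF d]) (rule that)
    \<comment> \<open>For s in (0, \<open>L\<close>) this is the integral of \<alpha> beyond s. It
      is bounded and vanishes off (0, \<open>L\<close>), but jumps at 0 unless \<alpha> has mean
      zero, so from here on it acts only as a bounded Borel factor.\<close>
    define A where "A s = (\<integral>x. oriented_ind 0 x s * \<alpha> x \<partial>lborel)" for s
    have [measurable]: "A \<in> borel_measurable borel"
      unfolding A_def by (rule segment_weight_measurable) simp
    have A: "\<bar>A s\<bar> \<le> (\<integral>x. \<bar>\<alpha> x\<bar> \<partial>lborel)" for s
      unfolding A_def by (rule segment_weight_bound[OF bumps_integrable[OF ab(1)]])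
    have A0: "A s = 0" if "s \<notin> {0<..<L}" for s
    proof -
      have "(\<lambda>x. oriented_ind 0 x s * \<alpha> x) = (\<lambda>x. 0)"
        using that bumps_zero[OF ab(1)] by (auto simp: oriented_ind_def fun_eq_iff)
      then show ?thesis
        by (simp add: A_def)
    qed
    have p0A: "integrable lborel (\<lambda>x. p0 x * A x)"
    proof (rule Bochner_Integration.integrable_bound)
      show "integrable lborel (\<lambda>x. p0 x * (\<integral>x. \<bar>\<alpha> x\<bar> \<partial>lborel))"
        using i(5) by simp
      show "AE x in lborel. norm (p0 x * A x) \<le> norm (p0 x * (\<integral>x. \<bar>\<alpha> x\<bar> \<partial>lborel))"
        using A by (intro AE_I2) (simp add: abs_mult integral_nonneg_AE mult_left_mono)
    qed simp
    have Qab: "(\<integral>p. Q p * (\<alpha> (fst p) * \<beta> (snd p)) \<partial>lborel) = (\<integral>p. q p * (A (fst p) * \<beta> (snd p)) \<partial>lborel)"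
      unfolding Q_def A_def
      by (rule segment_int_duality_fst[OF i(4) bumps_borel[OF ab(2)] B(1) bumps_integrable[OF ab(1)]])
    define S where "S p = segment_int 0 (fst p) (\<lambda>s. P (s, snd p))" for p
    have [measurable]: "S \<in> borel_measurable borel"
      unfolding S_def by measurable
    have Si: "integrable lborel (\<lambda>p. S p * (\<alpha> (fst p) * deriv \<beta> (snd p)))"
    proof -
      have "(\<lambda>p. S p * (\<alpha> (fst p) * deriv \<beta> (snd p))) \<in> borel_measurable borel"
        by measurable
      from lborel_swap(2)[OF this] segment_int_integrable[OF _ bumps_borel[OF d] B'(1) bumps_integrable[OF ab(1)], of "\<lambda>p. P (prod.swap p)" 0] i(2)
      show ?thesis
        by (simp add: S_def mult.commute[of "deriv \<beta> _"] lborel_swap)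
    qed
    note ci = integrable_lborel_prod[OF bumps_integrable[OF ab(1)] bumps_integrable[OF d]]
    have "(\<integral>p. F p * (\<alpha> (fst p) * deriv \<beta> (snd p)) \<partial>lborel)
      = (\<integral>p. c * (\<alpha> (fst p) * deriv \<beta> (snd p)) + S p * (\<alpha> (fst p) * deriv \<beta> (snd p)) \<partial>lborel)"
    proof (rule integral_cong_AE)
      show "AE p in lborel. F p * (\<alpha> (fst p) * deriv \<beta> (snd p))
          = c * (\<alpha> (fst p) * deriv \<beta> (snd p)) + S p * (\<alpha> (fst p) * deriv \<beta> (snd p))"
        using FP
      proof eventually_elim
        case (elim p)
        then show ?case
          using bumps_off_square[OF ab(1) d, of p] by (cases "p \<in> \<Omega> L") (auto simp: S_def distrib_right)
      qed
    qed measurable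
    also have "\<dots> = (\<integral>p. S p * (\<alpha> (fst p) * deriv \<beta> (snd p)) \<partial>lborel)"
      using ci Si by (simp add: bumps_integral_deriv[OF ab(2)])
    also have "\<dots> = (\<integral>p. P p * (A (fst p) * deriv \<beta> (snd p)) \<partial>lborel)"
      unfolding S_def A_def
      by (rule segment_int_duality_fst[OF i(2) bumps_borel[OF d] B'(1) bumps_integrable[OF ab(1)]])
    also have "\<dots> = (\<integral>p. (p0 (fst p) * A (fst p)) * deriv \<beta> (snd p)
        + segment_int 0 (snd p) (\<lambda>t. q (fst p, t)) * (A (fst p) * deriv \<beta> (snd p)) \<partial>lborel)"
    proof (rule integral_cong_AE)
      show "AE p in lborel. P p * (A (fst p) * deriv \<beta> (snd p)) = (p0 (fst p) * A (fst p)) * deriv \<beta> (snd p)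
        + segment_int 0 (snd p) (\<lambda>t. q (fst p, t)) * (A (fst p) * deriv \<beta> (snd p))"
        using Pq
      proof eventually_elim
        case (elim p)
        show ?case
        proof (cases "p \<in> \<Omega> L")
          case True
          then show ?thesis
            using elim by (simp add: algebra_simps)
        next
          case False
          then have "A (fst p) = 0 \<or> deriv \<beta> (snd p) = 0"
            using A0[of "fst p"] bumps_zero[OF d, of "snd p"] by (auto simp: \<Omega>_def mem_Times_iff)
          then show ?thesis
            by auto
        qed
      qed
    qed measurable
    also have "\<dots> = (\<integral>p. (p0 (fst p) * A (fst p)) * deriv \<beta> (snd p) \<partial>lborel)
      + (\<integral>p. segment_int 0 (snd p) (\<lambda>t. q (fst p, t)) * (A (fst p) * deriv \<beta> (snd p)) \<partial>lborel)"
    proof (rule Bochner_Integration.integral_add)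
      show "integrable lborel (\<lambda>p. (p0 (fst p) * A (fst p)) * deriv \<beta> (snd p))"
        by (rule integrable_lborel_prod(1)[OF p0A bumps_integrable[OF d]])
      show "integrable lborel (\<lambda>p. segment_int 0 (snd p) (\<lambda>t. q (fst p, t)) * (A (fst p) * deriv \<beta> (snd p)))"
        by (rule segment_int_integrable[OF i(4) _ A bumps_integrable[OF d]]) simp
    qed
    also have "(\<integral>p. (p0 (fst p) * A (fst p)) * deriv \<beta> (snd p) \<partial>lborel) = 0"
      using integrable_lborel_prod(2)[OF p0A bumps_integrable[OF d]] by (simp add: bumps_integral_deriv[OF ab(2)])
    also have "(\<integral>p. segment_int 0 (snd p) (\<lambda>t. q (fst p, t)) * (A (fst p) * deriv \<beta> (snd p)) \<partial>lborel)
      = - (\<integral>p. q p * (A (fst p) * \<beta> (snd p)) \<partial>lborel)"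
      using segment_int_duality_snd[where k = A, OF i(4) _ A bumps_integrable[OF d]]
      by (simp add: bumps_segment_weight[OF ab(2)])
    finally have "(\<integral>p. H p * (\<alpha> (fst p) * \<beta> (snd p)) \<partial>lborel) = (\<integral>p. Q p * (\<alpha> (fst p) * \<beta> (snd p)) \<partial>lborel)"
      using FH[OF ab] Qab by simp
    moreover have "(\<integral>p. h p * (\<alpha> (fst p) * \<beta> (snd p)) \<partial>lborel)
      = (\<integral>p. H p * (\<alpha> (fst p) * \<beta> (snd p)) - Q p * (\<alpha> (fst p) * \<beta> (snd p)) \<partial>lborel)"
      using bumps_off_square[OF ab]
      by (intro Bochner_Integration.integral_cong refl) (auto simp: h_def indicator_def left_diff_distrib)
    ultimately show "(\<integral>p. h p * (\<alpha> (fst p) * \<beta> (snd p)) \<partial>lborel) = 0"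
      using integrable_lborel_times_bumps[OF i(3) ab] Qi[OF bumps_integrable[OF ab(1)] bumps_borel[OF ab(2)] B(1)] by simp
  qed
  then show ?thesis
    by eventually_elim (auto simp: h_def Q_def)
qed

text \<open>Comparing the representations that start at the left and at the right side shows that
  the integral of \<open>P\<close> over almost every row is - \<open>c\<close>. Once
  \<open>P\<close> is expressed by \<open>p0\<close> and \<open>q\<close>, this integral is
  continuous in the height, so the identity holds for every height. It makes the nodal values on the
  right side exactly zero.\<close>

lemma two_traces_representation:
  assumes L: "L > 0" and i: "integrable lborel P" "integrable lborel q" "integrable lborel p0"
    and z: "\<And>p. p \<notin> \<Omega> L \<Longrightarrow> P p = 0" "\<And>p. p \<notin> \<Omega> L \<Longrightarrow> q p = 0"
    and F0: "AE p in lborel. p \<in> \<Omega> L \<longrightarrow> F p = c + segment_int 0 (fst p) (\<lambda>s. P (s, snd p))"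
    and FL: "AE p in lborel. p \<in> \<Omega> L \<longrightarrow> F p = segment_int L (fst p) (\<lambda>s. P (s, snd p))"
    and Pq: "AE p in lborel. p \<in> \<Omega> L \<longrightarrow> P p = p0 (fst p) + segment_int 0 (snd p) (\<lambda>t. q (fst p, t))"
    and y: "y \<in> {0..L}"
  shows "segment_int 0 L (\<lambda>s. p0 s + segment_int 0 y (\<lambda>t. q (s, t))) = - c"
proof -
  have [measurable]: "P \<in> borel_measurable borel" "q \<in> borel_measurable borel" "p0 \<in> borel_measurable borel"
    using i by auto
  define S where "S s y = p0 s + segment_int 0 y (\<lambda>t. q (s, t))" for s y
  define k where "k t = (\<integral>s. q (s, t) \<partial>lborel)" for t
  have k: "integrable lborel k"
    unfolding k_def using lborel_Fubini(6)[OF i(2)] .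
  define c0 where "c0 = segment_int 0 L p0"
  \<comment> \<open>Exchanging the integrals isolates the dependence on the height in the end point
    of a single integral of \<open>k\<close>, which is visibly continuous.\<close>
  have S_eq: "segment_int 0 L (\<lambda>s. S s y) = c0 + segment_int 0 y k" for y
  proof -
    have oi: "integrable lborel (\<lambda>p. oriented_ind 0 y (snd p) * q p)"
      by (rule Bochner_Integration.integrable_bound[OF i(2)])
        (use abs_oriented_ind in \<open>auto simp: abs_mult intro!: mult_left_le_one_le\<close>)
    have si: "integrable lborel (\<lambda>s. segment_int 0 y (\<lambda>t. q (s, t)))"
      using lborel_Fubini(5)[OF oi] by (simp add: segment_int_def)
    have "oriented_ind 0 L s * segment_int 0 y (\<lambda>t. q (s, t)) = segment_int 0 y (\<lambda>t. q (s, t))" for s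
    proof (cases "0 < s \<and> s < L")
      case False
      then have "(\<lambda>t. q (s, t)) = (\<lambda>t. 0)"
        using z(2) by (auto simp: \<Omega>_def)
      then show ?thesis
        by (simp add: segment_int_def)
    qed (simp add: oriented_ind_def)
    then have "segment_int 0 L (\<lambda>s. segment_int 0 y (\<lambda>t. q (s, t))) = (\<integral>s. segment_int 0 y (\<lambda>t. q (s, t)) \<partial>lborel)"
      unfolding segment_int_def[of 0 L] by (simp only:)
    also have "\<dots> = segment_int 0 y k"
      using lborel_Fubini(1,2)[OF oi] by (simp add: segment_int_def k_def)
    finally show ?thesis
      unfolding S_def c0_def using segment_int_add[OF i(3) si] by simp
  qed
  have "AE p in lborel. p \<in> \<Omega> L \<longrightarrow> c + (\<integral>s. P (s, snd p) \<partial>lborel) = 0"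
    using F0 FL AE_lborel_fst_snd(2)[OF lborel_Fubini(4)[OF i(1)]]
  proof eventually_elim
    case (elim p)
    show ?case
    proof
      assume p: "p \<in> \<Omega> L"
      note I = integrable_oriented_ind[OF elim(3)]
      \<comment> \<open>The oriented segments from 0 to the point and from the point to
        \<open>L\<close> together cover the whole row up to one point.\<close>
      have "segment_int 0 (fst p) (\<lambda>s. P (s, snd p)) - segment_int L (fst p) (\<lambda>s. P (s, snd p))
        = (\<integral>s. (oriented_ind 0 (fst p) s - oriented_ind L (fst p) s) * P (s, snd p) \<partial>lborel)"
        unfolding segment_int_def left_diff_distrib using I by simp
      also have "\<dots> = (\<integral>s. P (s, snd p) \<partial>lborel)"
      proof (rule integral_cong_AE)
        show "AE s in lborel. (oriented_ind 0 (fst p) s - oriented_ind L (fst p) s) * P (s, snd p) = P (s, snd p)"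
          using AE_lborel_singleton[of "fst p"]
        proof eventually_elim
          case (elim s)
          show ?case
            by (cases "(s, snd p) \<in> \<Omega> L") (use elim p z(1)[of "(s, snd p)"] in \<open>auto simp: \<Omega>_def oriented_ind_def\<close>)
        qed
      qed measurable
      finally show "c + (\<integral>s. P (s, snd p) \<partial>lborel) = 0"
        using elim p by linarith
    qed
  qed
  from AE_square_snd[OF this L] have 1: "AE y in lborel. y \<in> {0<..<L} \<longrightarrow> c + (\<integral>s. P (s, y) \<partial>lborel) = 0" .
  have "AE y in lborel. y \<in> {0<..<L} \<longrightarrow> c + (c0 + segment_int 0 y k) = 0"
    using 1 AE_lborel_pairD(2)[OF Pq]
  proof eventually_elim
    case (elim y)
    show ?case
    proof
      assume y: "y \<in> {0<..<L}"
      have "(\<integral>s. P (s, y) \<partial>lborel) = segment_int 0 L (\<lambda>s. S s y)"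
        unfolding segment_int_def[of 0 L]
      proof (rule integral_cong_AE)
        show "AE s in lborel. P (s, y) = oriented_ind 0 L s * S s y"
          using elim(2)
        proof eventually_elim
          case (elim s)
          show ?case
            by (cases "(s, y) \<in> \<Omega> L") (use elim y L z(1)[of "(s, y)"] in \<open>auto simp: \<Omega>_def oriented_ind_def S_def\<close>)
        qed
        have "(\<lambda>s. segment_int 0 y (\<lambda>t. q (s, t))) \<in> borel_measurable borel"
          unfolding segment_int_def by (rule borel_measurable_lborel_param) measurable
        then show "(\<lambda>s. oriented_ind 0 L s * S s y) \<in> borel_measurable lborel"
          unfolding S_def by measurable
      qed measurable
      with elim y S_eq show "c + (c0 + segment_int 0 y k) = 0"
        by simp
    qed
  qed
  then have "c + (c0 + segment_int 0 y k) = 0"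
    using L y by (rule AE_zero_imp_zero) (intro tendsto_intros segment_int_tendsto k)
  then show ?thesis
    using S_eq[of y] by (simp add: S_def)
qed

section \<open>Locally affine Lipschitz functions\<close>

lemma C_1I:
  fixes f :: "real \<times> real \<Rightarrow> real"
  assumes fx: "\<And>x y. ((\<lambda>x. f (x, y)) has_real_derivative fx (x, y)) (at x)"
    and fy: "\<And>x y. ((\<lambda>y. f (x, y)) has_real_derivative fy (x, y)) (at y)"
    and cx: "continuous_on UNIV fx" and cy: "continuous_on UNIV fy"
  shows "C_k 1 f" "frechet_derivative f (at p) (1, 0) = fx p" "frechet_derivative f (at p) (0, 1) = fy p"
proof -
  have D: "(f has_derivative (\<lambda>v. fx p * fst v + fy p * snd v)) (at p)" for p
  proof -
    obtain x y where p: "p = (x, y)" by (cases p)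
    have "continuous_on UNIV (\<lambda>p. blinfun_mult_right (fy p))"
      by (intro bounded_linear.continuous_on[OF bounded_linear_blinfun_mult_right] cy)
    then have "((\<lambda>(x, y). f (x, y)) has_derivative
        (\<lambda>(tx, ty). fx (x, y) * tx + blinfun_mult_right (fy (x, y)) ty)) (at (x, y) within UNIV \<times> UNIV)"
      using fx fy by (intro has_derivative_partialsI)
        (auto simp: has_field_derivative_def continuous_on_eq_continuous_at case_prod_beta')
    then show ?thesis
      by (simp add: p case_prod_beta')
  qed
  have F: "frechet_derivative f (at p) = (\<lambda>v. fx p * fst v + fy p * snd v)" for p
    using frechet_derivative_at[OF D] by simp
  then show "frechet_derivative f (at p) (1, 0) = fx p" "frechet_derivative f (at p) (0, 1) = fy p"
    by simp_all
  have "f differentiable (at p)" for p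
    using D differentiable_def by blast
  then show "C_k 1 f"
    unfolding One_nat_def C_k.simps using cx cy by (simp add: Basis_real_prod F)
qed

section \<open>Steklov averages of Lipschitz functions\<close>

lemma shifted_integral_DERIV:
  fixes g :: "real \<Rightarrow> real"
  assumes g: "continuous_on UNIV g" and e: "e \<ge> 0"
  shows "((\<lambda>x. integral {0..e} (\<lambda>s. g (x + s))) has_real_derivative g (x + e) - g x) (at x)"
proof -
  obtain F where F: "\<And>x. (F has_real_derivative g x) (at x)"
    using einterval_antiderivative[of "-\<infinity>" \<infinity> g] g
    by (auto simp: continuous_on_eq_continuous_at has_real_derivative_iff_has_vector_derivative)
  have shift: "((\<lambda>s. F (s + c)) has_real_derivative g (x + c)) (at x)" for x c
    using DERIV_shift[of F "g (x + c)" x c] F by simp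
  have "integral {0..e} (\<lambda>s. g (x + s)) = F (x + e) - F x" for x
  proof -
    have "((\<lambda>s. g (x + s)) has_integral F (x + e) - F (x + 0)) {0..e}"
      using shift[of x] e by (intro fundamental_theorem_of_calculus)
        (auto simp: has_real_derivative_iff_has_vector_derivative[symmetric] add.commute intro: DERIV_subset)
    then show ?thesis
      by (simp add: integral_unique)
  qed
  then show ?thesis
    using shift F by (auto intro!: derivative_intros)
qed

text \<open>The Steklov average: the mean over the square of side \<open>e\<close> with lower left
  corner \<open>p\<close>. Its partials are averaged difference quotients, so a Lipschitz bound
  carries over with the same constant. As \<open>u\<close> lives on the whole plane, the square may
  leave the domain.\<close>

definition steklov :: "real \<Rightarrow> (real \<times> real \<Rightarrow> real) \<Rightarrow> real \<times> real \<Rightarrow> real" where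
  "steklov e u p = integral {0..e} (\<lambda>t. integral {0..e} (\<lambda>s. u (fst p + s, snd p + t))) / e\<^sup>2"

definition steklov_fst :: "real \<Rightarrow> (real \<times> real \<Rightarrow> real) \<Rightarrow> real \<times> real \<Rightarrow> real" where
  "steklov_fst e u p = integral {0..e} (\<lambda>t. u (fst p + e, snd p + t) - u (fst p, snd p + t)) / e\<^sup>2"

definition steklov_snd :: "real \<Rightarrow> (real \<times> real \<Rightarrow> real) \<Rightarrow> real \<times> real \<Rightarrow> real" where
  "steklov_snd e u p = integral {0..e} (\<lambda>s. u (fst p + s, snd p + e) - u (fst p + s, snd p)) / e\<^sup>2"

lemma continuous_on_integral_param:
  fixes f :: "'a::topological_space \<Rightarrow> real \<Rightarrow> real"
  assumes "continuous_on UNIV (\<lambda>(p, t). f p t)"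
  shows "continuous_on UNIV (\<lambda>p. integral {a..b} (f p))"
  using integral_continuous_on_param[of UNIV a b f] assms
  by (simp add: continuous_on_subset)

text \<open>The inner integral runs over the first variable, which causes the asymmetry of the
  proof: the first partial needs differentiation under the outer integral, whereas the second is the
  shift formula applied to the outer integral itself.\<close>

lemma steklov_C_1:
  assumes u: "continuous_on UNIV u" and e: "e > 0"
  shows "C_k 1 (steklov e u)" "frechet_derivative (steklov e u) (at p) (1, 0) = steklov_fst e u p"
    "frechet_derivative (steklov e u) (at p) (0, 1) = steklov_snd e u p"
proof -
  have c: "continuous_on S (\<lambda>q. u (f q, g q))" if "continuous_on S f" "continuous_on S g" for S and f g :: "'b::topological_space \<Rightarrow> real"
    using that by (auto intro!: continuous_on_compose2[OF u] continuous_intros)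
  have inner: "continuous_on UNIV (\<lambda>q. integral {0..e} (\<lambda>s. u (fst q + s, snd q)))"
    by (intro continuous_on_integral_param) (auto simp: case_prod_beta' intro!: c continuous_intros)
  have inner': "continuous_on S (\<lambda>q. integral {0..e} (\<lambda>s. u (f q + s, g q)))" if "continuous_on S f" "continuous_on S g" for S and f g :: "'b::topological_space \<Rightarrow> real"
    using continuous_on_compose2[OF inner, of S "\<lambda>q. (f q, g q)"] that by (auto intro!: continuous_intros)
  have x: "((\<lambda>x. steklov e u (x, y)) has_real_derivative steklov_fst e u (x, y)) (at x)" for x y
  proof -
    have "((\<lambda>x. integral (cbox 0 e) (\<lambda>t. integral {0..e} (\<lambda>s. u (x + s, y + t)))) has_field_derivative
        integral (cbox 0 e) (\<lambda>t. u (x + e, y + t) - u (x, y + t))) (at x within UNIV)"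
    proof (rule leibniz_rule_field_derivative)
      show "((\<lambda>x. integral {0..e} (\<lambda>s. u (x + s, y + t))) has_field_derivative u (x + e, y + t) - u (x, y + t)) (at x within UNIV)" for x t
        using shifted_integral_DERIV[OF continuous_on_slice(1)[OF u], of e "y + t" x] e by simp
      show "(\<lambda>t. integral {0..e} (\<lambda>s. u (x + s, y + t))) integrable_on cbox 0 e" for x
        by (intro integrable_continuous inner' continuous_intros)
    qed (auto simp: case_prod_beta' intro!: c continuous_intros)
    then show ?thesis
      unfolding steklov_def steklov_fst_def by (simp add: DERIV_cdivide)
  qed
  have y: "((\<lambda>y. steklov e u (x, y)) has_real_derivative steklov_snd e u (x, y)) (at y)" for x y
  proof -
    have "((\<lambda>y. integral {0..e} (\<lambda>t. integral {0..e} (\<lambda>s. u (x + s, y + t)))) has_real_derivative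
        integral {0..e} (\<lambda>s. u (x + s, y + e)) - integral {0..e} (\<lambda>s. u (x + s, y))) (at y)"
      by (rule shifted_integral_DERIV) (use e in \<open>auto intro!: inner' continuous_intros\<close>)
    moreover have "integral {0..e} (\<lambda>s. u (x + s, y + e)) - integral {0..e} (\<lambda>s. u (x + s, y))
        = integral {0..e} (\<lambda>s. u (x + s, y + e) - u (x + s, y))"
      by (intro Henstock_Kurzweil_Integration.integral_diff[symmetric] integrable_continuous_interval c continuous_intros)
    ultimately show ?thesis
      unfolding steklov_def steklov_snd_def by (simp add: DERIV_cdivide)
  qed
  have cx: "continuous_on UNIV (steklov_fst e u)"
    unfolding steklov_fst_def
    by (intro continuous_on_divide continuous_on_integral_param) (use e in \<open>auto simp: case_prod_beta' intro!: c continuous_intros\<close>)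
  have cy: "continuous_on UNIV (steklov_snd e u)"
    unfolding steklov_snd_def
    by (intro continuous_on_divide continuous_on_integral_param) (use e in \<open>auto simp: case_prod_beta' intro!: c continuous_intros\<close>)
  show "C_k 1 (steklov e u)" "frechet_derivative (steklov e u) (at p) (1, 0) = steklov_fst e u p"
    "frechet_derivative (steklov e u) (at p) (0, 1) = steklov_snd e u p"
    by (rule C_1I[OF x y cx cy])+
qed

lemma abs_integral_le:
  fixes f :: "real \<Rightarrow> real"
  assumes "continuous_on {0..e} f" "e \<ge> 0" "\<And>t. t \<in> {0..e} \<Longrightarrow> \<bar>f t\<bar> \<le> B"
  shows "\<bar>integral {0..e} f\<bar> \<le> B * e"
  using integral_bound[of 0 e f B] assms by (simp add: real_norm_def)

text \<open>The l1 distance is used so that difference quotients along the axes are bounded by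
  \<open>K\<close> itself.\<close>

definition coord_lipschitz :: "real \<Rightarrow> (real \<times> real \<Rightarrow> real) \<Rightarrow> bool" where
  "coord_lipschitz K u \<longleftrightarrow> (\<forall>x x' y y'. \<bar>u (x, y) - u (x', y')\<bar> \<le> K * (\<bar>x - x'\<bar> + \<bar>y - y'\<bar>))"

lemma coord_lipschitz_nonneg: "coord_lipschitz K u \<Longrightarrow> K \<ge> 0"
  unfolding coord_lipschitz_def by (drule spec[of _ 1], drule spec[of _ 0], drule spec[of _ 0], drule spec[of _ 0]) simp

lemma coord_lipschitz_continuous:
  assumes "coord_lipschitz K u"
  shows "continuous_on UNIV u"
proof -
  have "\<bar>u p - u q\<bar> \<le> (2 * K) * dist p q" for p q
  proof -
    have "0 \<le> K"
      using coord_lipschitz_nonneg[OF assms] by simp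
    have "\<bar>fst p - fst q\<bar> \<le> dist p q" "\<bar>snd p - snd q\<bar> \<le> dist p q"
      using dist_fst_le[of p q] dist_snd_le[of p q] by (simp_all add: dist_real_def)
    then have "K * (\<bar>fst p - fst q\<bar> + \<bar>snd p - snd q\<bar>) \<le> K * (2 * dist p q)"
      using \<open>0 \<le> K\<close> by (intro mult_left_mono) auto
    then show ?thesis
      using assms[unfolded coord_lipschitz_def, rule_format, of "fst p" "snd p" "fst q" "snd q"] by simp
  qed
  moreover have "0 \<le> 2 * K"
    using coord_lipschitz_nonneg[OF assms] by simp
  ultimately have "(2 * K)-lipschitz_on UNIV u"
    by (intro lipschitz_onI) (auto simp: dist_real_def)
  then show ?thesis
    by (rule lipschitz_on_continuous_on)
qed

text \<open>Points of the averaging square have l1 distance at most 2 e from \<open>p\<close>,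
  whence the factor 2 in the last bound.\<close>

lemma steklov_bounds:
  assumes u: "coord_lipschitz K u" and e: "e > 0"
  shows "\<bar>steklov_fst e u p\<bar> \<le> K" "\<bar>steklov_snd e u p\<bar> \<le> K" "\<bar>steklov e u p - u p\<bar> \<le> 2 * K * e"
proof -
  note cu = coord_lipschitz_continuous[OF u]
  have c: "continuous_on S (\<lambda>q. u (f q, g q))" if "continuous_on S f" "continuous_on S g" for S and f g :: "'b::topological_space \<Rightarrow> real"
    using that by (auto intro!: continuous_on_compose2[OF cu] continuous_intros)
  have lip: "\<bar>u (x, y) - u (x', y')\<bar> \<le> K * (\<bar>x - x'\<bar> + \<bar>y - y'\<bar>)" for x y x' y'
    using u by (simp add: coord_lipschitz_def)
  have K: "K \<ge> 0"
    using coord_lipschitz_nonneg[OF u] .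
  have "\<bar>integral {0..e} (\<lambda>t. u (fst p + e, snd p + t) - u (fst p, snd p + t))\<bar> \<le> (K * e) * e"
  proof (intro abs_integral_le c continuous_intros)
    show "\<bar>u (fst p + e, snd p + t) - u (fst p, snd p + t)\<bar> \<le> K * e" for t
      using lip[of "fst p + e" "snd p + t" "fst p" "snd p + t"] e by simp
  qed (use e in auto)
  then show "\<bar>steklov_fst e u p\<bar> \<le> K"
    using e by (simp add: steklov_fst_def field_simps power2_eq_square)
  have "\<bar>integral {0..e} (\<lambda>s. u (fst p + s, snd p + e) - u (fst p + s, snd p))\<bar> \<le> (K * e) * e"
  proof (intro abs_integral_le c continuous_intros)
    show "\<bar>u (fst p + s, snd p + e) - u (fst p + s, snd p)\<bar> \<le> K * e" for s
      using lip[of "fst p + s" "snd p + e" "fst p + s" "snd p"] e by simp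
  qed (use e in auto)
  then show "\<bar>steklov_snd e u p\<bar> \<le> K"
    using e by (simp add: steklov_snd_def field_simps power2_eq_square)
  have inner: "continuous_on UNIV (\<lambda>q. integral {0..e} (\<lambda>s. u (fst q + s, snd q)))"
    by (intro continuous_on_integral_param) (auto simp: case_prod_beta' intro!: c continuous_intros)
  have inner': "continuous_on S (\<lambda>q. integral {0..e} (\<lambda>s. u (f q + s, g q)))" if "continuous_on S f" "continuous_on S g" for S and f g :: "'b::topological_space \<Rightarrow> real"
    using continuous_on_compose2[OF inner, of S "\<lambda>q. (f q, g q)"] that by (auto intro!: continuous_intros)
  have const: "integral {0..e} (\<lambda>t. b) = e * b" for b :: real
    using e by simp
  have 1: "\<bar>integral {0..e} (\<lambda>s. u (fst p + s, snd p + t)) - e * u p\<bar> \<le> (2 * K * e) * e" if t: "t \<in> {0..e}" for t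
  proof -
    have "integral {0..e} (\<lambda>s. u (fst p + s, snd p + t)) - e * u p = integral {0..e} (\<lambda>s. u (fst p + s, snd p + t) - u p)"
      unfolding const[symmetric]
      by (intro Henstock_Kurzweil_Integration.integral_diff[symmetric] integrable_continuous_interval c continuous_intros)
    moreover have "\<bar>integral {0..e} (\<lambda>s. u (fst p + s, snd p + t) - u p)\<bar> \<le> (2 * K * e) * e"
    proof (intro abs_integral_le c continuous_intros)
      fix s assume s: "s \<in> {0..e}"
      have "K * (\<bar>s\<bar> + \<bar>t\<bar>) \<le> K * (2 * e)"
        using s t K by (intro mult_left_mono) auto
      then show "\<bar>u (fst p + s, snd p + t) - u p\<bar> \<le> 2 * K * e"
        using lip[of "fst p + s" "snd p + t" "fst p" "snd p"] by simp
    qed (use e in auto)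
    ultimately show ?thesis
      by simp
  qed
  have "integral {0..e} (\<lambda>t. integral {0..e} (\<lambda>s. u (fst p + s, snd p + t))) - e * (e * u p)
      = integral {0..e} (\<lambda>t. integral {0..e} (\<lambda>s. u (fst p + s, snd p + t)) - e * u p)"
    unfolding const[symmetric, of "e * u p"]
    by (intro Henstock_Kurzweil_Integration.integral_diff[symmetric] integrable_continuous_interval inner' continuous_intros)
  moreover have "\<bar>integral {0..e} (\<lambda>t. integral {0..e} (\<lambda>s. u (fst p + s, snd p + t)) - e * u p)\<bar> \<le> ((2 * K * e) * e) * e"
    using 1 e by (intro abs_integral_le inner' continuous_intros) auto
  ultimately have "\<bar>integral {0..e} (\<lambda>t. integral {0..e} (\<lambda>s. u (fst p + s, snd p + t))) - e\<^sup>2 * u p\<bar> \<le> e\<^sup>2 * (2 * K * e)"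
    by (simp add: power2_eq_square algebra_simps)
  moreover have "steklov e u p - u p = (integral {0..e} (\<lambda>t. integral {0..e} (\<lambda>s. u (fst p + s, snd p + t))) - e\<^sup>2 * u p) / e\<^sup>2"
    using e by (simp add: steklov_def field_simps)
  ultimately show "\<bar>steklov e u p - u p\<bar> \<le> 2 * K * e"
    using e by (simp add: abs_divide pos_divide_le_eq mult.commute)
qed

definition affine_near :: "(real \<times> real \<Rightarrow> real) \<Rightarrow> real \<times> real \<Rightarrow> real \<Rightarrow> real \<Rightarrow> bool" where
  "affine_near u p cx cy \<longleftrightarrow>
     (\<exists>r>0. \<forall>x y. \<bar>x - fst p\<bar> < r \<and> \<bar>y - snd p\<bar> < r \<longrightarrow> u (x, y) = u p + cx * (x - fst p) + cy * (y - snd p))"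

text \<open>Once \<open>e n\<close> is smaller than the radius of affinity the difference quotients
  equal the slopes exactly, so both sequences are eventually constant.\<close>

lemma steklov_affine_near:
  assumes a: "affine_near u p cx cy" and e: "e \<longlonglongrightarrow> 0" "\<And>n. e n > 0"
  shows "(\<lambda>n. steklov_fst (e n) u p) \<longlonglongrightarrow> cx" "(\<lambda>n. steklov_snd (e n) u p) \<longlonglongrightarrow> cy"
proof -
  obtain r where r: "r > 0" and u: "\<And>x y. \<bar>x - fst p\<bar> < r \<Longrightarrow> \<bar>y - snd p\<bar> < r \<Longrightarrow> u (x, y) = u p + cx * (x - fst p) + cy * (y - snd p)"
    using a by (auto simp: affine_near_def)
  have ev: "eventually (\<lambda>n. e n < r) sequentially"
    using order_tendstoD(2)[OF e(1) r] .
  have "steklov_fst d u p = cx \<and> steklov_snd d u p = cy" if d: "0 < d" "d < r" for d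
  proof -
    have "integral {0..d} (\<lambda>t. u (fst p + d, snd p + t) - u (fst p, snd p + t)) = integral {0..d} (\<lambda>t. cx * d)"
      by (rule Henstock_Kurzweil_Integration.integral_cong) (use d u in auto)
    moreover have "integral {0..d} (\<lambda>s. u (fst p + s, snd p + d) - u (fst p + s, snd p)) = integral {0..d} (\<lambda>t. cy * d)"
      by (rule Henstock_Kurzweil_Integration.integral_cong) (use d u in auto)
    ultimately show ?thesis
      using d by (simp add: steklov_fst_def steklov_snd_def power2_eq_square)
  qed
  then have "eventually (\<lambda>n. steklov_fst (e n) u p = cx) sequentially" "eventually (\<lambda>n. steklov_snd (e n) u p = cy) sequentially"
    using ev e(2) by (auto elim!: eventually_mono)
  then show "(\<lambda>n. steklov_fst (e n) u p) \<longlonglongrightarrow> cx" "(\<lambda>n. steklov_snd (e n) u p) \<longlonglongrightarrow> cy"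
    by (auto intro: tendsto_eventually)
qed

section \<open>Limits of averages: weak derivatives and traces\<close>

lemma integrable_const_square: "integrable (lebesgue_on (\<Omega> L)) (\<lambda>_. c::real)"
  by (rule finite_measure.integrable_const[OF finite_measure_square])

text \<open>Dominated convergence on both sides of the defining identity, with the uniform bounds as
  majorants. The derivatives converge only almost everywhere, so their limit is supplied as a
  separate Borel function \<open>g\<close>.\<close>

lemma has_weak_partial_limit:
  fixes w d :: "nat \<Rightarrow> real \<times> real \<Rightarrow> real"
  assumes w: "\<And>n. has_weak_partial (\<Omega> L) b (w n) (d n)" and b: "b \<in> Basis"
    and wc: "\<And>n. continuous_on UNIV (w n)" and dc: "\<And>n. continuous_on UNIV (d n)"
    and u: "continuous_on UNIV u" and g: "g \<in> borel_measurable borel" "\<And>p. \<bar>g p\<bar> \<le> K"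
    and wl: "\<And>n p. \<bar>w n p - u p\<bar> \<le> B" "\<And>p. (\<lambda>n. w n p) \<longlonglongrightarrow> u p"
    and dl: "\<And>n p. \<bar>d n p\<bar> \<le> K" "AE p in lebesgue_on (\<Omega> L). (\<lambda>n. d n p) \<longlonglongrightarrow> g p"
  shows "has_weak_partial (\<Omega> L) b u g" "square_integrable (lebesgue_on (\<Omega> L)) g"
proof -
  have m: "f \<in> borel_measurable (lebesgue_on (\<Omega> L))" if "f \<in> borel_measurable borel" for f :: "real \<times> real \<Rightarrow> real"
    using that by (intro measurable_restrict_space1 measurable_completion) simp
  have K2: "(g p)\<^sup>2 \<le> K\<^sup>2" for p
    using g(2)[of p] by (metis abs_ge_zero power2_abs power_mono)
  show sq: "square_integrable (lebesgue_on (\<Omega> L)) g"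
    unfolding square_integrable_def
    using m[OF g(1)] K2 by (auto intro!: Bochner_Integration.integrable_bound[OF integrable_const_square[of L "K\<^sup>2"]])
  show "has_weak_partial (\<Omega> L) b u g"
    unfolding has_weak_partial_def
  proof (intro conjI ballI)
    show "locally_integrable (\<Omega> L) u" "locally_integrable (\<Omega> L) g"
      by (intro square_integrable_locally_integrable sq continuous_square_integrable u)+
    fix \<phi> assume \<phi>: "\<phi> \<in> test_functions (\<Omega> L)"
    obtain C where C: "\<And>x. \<bar>\<phi> x\<bar> \<le> C" "\<And>x. \<bar>frechet_derivative \<phi> (at x) b\<bar> \<le> C"
      "continuous_on UNIV \<phi>" "continuous_on UNIV (\<lambda>x. frechet_derivative \<phi> (at x) b)"
      using test_function_bounded[OF \<phi> b] by blast
    note mm = m[OF borel_measurable_continuous_onI]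
    have ui: "integrable (lebesgue_on (\<Omega> L)) u"
      using square_integrable_imp_integrable[OF finite_measure_square continuous_square_integrable[OF u]] .
    have l1: "(\<lambda>n. LINT x|lebesgue_on (\<Omega> L). w n x * frechet_derivative \<phi> (at x) b)
        \<longlonglongrightarrow> (LINT x|lebesgue_on (\<Omega> L). u x * frechet_derivative \<phi> (at x) b)"
    proof (rule integral_dominated_convergence[where w = "\<lambda>x. (\<bar>u x\<bar> + B) * C"])
      show "integrable (lebesgue_on (\<Omega> L)) (\<lambda>x. (\<bar>u x\<bar> + B) * C)"
        using ui integrable_const_square by auto
      show "AE x in lebesgue_on (\<Omega> L). norm (w n x * frechet_derivative \<phi> (at x) b) \<le> (\<bar>u x\<bar> + B) * C" for n
      proof (rule AE_I2)
        fix x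
        have "\<bar>w n x\<bar> \<le> \<bar>u x\<bar> + B"
          using wl(1)[of n x] by linarith
        then show "norm (w n x * frechet_derivative \<phi> (at x) b) \<le> (\<bar>u x\<bar> + B) * C"
          using C(2)[of x] by (simp add: abs_mult mult_mono')
      qed
      show "AE x in lebesgue_on (\<Omega> L). (\<lambda>n. w n x * frechet_derivative \<phi> (at x) b) \<longlonglongrightarrow> u x * frechet_derivative \<phi> (at x) b"
        by (intro AE_I2 tendsto_intros wl)
    qed (intro borel_measurable_times mm u wc C)+
    have l2: "(\<lambda>n. (LINT x|lebesgue_on (\<Omega> L). d n x * \<phi> x)) \<longlonglongrightarrow> (LINT x|lebesgue_on (\<Omega> L). g x * \<phi> x)"
    proof (rule integral_dominated_convergence[where w = "\<lambda>x. K * C"])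
      show "AE x in lebesgue_on (\<Omega> L). norm (d n x * \<phi> x) \<le> K * C" for n
        using dl(1) C(1) by (intro AE_I2) (simp add: abs_mult mult_mono')
      show "AE x in lebesgue_on (\<Omega> L). (\<lambda>n. d n x * \<phi> x) \<longlonglongrightarrow> g x * \<phi> x"
        using dl(2) by eventually_elim (intro tendsto_intros)
    qed (intro borel_measurable_times mm m g dc C integrable_const_square)+
    have "(LINT x|lebesgue_on (\<Omega> L). w n x * frechet_derivative \<phi> (at x) b) = - (LINT x|lebesgue_on (\<Omega> L). d n x * \<phi> x)" for n
      using w[of n] \<phi> by (auto simp: has_weak_partial_def)
    with l1 have "(\<lambda>n. - (LINT x|lebesgue_on (\<Omega> L). d n x * \<phi> x))
        \<longlonglongrightarrow> (LINT x|lebesgue_on (\<Omega> L). u x * frechet_derivative \<phi> (at x) b)"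
      by simp
    from LIMSEQ_unique[OF this tendsto_minus[OF l2]]
    show "(LINT x|lebesgue_on (\<Omega> L). u x * frechet_derivative \<phi> (at x) b) = - (LINT x|lebesgue_on (\<Omega> L). g x * \<phi> x)" .
  qed
qed

lemma L2_norm_tendsto_0:
  assumes "AE x in M. (\<lambda>n. f n x) \<longlonglongrightarrow> 0" "\<And>n x. \<bar>f n x\<bar> \<le> K" "integrable M (\<lambda>_. K\<^sup>2)" "\<And>n. f n \<in> borel_measurable M"
  shows "(\<lambda>n. L2_norm M (f n)) \<longlonglongrightarrow> 0"
proof -
  have "(\<lambda>n. \<integral>x. (f n x)\<^sup>2 \<partial>M) \<longlonglongrightarrow> (\<integral>x. 0 \<partial>M)"
  proof (rule integral_dominated_convergence[where w = "\<lambda>_. K\<^sup>2"])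
    show "AE x in M. (\<lambda>n. (f n x)\<^sup>2) \<longlonglongrightarrow> 0"
      using assms(1) by eventually_elim (auto dest: tendsto_power[where n = 2])
    show "AE x in M. norm ((f n x)\<^sup>2) \<le> K\<^sup>2" for n
    proof (rule AE_I2)
      fix x
      show "norm ((f n x)\<^sup>2) \<le> K\<^sup>2"
        using power_mono[OF assms(2)[of n x], of 2] by simp
    qed
  qed (use assms(3,4) in auto)
  then have "(\<lambda>n. sqrt (\<integral>x. (f n x)\<^sup>2 \<partial>M)) \<longlonglongrightarrow> sqrt 0"
    by (intro tendsto_real_sqrt) simp
  then show ?thesis
    by (simp add: L2_norm_def)
qed

text \<open>The Steklov averages do double duty: the limits of their partials are the weak
  derivatives, and the averages themselves are the smooth approximations that
  \<open>has_trace\<close> demands. The Lipschitz constant gives the domination, and affinity near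
  almost every point stands in for Rademacher's theorem and yields the values of the
  derivatives.\<close>

lemma locally_affine_H1:
  assumes u: "coord_lipschitz K u"
    and loc: "AE p in lborel. p \<in> \<Omega> L \<longrightarrow> (\<exists>cx cy. affine_near u p cx cy)"
  shows "u \<in> H1 (\<Omega> L)"
    and "AE p in lborel. p \<in> \<Omega> L \<longrightarrow> (\<forall>cx cy. affine_near u p cx cy \<longrightarrow>
        weak_partial (\<Omega> L) (1, 0) u p = cx \<and> weak_partial (\<Omega> L) (0, 1) u p = cy)"
    and "(\<And>y. y \<in> {0..L} \<Longrightarrow> u (a, y) = c) \<Longrightarrow> has_trace (\<Omega> L) (side L a) u (\<lambda>_. c)"
proof -
  note uc = coord_lipschitz_continuous[OF u]
  define e where "e n = inverse (real (Suc n))" for n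
  have e: "e \<longlonglongrightarrow> 0" "\<And>n. e n > 0" "\<And>n. e n \<le> 1"
    using LIMSEQ_inverse_real_of_nat by (auto simp: e_def[abs_def] field_simps)
  define w where "w n = steklov (e n) u" for n
  define wx where "wx n = steklov_fst (e n) u" for n
  define wy where "wy n = steklov_snd (e n) u" for n
  have K: "K \<ge> 0"
    using coord_lipschitz_nonneg[OF u] .
  note S = steklov_C_1[OF uc e(2), folded w_def wx_def wy_def]
  note B = steklov_bounds[OF u e(2), folded w_def wx_def wy_def]
  have wc: "continuous_on UNIV (w n)" "continuous_on UNIV (wx n)" "continuous_on UNIV (wy n)" for n
    using C_1_partials(4)[OF S(1)[of n]] C_1_partials(3)[OF S(1)[of n] Basis_real_prod_mem(1)]
      C_1_partials(3)[OF S(1)[of n] Basis_real_prod_mem(2)] by (simp_all add: S)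
  have [measurable]: "w n \<in> borel_measurable borel" "wx n \<in> borel_measurable borel" "wy n \<in> borel_measurable borel"
    "u \<in> borel_measurable borel" for n
    using wc uc by (auto intro: borel_measurable_continuous_onI)
  have wp: "has_weak_partial (\<Omega> L) (1, 0) (w n) (wx n)" "has_weak_partial (\<Omega> L) (0, 1) (w n) (wy n)" for n
    using C_1_weak_partial[OF S(1)[of n] Basis_real_prod_mem(1), of L]
      C_1_weak_partial[OF S(1)[of n] Basis_real_prod_mem(2), of L] by (simp_all add: S)
  \<comment> \<open>\<open>lim\<close> is arbitrary where the sequence diverges; the truncation keeps the functions bounded.\<close>
  define gx where "gx p = max (- K) (min K (lim (\<lambda>n. wx n p)))" for p
  define gy where "gy p = max (- K) (min K (lim (\<lambda>n. wy n p)))" for p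
  have [measurable]: "gx \<in> borel_measurable borel" "gy \<in> borel_measurable borel"
    unfolding gx_def gy_def by measurable
  have gb: "\<bar>gx p\<bar> \<le> K" "\<bar>gy p\<bar> \<le> K" for p
    using K by (auto simp: gx_def gy_def)
  have near: "(\<lambda>n. wx n p) \<longlonglongrightarrow> cx \<and> (\<lambda>n. wy n p) \<longlonglongrightarrow> cy \<and> gx p = cx \<and> gy p = cy" if "affine_near u p cx cy" for p cx cy
  proof -
    note l = steklov_affine_near[OF that e(1,2), folded wx_def wy_def]
    have "\<bar>cx\<bar> \<le> K" "\<bar>cy\<bar> \<le> K"
      using tendsto_upperbound[OF tendsto_rabs[OF l(1)]] tendsto_upperbound[OF tendsto_rabs[OF l(2)]] B by auto
    then show ?thesis
      using l limI[OF l(1)] limI[OF l(2)] by (auto simp: gx_def gy_def)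
  qed
  have wl: "\<bar>w n p - u p\<bar> \<le> 2 * K" for n p
    using B(3)[of n p] mult_left_mono[OF e(3)[of n], of "2 * K"] K by simp
  have wt: "(\<lambda>n. w n p - u p) \<longlonglongrightarrow> 0" for p
  proof (rule Lim_null_comparison[where g = "\<lambda>n. 2 * K * e n"])
    show "(\<lambda>n. 2 * K * e n) \<longlonglongrightarrow> 0"
      using tendsto_mult_left[OF e(1), of "2 * K"] by simp
  qed (use B(3) in auto)
  then have wt': "(\<lambda>n. w n p) \<longlonglongrightarrow> u p" for p
    by (simp add: LIM_zero_iff)
  have conv: "AE p in lebesgue_on (\<Omega> L). (\<lambda>n. wx n p) \<longlonglongrightarrow> gx p" "AE p in lebesgue_on (\<Omega> L). (\<lambda>n. wy n p) \<longlonglongrightarrow> gy p"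
    unfolding AE_lebesgue_on[OF square_borel] using loc near by (fastforce elim!: eventually_mono)+
  have gx: "has_weak_partial (\<Omega> L) (1, 0) u gx" "square_integrable (lebesgue_on (\<Omega> L)) gx"
    using has_weak_partial_limit[OF wp(1) Basis_real_prod_mem(1) wc(1,2) uc _ gb(1) wl wt' B(1) conv(1)] by auto
  have gy: "has_weak_partial (\<Omega> L) (0, 1) u gy" "square_integrable (lebesgue_on (\<Omega> L)) gy"
    using has_weak_partial_limit[OF wp(2) Basis_real_prod_mem(2) wc(1,3) uc _ gb(2) wl wt' B(2) conv(2)] by auto
  show H: "u \<in> H1 (\<Omega> L)"
    unfolding H1_def using gx gy continuous_square_integrable[OF uc] by (auto simp: Basis_real_prod)
  note ae = H1_weak_partial_eq[OF H Basis_real_prod_mem(1) gx(1)] H1_weak_partial_eq[OF H Basis_real_prod_mem(2) gy(1)]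
  show "AE p in lborel. p \<in> \<Omega> L \<longrightarrow> (\<forall>cx cy. affine_near u p cx cy \<longrightarrow>
        weak_partial (\<Omega> L) (1, 0) u p = cx \<and> weak_partial (\<Omega> L) (0, 1) u p = cy)"
    using ae[unfolded AE_lebesgue_on[OF square_borel]] by eventually_elim (use near in auto)
  assume uc': "\<And>y. y \<in> {0..L} \<Longrightarrow> u (a, y) = c"
  have bm: "f \<in> borel_measurable (lebesgue_on (\<Omega> L))" "f \<in> borel_measurable (side L a)" if "f \<in> borel_measurable borel" for f :: "real \<times> real \<Rightarrow> real"
    using that by (auto simp: side_def vertical_length_def intro!: measurable_restrict_space1 measurable_completion)
  have wH: "w n \<in> H1 (\<Omega> L)" for n
    using C_1_in_H1[OF S(1)] .
  show "has_trace (\<Omega> L) (side L a) u (\<lambda>_. c)"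
    unfolding has_trace_def
  proof (intro conjI exI[of _ w] allI H S)
    show "square_integrable (side L a) (\<lambda>_. c)"
      by (intro continuous_square_integrable_side continuous_intros)
    have sc: "integrable (side L a) (\<lambda>_. k)" for k :: real
      by (subst side_integral(3)) (auto intro!: integrable_indicator_bounded)
    have wm: "(\<lambda>x. w n x - u x) \<in> borel_measurable borel" "(\<lambda>x. wx n x - gx x) \<in> borel_measurable borel"
      "(\<lambda>x. wy n x - gy x) \<in> borel_measurable borel" for n
      by measurable
    have "(\<lambda>n. L2_norm (side L a) (\<lambda>x. w n x - u x)) \<longlonglongrightarrow> 0"
      by (rule L2_norm_tendsto_0[OF AE_I2[OF wt] wl sc bm(2)[OF wm(1)]])
    moreover have "L2_norm (side L a) (\<lambda>x. w n x - u x) = L2_norm (side L a) (\<lambda>x. w n x - c)" for n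
      unfolding L2_norm_def
      by (intro arg_cong[where f = sqrt] Bochner_Integration.integral_cong)
        (use uc' in \<open>auto simp: side_def space_restrict_space\<close>)
    ultimately show "(\<lambda>n. L2_norm (side L a) (\<lambda>x. w n x - c)) \<longlonglongrightarrow> 0"
      by simp
    have nx: "L2_norm (lebesgue_on (\<Omega> L)) (weak_partial (\<Omega> L) b (\<lambda>x. w n x - u x)) = L2_norm (lebesgue_on (\<Omega> L)) (\<lambda>p. d p - g p)"
      if "b \<in> Basis" "has_weak_partial (\<Omega> L) b (w n) d" "has_weak_partial (\<Omega> L) b u g" "d \<in> borel_measurable borel" "g \<in> borel_measurable borel" for n d g b
    proof (rule L2_norm_cong_AE)
      show "AE p in lebesgue_on (\<Omega> L). weak_partial (\<Omega> L) b (\<lambda>x. w n x - u x) p = d p - g p"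
        using H1_diff(2)[OF wH[of n] H that(1)] H1_weak_partial_eq[OF wH that(1,2)] H1_weak_partial_eq[OF H that(1,3)]
        by eventually_elim simp
      show "weak_partial (\<Omega> L) b (\<lambda>x. w n x - u x) \<in> borel_measurable (lebesgue_on (\<Omega> L))"
        using H1_D(2)[OF H1_diff(1)[OF wH H] that(1)] by (simp add: square_integrable_def)
      show "(\<lambda>p. d p - g p) \<in> borel_measurable (lebesgue_on (\<Omega> L))"
        using that by (intro bm) simp
    qed
    have "(\<lambda>n. L2_norm (lebesgue_on (\<Omega> L)) (\<lambda>x. wx n x - gx x)) \<longlonglongrightarrow> 0"
    proof (rule L2_norm_tendsto_0[where K = "2 * K"])
      show "\<bar>wx n p - gx p\<bar> \<le> 2 * K" for n p
        using B(1)[of n p] gb(1)[of p] by linarith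
      show "AE p in lebesgue_on (\<Omega> L). (\<lambda>n. wx n p - gx p) \<longlonglongrightarrow> 0"
        using conv(1) by eventually_elim (rule LIM_zero)
    qed (rule integrable_const_square bm(1)[OF wm(2)])+
    moreover have "(\<lambda>n. L2_norm (lebesgue_on (\<Omega> L)) (\<lambda>x. wy n x - gy x)) \<longlonglongrightarrow> 0"
    proof (rule L2_norm_tendsto_0[where K = "2 * K"])
      show "\<bar>wy n p - gy p\<bar> \<le> 2 * K" for n p
        using B(2)[of n p] gb(2)[of p] by linarith
      show "AE p in lebesgue_on (\<Omega> L). (\<lambda>n. wy n p - gy p) \<longlonglongrightarrow> 0"
        using conv(2) by eventually_elim (rule LIM_zero)
    qed (rule integrable_const_square bm(1)[OF wm(3)])+
    moreover have "(\<lambda>n. L2_norm (lebesgue_on (\<Omega> L)) (\<lambda>x. w n x - u x)) \<longlonglongrightarrow> 0"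
      by (rule L2_norm_tendsto_0[OF AE_I2[OF wt] wl integrable_const_square bm(1)[OF wm(1)]])
    ultimately have "(\<lambda>n. sqrt ((L2_norm (lebesgue_on (\<Omega> L)) (\<lambda>x. w n x - u x))\<^sup>2
        + ((L2_norm (lebesgue_on (\<Omega> L)) (\<lambda>x. wx n x - gx x))\<^sup>2 + (L2_norm (lebesgue_on (\<Omega> L)) (\<lambda>x. wy n x - gy x))\<^sup>2)))
      \<longlonglongrightarrow> sqrt (0\<^sup>2 + (0\<^sup>2 + 0\<^sup>2))"
      by (intro tendsto_real_sqrt tendsto_add tendsto_power)
    moreover have "H1_norm (\<Omega> L) (\<lambda>x. w n x - u x) = sqrt ((L2_norm (lebesgue_on (\<Omega> L)) (\<lambda>x. w n x - u x))\<^sup>2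
        + ((L2_norm (lebesgue_on (\<Omega> L)) (\<lambda>x. wx n x - gx x))\<^sup>2 + (L2_norm (lebesgue_on (\<Omega> L)) (\<lambda>x. wy n x - gy x))\<^sup>2))" for n
      unfolding H1_norm_def H1_seminorm_sq[OF H1_diff(1)[OF wH H]] L2_norm_sq[symmetric]
      using nx[OF Basis_real_prod_mem(1) wp(1) gx(1)] nx[OF Basis_real_prod_mem(2) wp(2) gy(1)] by simp
    ultimately show "(\<lambda>n. H1_norm (\<Omega> L) (\<lambda>x. w n x - u x)) \<longlonglongrightarrow> 0"
      by simp
  qed
qed

section \<open>Piecewise linear functions on the uniform meshes\<close>

text \<open>The nodal basis function at the origin of the mesh with unit squares; the diagonals have
  direction \<open>(1, 1)\<close> for \<open>\<kappa> = 1\<close> and \<open>(1, - 1)\<close> for \<open>\<kappa> = - 1\<close>.\<close>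

definition hat :: "real \<Rightarrow> real \<Rightarrow> real \<Rightarrow> real" where
  "hat \<kappa> s t = max 0 (1 - max (max \<bar>s\<bar> \<bar>t\<bar>) \<bar>s - \<kappa> * t\<bar>)"

definition pw_linear :: "real \<Rightarrow> real \<Rightarrow> nat \<Rightarrow> (nat \<Rightarrow> nat \<Rightarrow> real) \<Rightarrow> real \<times> real \<Rightarrow> real" where
  "pw_linear \<kappa> h M v p = (\<Sum>i\<le>M. \<Sum>j\<le>M. v i j * hat \<kappa> (fst p / h - real i) (snd p / h - real j))"

lemma hat_eq_0: "1 \<le> \<bar>s\<bar> \<or> 1 \<le> \<bar>t\<bar> \<Longrightarrow> hat \<kappa> s t = 0"
  by (auto simp: hat_def)

lemma hat_up_lower:
  assumes "0 \<le> \<tau>" "\<tau> \<le> \<sigma>" "\<sigma> \<le> 1"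
  shows "hat 1 \<sigma> \<tau> = 1 - \<sigma>" "hat 1 (\<sigma> - 1) \<tau> = \<sigma> - \<tau>" "hat 1 \<sigma> (\<tau> - 1) = 0" "hat 1 (\<sigma> - 1) (\<tau> - 1) = \<tau>"
  using assms by (auto simp: hat_def max_def abs_if)

lemma hat_up_upper:
  assumes "0 \<le> \<sigma>" "\<sigma> \<le> \<tau>" "\<tau> \<le> 1"
  shows "hat 1 \<sigma> \<tau> = 1 - \<tau>" "hat 1 (\<sigma> - 1) \<tau> = 0" "hat 1 \<sigma> (\<tau> - 1) = \<tau> - \<sigma>" "hat 1 (\<sigma> - 1) (\<tau> - 1) = \<sigma>"
  using assms by (auto simp: hat_def max_def abs_if)

lemma hat_down_lower:
  assumes "0 \<le> \<sigma>" "0 \<le> \<tau>" "\<sigma> + \<tau> \<le> 1"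
  shows "hat (- 1) \<sigma> \<tau> = 1 - \<sigma> - \<tau>" "hat (- 1) (\<sigma> - 1) \<tau> = \<sigma>" "hat (- 1) \<sigma> (\<tau> - 1) = \<tau>" "hat (- 1) (\<sigma> - 1) (\<tau> - 1) = 0"
  using assms by (auto simp: hat_def max_def abs_if)

lemma hat_down_upper:
  assumes "\<sigma> \<le> 1" "\<tau> \<le> 1" "1 \<le> \<sigma> + \<tau>"
  shows "hat (- 1) \<sigma> \<tau> = 0" "hat (- 1) (\<sigma> - 1) \<tau> = 1 - \<tau>" "hat (- 1) \<sigma> (\<tau> - 1) = 1 - \<sigma>" "hat (- 1) (\<sigma> - 1) (\<tau> - 1) = \<sigma> + \<tau> - 1"
  using assms by (auto simp: hat_def max_def abs_if)

text \<open>Each of the three absolute values in the maximum has Lipschitz constant 1 for the l1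
  distance, the last because |\<kappa>| = 1, and taking maxima preserves such a bound.\<close>

lemma hat_lipschitz:
  assumes "\<bar>\<kappa>\<bar> = 1"
  shows "\<bar>hat \<kappa> s t - hat \<kappa> s' t'\<bar> \<le> \<bar>s - s'\<bar> + \<bar>t - t'\<bar>"
proof -
  have m: "\<bar>max a b - max c d\<bar> \<le> e" if "\<bar>a - c\<bar> \<le> e" "\<bar>b - d\<bar> \<le> e" for a b c d e :: real
    using that by (auto simp: max_def abs_le_iff)
  have "\<bar>\<bar>s - \<kappa> * t\<bar> - \<bar>s' - \<kappa> * t'\<bar>\<bar> \<le> \<bar>(s - s') - \<kappa> * (t - t')\<bar>"
    using abs_triangle_ineq3[of "s - \<kappa> * t" "s' - \<kappa> * t'"] by (simp add: algebra_simps)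
  also have "\<dots> \<le> \<bar>s - s'\<bar> + \<bar>t - t'\<bar>"
    using abs_triangle_ineq4[of "s - s'" "\<kappa> * (t - t')"] assms by (simp add: abs_mult)
  finally have 1: "\<bar>\<bar>s - \<kappa> * t\<bar> - \<bar>s' - \<kappa> * t'\<bar>\<bar> \<le> \<bar>s - s'\<bar> + \<bar>t - t'\<bar>" .
  have 2: "\<bar>\<bar>s\<bar> - \<bar>s'\<bar>\<bar> \<le> \<bar>s - s'\<bar> + \<bar>t - t'\<bar>" "\<bar>\<bar>t\<bar> - \<bar>t'\<bar>\<bar> \<le> \<bar>s - s'\<bar> + \<bar>t - t'\<bar>"
    using abs_triangle_ineq3[of s s'] abs_triangle_ineq3[of t t'] by linarith+
  have "\<bar>max (max \<bar>s\<bar> \<bar>t\<bar>) \<bar>s - \<kappa> * t\<bar> - max (max \<bar>s'\<bar> \<bar>t'\<bar>) \<bar>s' - \<kappa> * t'\<bar>\<bar> \<le> \<bar>s - s'\<bar> + \<bar>t - t'\<bar>"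
    by (intro m 1 2)
  moreover have "\<bar>(1 - a) - (1 - b)\<bar> = \<bar>a - b\<bar>" for a b :: real
    by simp
  ultimately have "\<bar>(1 - max (max \<bar>s\<bar> \<bar>t\<bar>) \<bar>s - \<kappa> * t\<bar>) - (1 - max (max \<bar>s'\<bar> \<bar>t'\<bar>) \<bar>s' - \<kappa> * t'\<bar>)\<bar> \<le> \<bar>s - s'\<bar> + \<bar>t - t'\<bar>"
    by (simp only:)
  moreover have "\<bar>(0::real) - 0\<bar> \<le> \<bar>s - s'\<bar> + \<bar>t - t'\<bar>"
    by simp
  ultimately show ?thesis
    unfolding hat_def by (intro m)
qed

text \<open>The constant degenerates with the mesh, but it serves only to establish membership in
  \<open>H1\<close> and the traces and enters no error estimate.\<close>

lemma pw_linear_lipschitz: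
  assumes "\<bar>\<kappa>\<bar> = 1" "h > 0"
  shows "coord_lipschitz ((\<Sum>i\<le>M. \<Sum>j\<le>M. \<bar>v i j\<bar>) / h) (pw_linear \<kappa> h M v)"
  unfolding coord_lipschitz_def
proof (intro allI)
  fix x x' y y' :: real
  let ?d = "(\<bar>x - x'\<bar> + \<bar>y - y'\<bar>) / h"
  have "\<bar>hat \<kappa> (x / h - real i) (y / h - real j) - hat \<kappa> (x' / h - real i) (y' / h - real j)\<bar> \<le> ?d" for i j
  proof -
    have "\<bar>hat \<kappa> (x / h - real i) (y / h - real j) - hat \<kappa> (x' / h - real i) (y' / h - real j)\<bar>
      \<le> \<bar>x / h - real i - (x' / h - real i)\<bar> + \<bar>y / h - real j - (y' / h - real j)\<bar>"
      by (rule hat_lipschitz[OF assms(1)])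
    also have "\<dots> = ?d"
      using assms(2) by (simp add: diff_divide_distrib[symmetric] abs_divide add_divide_distrib)
    finally show ?thesis .
  qed
  then have d: "\<bar>v i j * hat \<kappa> (x / h - real i) (y / h - real j) - v i j * hat \<kappa> (x' / h - real i) (y' / h - real j)\<bar> \<le> \<bar>v i j\<bar> * ?d" for i j
    unfolding right_diff_distrib[symmetric] abs_mult by (intro mult_left_mono) auto
  have "\<bar>pw_linear \<kappa> h M v (x, y) - pw_linear \<kappa> h M v (x', y')\<bar>
    \<le> (\<Sum>i\<le>M. \<Sum>j\<le>M. \<bar>v i j * hat \<kappa> (x / h - real i) (y / h - real j) - v i j * hat \<kappa> (x' / h - real i) (y' / h - real j)\<bar>)"
    unfolding pw_linear_def sum_subtractf[symmetric] fst_conv snd_conv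
    by (intro order_trans[OF sum_abs] sum_mono sum_abs)
  also have "\<dots> \<le> (\<Sum>i\<le>M. \<Sum>j\<le>M. \<bar>v i j\<bar> * ?d)"
    by (intro sum_mono d)
  also have "\<dots> = (\<Sum>i\<le>M. \<Sum>j\<le>M. \<bar>v i j\<bar>) / h * (\<bar>x - x'\<bar> + \<bar>y - y'\<bar>)"
    by (simp add: sum_distrib_right sum_divide_distrib)
  finally show "\<bar>pw_linear \<kappa> h M v (x, y) - pw_linear \<kappa> h M v (x', y')\<bar>
    \<le> (\<Sum>i\<le>M. \<Sum>j\<le>M. \<bar>v i j\<bar>) / h * (\<bar>x - x'\<bar> + \<bar>y - y'\<bar>)" .
qed

lemma sum_two_neighbours:
  fixes f :: "nat \<Rightarrow> real"
  assumes "i < M" "\<And>k. k \<noteq> i \<Longrightarrow> k \<noteq> Suc i \<Longrightarrow> f k = 0"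
  shows "(\<Sum>k\<le>M. f k) = f i + f (Suc i)"
proof -
  have "(\<Sum>k\<le>M. f k) = (\<Sum>k\<in>{i, Suc i}. f k)"
    using assms by (intro sum.mono_neutral_right) auto
  then show ?thesis
    by simp
qed

text \<open>A node that is at least one mesh width away in some direction contributes nothing, which
  leaves the four corners of the cell.\<close>

lemma pw_linear_cell:
  assumes h: "h > 0" and ij: "i < M" "j < M" and \<sigma>: "0 \<le> \<sigma>" "\<sigma> \<le> 1" and \<tau>: "0 \<le> \<tau>" "\<tau> \<le> 1"
  shows "pw_linear \<kappa> h M v ((real i + \<sigma>) * h, (real j + \<tau>) * h) =
    v i j * hat \<kappa> \<sigma> \<tau> + v (Suc i) j * hat \<kappa> (\<sigma> - 1) \<tau>
    + v i (Suc j) * hat \<kappa> \<sigma> (\<tau> - 1) + v (Suc i) (Suc j) * hat \<kappa> (\<sigma> - 1) (\<tau> - 1)"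
proof -
  have far: "1 \<le> \<bar>real i + \<sigma> - real k\<bar>" if "k \<noteq> i" "k \<noteq> Suc i" "0 \<le> \<sigma>" "\<sigma> \<le> 1" for i k :: nat and \<sigma> :: real
  proof -
    have "real k + 1 \<le> real i \<or> real i + 2 \<le> real k"
      using that by linarith
    then show ?thesis
      using that by linarith
  qed
  define H where "H k l = hat \<kappa> (real i + \<sigma> - real k) (real j + \<tau> - real l)" for k l
  have H0: "H k l = 0" if "k \<noteq> i \<and> k \<noteq> Suc i \<or> l \<noteq> j \<and> l \<noteq> Suc j" for k l
    unfolding H_def using that far \<sigma> \<tau> by (intro hat_eq_0) blast
  have "pw_linear \<kappa> h M v ((real i + \<sigma>) * h, (real j + \<tau>) * h) = (\<Sum>k\<le>M. \<Sum>l\<le>M. v k l * H k l)"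
    using h by (simp add: pw_linear_def H_def)
  also have "\<dots> = (\<Sum>l\<le>M. v i l * H i l) + (\<Sum>l\<le>M. v (Suc i) l * H (Suc i) l)"
    using ij by (intro sum_two_neighbours) (auto simp: H0)
  also have "(\<Sum>l\<le>M. v i l * H i l) = v i j * H i j + v i (Suc j) * H i (Suc j)"
    using ij by (intro sum_two_neighbours) (auto simp: H0)
  also have "(\<Sum>l\<le>M. v (Suc i) l * H (Suc i) l) = v (Suc i) j * H (Suc i) j + v (Suc i) (Suc j) * H (Suc i) (Suc j)"
    using ij by (intro sum_two_neighbours) (auto simp: H0)
  finally show ?thesis
    by (simp add: H_def algebra_simps)
qed

lemma pw_linear_triangles:
  assumes h: "h > 0" and ij: "i < M" "j < M" and \<sigma>: "0 \<le> \<sigma>" "\<sigma> \<le> 1" and \<tau>: "0 \<le> \<tau>" "\<tau> \<le> 1"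
  shows "\<tau> \<le> \<sigma> \<Longrightarrow> pw_linear 1 h M v ((real i + \<sigma>) * h, (real j + \<tau>) * h)
      = v i j + (v (Suc i) j - v i j) * \<sigma> + (v (Suc i) (Suc j) - v (Suc i) j) * \<tau>"
    and "\<sigma> \<le> \<tau> \<Longrightarrow> pw_linear 1 h M v ((real i + \<sigma>) * h, (real j + \<tau>) * h)
      = v i j + (v (Suc i) (Suc j) - v i (Suc j)) * \<sigma> + (v i (Suc j) - v i j) * \<tau>"
    and "\<sigma> + \<tau> \<le> 1 \<Longrightarrow> pw_linear (- 1) h M v ((real i + \<sigma>) * h, (real j + \<tau>) * h)
      = v i j + (v (Suc i) j - v i j) * \<sigma> + (v i (Suc j) - v i j) * \<tau>"
    and "1 \<le> \<sigma> + \<tau> \<Longrightarrow> pw_linear (- 1) h M v ((real i + \<sigma>) * h, (real j + \<tau>) * h)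
      = v (Suc i) j + v i (Suc j) - v (Suc i) (Suc j)
        + (v (Suc i) (Suc j) - v i (Suc j)) * \<sigma> + (v (Suc i) (Suc j) - v (Suc i) j) * \<tau>"
  unfolding pw_linear_cell[OF h ij \<sigma> \<tau>] using \<sigma> \<tau> by (simp_all add: hat_up_lower hat_up_upper hat_down_lower
      hat_down_upper algebra_simps)

section \<open>Affinity on each triangle of the two meshes\<close>

lemma P1_on_triangle:
  assumes h: "h > 0"
    and K: "K = convex hull {(a1 * h, b1 * h), (a2 * h, b2 * h), (a3 * h, b3 * h)}"
    and u: "\<And>r s t. 0 \<le> r \<Longrightarrow> 0 \<le> s \<Longrightarrow> 0 \<le> t \<Longrightarrow> r + s + t = 1 \<Longrightarrow>
      u ((r * a1 + s * a2 + t * a3) * h, (r * b1 + s * b2 + t * b3) * h)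
      = A + B * (r * a1 + s * a2 + t * a3) + C * (r * b1 + s * b2 + t * b3)"
  shows "P1_on K u"
  unfolding P1_on_def
proof (intro exI ballI, clarify)
  fix x y assume "(x, y) \<in> K"
  then obtain r s t where rst: "0 \<le> r" "0 \<le> s" "0 \<le> t" "r + s + t = 1"
    and xy: "x = r * (a1 * h) + s * (a2 * h) + t * (a3 * h)" "y = r * (b1 * h) + s * (b2 * h) + t * (b3 * h)"
    unfolding K convex_hull_3 by auto
  have eq: "x = (r * a1 + s * a2 + t * a3) * h" "y = (r * b1 + s * b2 + t * b3) * h"
    by (simp_all add: xy algebra_simps)
  show "u (x, y) = A + B / h * x + C / h * y"
    unfolding eq u[OF rst] using h by simp
qed

lemma pw_linear_P1:
  assumes h: "h > 0"
  shows "K \<in> mesh_up h M \<Longrightarrow> P1_on K (pw_linear 1 h M v)" "K \<in> mesh_down h M \<Longrightarrow> P1_on K (pw_linear (- 1) h M v)"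
proof -
  note T = pw_linear_triangles[OF h]
  assume "K \<in> mesh_up h M"
  then obtain i j where ij: "i < M" "j < M"
    and K: "K = convex hull {node h i j, node h (i + 1) j, node h (i + 1) (j + 1)} \<or>
      K = convex hull {node h i j, node h i (j + 1), node h (i + 1) (j + 1)}"
    by (auto simp: mesh_up_def)
  from K show "P1_on K (pw_linear 1 h M v)"
  proof
    assume K: "K = convex hull {node h i j, node h (i + 1) j, node h (i + 1) (j + 1)}"
    show ?thesis
    proof (rule P1_on_triangle[OF h K[unfolded node_def]])
      fix r s t :: real assume rst: "0 \<le> r" "0 \<le> s" "0 \<le> t" "r + s + t = 1"
      then have r: "r = 1 - s - t" by simp
      have e: "r * real i + s * real (i + 1) + t * real (i + 1) = real i + (s + t)"
        "r * real j + s * real j + t * real (j + 1) = real j + t"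
        by (simp_all add: r algebra_simps)
      show "pw_linear 1 h M v ((r * real i + s * real (i + 1) + t * real (i + 1)) * h,
          (r * real j + s * real j + t * real (j + 1)) * h)
        = v i j - (v (Suc i) j - v i j) * real i - (v (Suc i) (Suc j) - v (Suc i) j) * real j
        + (v (Suc i) j - v i j) * (r * real i + s * real (i + 1) + t * real (i + 1))
        + (v (Suc i) (Suc j) - v (Suc i) j) * (r * real j + s * real j + t * real (j + 1))"
        unfolding e using rst by (subst T(1)[OF ij]) (auto simp: algebra_simps)
    qed
  next
    assume K: "K = convex hull {node h i j, node h i (j + 1), node h (i + 1) (j + 1)}"
    show ?thesis
    proof (rule P1_on_triangle[OF h K[unfolded node_def]])
      fix r s t :: real assume rst: "0 \<le> r" "0 \<le> s" "0 \<le> t" "r + s + t = 1"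
      then have r: "r = 1 - s - t" by simp
      have e: "r * real i + s * real i + t * real (i + 1) = real i + t"
        "r * real j + s * real (j + 1) + t * real (j + 1) = real j + (s + t)"
        by (simp_all add: r algebra_simps)
      show "pw_linear 1 h M v ((r * real i + s * real i + t * real (i + 1)) * h,
          (r * real j + s * real (j + 1) + t * real (j + 1)) * h)
        = v i j - (v (Suc i) (Suc j) - v i (Suc j)) * real i - (v i (Suc j) - v i j) * real j
        + (v (Suc i) (Suc j) - v i (Suc j)) * (r * real i + s * real i + t * real (i + 1))
        + (v i (Suc j) - v i j) * (r * real j + s * real (j + 1) + t * real (j + 1))"
        unfolding e using rst by (subst T(2)[OF ij]) (auto simp: algebra_simps)
    qed
  qed
next
  note T = pw_linear_triangles[OF h]
  assume "K \<in> mesh_down h M"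
  then obtain i j where ij: "i < M" "j < M"
    and K: "K = convex hull {node h (i + 1) j, node h i (j + 1), node h i j} \<or>
      K = convex hull {node h (i + 1) j, node h i (j + 1), node h (i + 1) (j + 1)}"
    by (auto simp: mesh_down_def)
  from K show "P1_on K (pw_linear (- 1) h M v)"
  proof
    assume K: "K = convex hull {node h (i + 1) j, node h i (j + 1), node h i j}"
    show ?thesis
    proof (rule P1_on_triangle[OF h K[unfolded node_def]])
      fix r s t :: real assume rst: "0 \<le> r" "0 \<le> s" "0 \<le> t" "r + s + t = 1"
      then have r: "t = 1 - s - r" by simp
      have e: "r * real (i + 1) + s * real i + t * real i = real i + r"
        "r * real j + s * real (j + 1) + t * real j = real j + s"
        by (simp_all add: r algebra_simps)
      show "pw_linear (- 1) h M v ((r * real (i + 1) + s * real i + t * real i) * h,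
          (r * real j + s * real (j + 1) + t * real j) * h)
        = v i j - (v (Suc i) j - v i j) * real i - (v i (Suc j) - v i j) * real j
        + (v (Suc i) j - v i j) * (r * real (i + 1) + s * real i + t * real i)
        + (v i (Suc j) - v i j) * (r * real j + s * real (j + 1) + t * real j)"
        unfolding e using rst by (subst T(3)[OF ij]) (auto simp: algebra_simps)
    qed
  next
    assume K: "K = convex hull {node h (i + 1) j, node h i (j + 1), node h (i + 1) (j + 1)}"
    show ?thesis
    proof (rule P1_on_triangle[OF h K[unfolded node_def]])
      fix r s t :: real assume rst: "0 \<le> r" "0 \<le> s" "0 \<le> t" "r + s + t = 1"
      then have r: "t = 1 - s - r" by simp
      have e: "r * real (i + 1) + s * real i + t * real (i + 1) = real i + (1 - s)"
        "r * real j + s * real (j + 1) + t * real (j + 1) = real j + (1 - r)"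
        by (simp_all add: r algebra_simps)
      show "pw_linear (- 1) h M v ((r * real (i + 1) + s * real i + t * real (i + 1)) * h,
          (r * real j + s * real (j + 1) + t * real (j + 1)) * h)
        = v (Suc i) j + v i (Suc j) - v (Suc i) (Suc j)
          - (v (Suc i) (Suc j) - v i (Suc j)) * real i - (v (Suc i) (Suc j) - v (Suc i) j) * real j
        + (v (Suc i) (Suc j) - v i (Suc j)) * (r * real (i + 1) + s * real i + t * real (i + 1))
        + (v (Suc i) (Suc j) - v (Suc i) j) * (r * real j + s * real (j + 1) + t * real (j + 1))"
        unfolding e using rst by (subst T(4)[OF ij]) (auto simp: algebra_simps)
    qed
  qed
qed

section \<open>Slopes of piecewise linear functions at almost every point\<close>

lemma affine_nearI:
  assumes h: "h > 0" and r: "r > 0"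
    and u: "\<And>\<sigma>' \<tau>'. \<bar>\<sigma>' - \<sigma>\<bar> < r \<Longrightarrow> \<bar>\<tau>' - \<tau>\<bar> < r \<Longrightarrow> u ((a + \<sigma>') * h, (b + \<tau>') * h) = A + B * \<sigma>' + C * \<tau>'"
  shows "affine_near u ((a + \<sigma>) * h, (b + \<tau>) * h) (B / h) (C / h)"
  unfolding affine_near_def
proof (intro exI[of _ "r * h"] conjI allI impI)
  show "0 < r * h"
    using h r by simp
  fix x y
  assume xy: "\<bar>x - fst ((a + \<sigma>) * h, (b + \<tau>) * h)\<bar> < r * h \<and> \<bar>y - snd ((a + \<sigma>) * h, (b + \<tau>) * h)\<bar> < r * h"
  have e: "x = (a + (x / h - a)) * h" "y = (b + (y / h - b)) * h"
    using h by (simp_all add: field_simps)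
  have "\<bar>x - (a + \<sigma>) * h\<bar> = \<bar>x / h - a - \<sigma>\<bar> * h" "\<bar>y - (b + \<tau>) * h\<bar> = \<bar>y / h - b - \<tau>\<bar> * h"
    using h abs_mult[of "x / h - a - \<sigma>" h] abs_mult[of "y / h - b - \<tau>" h] by (simp_all add: field_simps)
  then have near: "\<bar>x / h - a - \<sigma>\<bar> < r" "\<bar>y / h - b - \<tau>\<bar> < r"
    using xy h by auto
  have 1: "u (x, y) = A + B * (x / h - a) + C * (y / h - b)"
    using u[OF near] e by simp
  have 2: "u ((a + \<sigma>) * h, (b + \<tau>) * h) = A + B * \<sigma> + C * \<tau>"
    using u[of \<sigma> \<tau>] r by simp
  show "u (x, y) = u ((a + \<sigma>) * h, (b + \<tau>) * h) + B / h * (x - fst ((a + \<sigma>) * h, (b + \<tau>) * h))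
      + C / h * (y - snd ((a + \<sigma>) * h, (b + \<tau>) * h))"
    unfolding 1 2 using h by (simp add: field_simps)
qed

text \<open>On each triangle, for either direction of the diagonals, the slope in x is the
  difference quotient along one of the two horizontal edges of the cell, and the slope in y that
  along one of its two vertical edges. Recording only this lets the error analysis treat all four
  kinds of triangles at once.\<close>

definition cell_slopes :: "(real \<times> real \<Rightarrow> real) \<Rightarrow> real \<Rightarrow> (nat \<Rightarrow> nat \<Rightarrow> real) \<Rightarrow> nat \<Rightarrow> nat \<Rightarrow> real \<times> real \<Rightarrow> bool" where
  "cell_slopes u h v i j p \<longleftrightarrow> (\<exists>i'\<in>{i, Suc i}. \<exists>j'\<in>{j, Suc j}.
     affine_near u p ((v (Suc i) j' - v i j') / h) ((v i' (Suc j) - v i' j) / h))"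

lemma near_order: "\<bar>a' - a\<bar> < (a - b) / 2 \<Longrightarrow> \<bar>b' - b\<bar> < (a - b) / 2 \<Longrightarrow> b' \<le> (a' :: real)"
  by argo

lemma near_sum_le: "\<bar>a' - a\<bar> < (1 - a - b) / 2 \<Longrightarrow> \<bar>b' - b\<bar> < (1 - a - b) / 2 \<Longrightarrow> a' + b' \<le> (1 :: real)"
  by argo

lemma near_sum_ge: "\<bar>a' - a\<bar> < (a + b - 1) / 2 \<Longrightarrow> \<bar>b' - b\<bar> < (a + b - 1) / 2 \<Longrightarrow> (1 :: real) \<le> a' + b'"
  by argo

lemma pw_linear_cell_slopes:
  assumes h: "h > 0" and ij: "i < M" "j < M" and \<sigma>: "0 < \<sigma>" "\<sigma> < 1" and \<tau>: "0 < \<tau>" "\<tau> < 1"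
    and \<kappa>: "\<kappa> = 1 \<and> \<sigma> \<noteq> \<tau> \<or> \<kappa> = - 1 \<and> \<sigma> + \<tau> \<noteq> 1"
  shows "cell_slopes (pw_linear \<kappa> h M v) h v i j ((real i + \<sigma>) * h, (real j + \<tau>) * h)"
proof -
  note T = pw_linear_triangles[OF h ij]
  \<comment> \<open>Within distance \<open>r0\<close> a point stays in the cell; in each case below,
    half the gap to the diagonal is added as a second bound, so that it also stays in the same
    triangle.\<close>
  define r0 where "r0 = min (min \<sigma> (1 - \<sigma>)) (min \<tau> (1 - \<tau>))"
  have r0: "r0 > 0" "r0 \<le> \<sigma>" "r0 \<le> 1 - \<sigma>" "r0 \<le> \<tau>" "r0 \<le> 1 - \<tau>"
    using \<sigma> \<tau> by (auto simp: r0_def)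
  consider "\<kappa> = 1" "\<tau> < \<sigma>" | "\<kappa> = 1" "\<sigma> < \<tau>" | "\<kappa> = - 1" "\<sigma> + \<tau> < 1" | "\<kappa> = - 1" "1 < \<sigma> + \<tau>"
    using \<kappa> by linarith
  then show ?thesis
  proof cases
    case 1
    have "affine_near (pw_linear \<kappa> h M v) ((real i + \<sigma>) * h, (real j + \<tau>) * h) ((v (Suc i) j - v i j) / h) ((v (Suc i) (Suc j) - v (Suc i) j) / h)"
      unfolding \<open>\<kappa> = 1\<close>
    proof (rule affine_nearI[OF h])
      show "0 < min r0 ((\<sigma> - \<tau>) / 2)"
        using 1 r0 by simp
      fix \<sigma>' \<tau>' :: real
      assume "\<bar>\<sigma>' - \<sigma>\<bar> < min r0 ((\<sigma> - \<tau>) / 2)" "\<bar>\<tau>' - \<tau>\<bar> < min r0 ((\<sigma> - \<tau>) / 2)"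
      then have n: "\<bar>\<sigma>' - \<sigma>\<bar> < r0" "\<bar>\<tau>' - \<tau>\<bar> < r0" "\<bar>\<sigma>' - \<sigma>\<bar> < (\<sigma> - \<tau>) / 2" "\<bar>\<tau>' - \<tau>\<bar> < (\<sigma> - \<tau>) / 2"
        by simp_all
      then have "0 \<le> \<sigma>'" "\<sigma>' \<le> 1" "0 \<le> \<tau>'" "\<tau>' \<le> 1"
        using r0 unfolding abs_less_iff by linarith+
      then show "pw_linear 1 h M v ((real i + \<sigma>') * h, (real j + \<tau>') * h) = v i j + (v (Suc i) j - v i j) * \<sigma>' + (v (Suc i) (Suc j) - v (Suc i) j) * \<tau>'"
        using near_order[OF n(3,4)] by (rule T(1))
    qed
    then show ?thesis
      by (auto simp: cell_slopes_def)
  next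
    case 2
    have "affine_near (pw_linear \<kappa> h M v) ((real i + \<sigma>) * h, (real j + \<tau>) * h) ((v (Suc i) (Suc j) - v i (Suc j)) / h) ((v i (Suc j) - v i j) / h)"
      unfolding \<open>\<kappa> = 1\<close>
    proof (rule affine_nearI[OF h])
      show "0 < min r0 ((\<tau> - \<sigma>) / 2)"
        using 2 r0 by simp
      fix \<sigma>' \<tau>' :: real
      assume "\<bar>\<sigma>' - \<sigma>\<bar> < min r0 ((\<tau> - \<sigma>) / 2)" "\<bar>\<tau>' - \<tau>\<bar> < min r0 ((\<tau> - \<sigma>) / 2)"
      then have n: "\<bar>\<sigma>' - \<sigma>\<bar> < r0" "\<bar>\<tau>' - \<tau>\<bar> < r0" "\<bar>\<sigma>' - \<sigma>\<bar> < (\<tau> - \<sigma>) / 2" "\<bar>\<tau>' - \<tau>\<bar> < (\<tau> - \<sigma>) / 2"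
        by simp_all
      then have "0 \<le> \<sigma>'" "\<sigma>' \<le> 1" "0 \<le> \<tau>'" "\<tau>' \<le> 1"
        using r0 unfolding abs_less_iff by linarith+
      then show "pw_linear 1 h M v ((real i + \<sigma>') * h, (real j + \<tau>') * h) = v i j + (v (Suc i) (Suc j) - v i (Suc j)) * \<sigma>' + (v i (Suc j) - v i j) * \<tau>'"
        using near_order[OF n(4,3)] by (rule T(2))
    qed
    then show ?thesis
      by (auto simp: cell_slopes_def)
  next
    case 3
    have "affine_near (pw_linear \<kappa> h M v) ((real i + \<sigma>) * h, (real j + \<tau>) * h) ((v (Suc i) j - v i j) / h) ((v i (Suc j) - v i j) / h)"
      unfolding \<open>\<kappa> = - 1\<close>
    proof (rule affine_nearI[OF h])
      show "0 < min r0 ((1 - \<sigma> - \<tau>) / 2)"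
        using 3 r0 by simp
      fix \<sigma>' \<tau>' :: real
      assume "\<bar>\<sigma>' - \<sigma>\<bar> < min r0 ((1 - \<sigma> - \<tau>) / 2)" "\<bar>\<tau>' - \<tau>\<bar> < min r0 ((1 - \<sigma> - \<tau>) / 2)"
      then have n: "\<bar>\<sigma>' - \<sigma>\<bar> < r0" "\<bar>\<tau>' - \<tau>\<bar> < r0" "\<bar>\<sigma>' - \<sigma>\<bar> < (1 - \<sigma> - \<tau>) / 2" "\<bar>\<tau>' - \<tau>\<bar> < (1 - \<sigma> - \<tau>) / 2"
        by simp_all
      then have "0 \<le> \<sigma>'" "\<sigma>' \<le> 1" "0 \<le> \<tau>'" "\<tau>' \<le> 1"
        using r0 unfolding abs_less_iff by linarith+
      then show "pw_linear (- 1) h M v ((real i + \<sigma>') * h, (real j + \<tau>') * h) = v i j + (v (Suc i) j - v i j) * \<sigma>' + (v i (Suc j) - v i j) * \<tau>'"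
        using near_sum_le[OF n(3,4)] by (rule T(3))
    qed
    then show ?thesis
      by (auto simp: cell_slopes_def)
  next
    case 4
    have "affine_near (pw_linear \<kappa> h M v) ((real i + \<sigma>) * h, (real j + \<tau>) * h) ((v (Suc i) (Suc j) - v i (Suc j)) / h) ((v (Suc i) (Suc j) - v (Suc i) j) / h)"
      unfolding \<open>\<kappa> = - 1\<close>
    proof (rule affine_nearI[OF h])
      show "0 < min r0 ((\<sigma> + \<tau> - 1) / 2)"
        using 4 r0 by simp
      fix \<sigma>' \<tau>' :: real
      assume "\<bar>\<sigma>' - \<sigma>\<bar> < min r0 ((\<sigma> + \<tau> - 1) / 2)" "\<bar>\<tau>' - \<tau>\<bar> < min r0 ((\<sigma> + \<tau> - 1) / 2)"
      then have n: "\<bar>\<sigma>' - \<sigma>\<bar> < r0" "\<bar>\<tau>' - \<tau>\<bar> < r0" "\<bar>\<sigma>' - \<sigma>\<bar> < (\<sigma> + \<tau> - 1) / 2" "\<bar>\<tau>' - \<tau>\<bar> < (\<sigma> + \<tau> - 1) / 2"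
        by simp_all
      then have "0 \<le> \<sigma>'" "\<sigma>' \<le> 1" "0 \<le> \<tau>'" "\<tau>' \<le> 1"
        using r0 unfolding abs_less_iff by linarith+
      then show "pw_linear (- 1) h M v ((real i + \<sigma>') * h, (real j + \<tau>') * h) = v (Suc i) j + v i (Suc j) - v (Suc i) (Suc j) + (v (Suc i) (Suc j) - v i (Suc j)) * \<sigma>' + (v (Suc i) (Suc j) - v (Suc i) j) * \<tau>'"
        using near_sum_ge[OF n(3,4)] by (rule T(4))
    qed
    then show ?thesis
      by (auto simp: cell_slopes_def)
  qed
qed

lemma cell_index:
  assumes h: "h > 0" and M: "M \<ge> 1" and y: "0 \<le> y" "y \<le> real M * h"
  obtains j \<tau> where "j < M" "0 \<le> \<tau>" "\<tau> \<le> 1" "y = (real j + \<tau>) * h"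
proof (cases "y < real M * h")
  case True
  define j where "j = nat \<lfloor>y / h\<rfloor>"
  have f: "0 \<le> \<lfloor>y / h\<rfloor>"
    using y h by simp
  then have j: "real j = of_int \<lfloor>y / h\<rfloor>"
    by (simp add: j_def)
  have "y / h < real M"
    using True h by (simp add: divide_less_eq)
  then have "real j < real M"
    unfolding j using of_int_floor_le[of "y / h"] by linarith
  moreover have "0 \<le> y / h - real j" "y / h - real j \<le> 1"
    unfolding j by linarith+
  moreover have "y = (real j + (y / h - real j)) * h"
    using h by simp
  ultimately show ?thesis
    using that[of j "y / h - real j"] by auto
next
  case False
  \<comment> \<open>The upper end of the range belongs to the last cell, with \<tau> = 1.\<close>
  then show ?thesis
    using that[of "M - 1" 1] M y by (auto simp: of_nat_diff)
qed

lemma AE_not_on_line: "AE p in lborel. fst p - \<kappa> * snd p \<noteq> (c::real)"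
proof -
  have "{p \<in> space (lborel \<Otimes>\<^sub>M lborel). snd p - \<kappa> * fst p \<noteq> c} \<in> sets (lborel \<Otimes>\<^sub>M (lborel :: real measure))"
    by measurable
  moreover have "AE y in lborel. AE x in lborel. snd (y, x) - \<kappa> * fst (y, x) \<noteq> c"
  proof (rule AE_I2)
    fix y :: real
    show "AE x in lborel. snd (y, x) - \<kappa> * fst (y, x) \<noteq> c"
      using AE_lborel_singleton[of "c + \<kappa> * y"] by eventually_elim auto
  qed
  ultimately have "AE p in lborel \<Otimes>\<^sub>M (lborel :: real measure). snd p - \<kappa> * fst p \<noteq> c"
    by (rule lborel_pair.AE_pair_measure)
  then have "AE p :: real \<times> real in lborel. snd p - \<kappa> * fst p \<noteq> c"
    unfolding lborel_prod .
  then show ?thesis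
    using AE_lborel_swap[of "\<lambda>p. fst p - \<kappa> * snd p \<noteq> c"] by simp
qed

lemma AE_pw_linear_slopes:
  assumes h: "h > 0" and M: "M \<ge> 1" and \<kappa>: "\<kappa> = 1 \<or> \<kappa> = - 1"
  shows "AE p in lborel. p \<in> \<Omega> (real M * h) \<longrightarrow> (\<exists>i<M. \<exists>j<M.
    real i * h < fst p \<and> fst p < (real i + 1) * h \<and> real j * h < snd p \<and> snd p < (real j + 1) * h \<and>
    cell_slopes (pw_linear \<kappa> h M v) h v i j p)"
proof -
  have "AE p :: real \<times> real in lborel. \<forall>k::nat. fst p \<noteq> real k * h"
    unfolding AE_all_countable by (rule allI, rule AE_lborel_fst_snd(1)[OF AE_lborel_singleton])
  moreover have "AE p :: real \<times> real in lborel. \<forall>k::nat. snd p \<noteq> real k * h"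
    unfolding AE_all_countable by (rule allI, rule AE_lborel_fst_snd(2)[OF AE_lborel_singleton])
  \<comment> \<open>These lines contain all diagonals: along them x - y, respectively x + y, is an
    integer multiple of h. With the grid lines they form a countable family, hence a null
    set.\<close>
  moreover have "AE p in lborel. \<forall>k::int. fst p - \<kappa> * snd p \<noteq> of_int k * h"
    unfolding AE_all_countable by (rule allI, rule AE_not_on_line)
  ultimately show ?thesis
  proof eventually_elim
    case (elim p)
    show ?case
    proof
      assume p: "p \<in> \<Omega> (real M * h)"
      then have b: "0 \<le> fst p" "fst p \<le> real M * h" "0 \<le> snd p" "snd p \<le> real M * h"
        by (auto simp: \<Omega>_def)
      obtain i \<sigma> where i: "i < M" "0 \<le> \<sigma>" "\<sigma> \<le> 1" "fst p = (real i + \<sigma>) * h"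
        using cell_index[OF h M b(1,2)] .
      obtain j \<tau> where j: "j < M" "0 \<le> \<tau>" "\<tau> \<le> 1" "snd p = (real j + \<tau>) * h"
        using cell_index[OF h M b(3,4)] .
      have s: "\<sigma> \<noteq> 0" "\<sigma> \<noteq> 1" "\<tau> \<noteq> 0" "\<tau> \<noteq> 1"
        using elim(1)[rule_format, of i] elim(1)[rule_format, of "Suc i"]
          elim(2)[rule_format, of j] elim(2)[rule_format, of "Suc j"] i j by (auto simp: algebra_simps)
      have "\<kappa> = 1 \<and> \<sigma> \<noteq> \<tau> \<or> \<kappa> = - 1 \<and> \<sigma> + \<tau> \<noteq> 1"
        using \<kappa>
      proof
        assume "\<kappa> = 1"
        moreover have "\<sigma> \<noteq> \<tau>"
        proof
          assume "\<sigma> = \<tau>"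
          then have "fst p - \<kappa> * snd p = of_int (int i - int j) * h"
            using \<open>\<kappa> = 1\<close> by (simp add: i(4) j(4) left_diff_distrib distrib_right)
          then show False
            using elim(3) by blast
        qed
        ultimately show ?thesis
          by simp
      next
        assume "\<kappa> = - 1"
        moreover have "\<sigma> + \<tau> \<noteq> 1"
        proof
          assume "\<sigma> + \<tau> = 1"
          then have "\<tau> = 1 - \<sigma>"
            by simp
          then have "fst p - \<kappa> * snd p = of_int (int i + int j + 1) * h"
            using \<open>\<kappa> = - 1\<close> by (simp add: i(4) j(4) left_diff_distrib distrib_right)
          then show False
            using elim(3) by blast
        qed
        ultimately show ?thesis
          by simp
      qed
      then have "cell_slopes (pw_linear \<kappa> h M v) h v i j p"
        using pw_linear_cell_slopes[OF h i(1) j(1), of \<sigma> \<tau> \<kappa> v] i j s by (cases p) auto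
      moreover have "real i * h < fst p" "fst p < (real i + 1) * h" "real j * h < snd p" "snd p < (real j + 1) * h"
        using i j s h by (auto simp: algebra_simps)
      ultimately show "\<exists>i<M. \<exists>j<M. real i * h < fst p \<and> fst p < (real i + 1) * h \<and> real j * h < snd p \<and>
          snd p < (real j + 1) * h \<and> cell_slopes (pw_linear \<kappa> h M v) h v i j p"
        using i(1) j(1) by blast
    qed
  qed
qed

text \<open>On a vertical side only the nodes of that side contribute, with weights 1 - \<tau> and
  \<tau> that sum to 1.\<close>

lemma pw_linear_column:
  assumes h: "h > 0" and M: "M \<ge> 1" and \<kappa>: "\<kappa> = 1 \<or> \<kappa> = - 1" and y: "0 \<le> y" "y \<le> real M * h"
    and v: "\<And>j. j \<le> M \<Longrightarrow> v k j = c" and k: "k = 0 \<or> k = M"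
  shows "pw_linear \<kappa> h M v (real k * h, y) = c"
proof -
  obtain j \<tau> where j: "j < M" "0 \<le> \<tau>" "\<tau> \<le> 1" "y = (real j + \<tau>) * h"
    using cell_index[OF h M y] .
  have hat: "hat \<kappa> 0 \<tau> = 1 - \<tau>" "hat \<kappa> 0 (\<tau> - 1) = \<tau>"
    using j \<kappa> by (auto simp: hat_def max_def abs_if)
  have c: "c * (1 - \<tau>) + c * \<tau> = c"
    by (simp add: algebra_simps)
  from k show ?thesis
  proof
    assume k0: "k = 0"
    have "pw_linear \<kappa> h M v ((real 0 + 0) * h, (real j + \<tau>) * h) = c"
      using M j k0 v[of j] v[of "Suc j"] by (subst pw_linear_cell[OF h]) (auto simp: hat hat_eq_0 c)
    then show ?thesis
      by (simp add: j k0)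
  next
    assume kM: "k = M"
    \<comment> \<open>The right side is reached as the edge with first local coordinate 1 of the
      last column of cells, since there is no cell with index \<open>M\<close>.\<close>
    have "pw_linear \<kappa> h M v ((real (M - 1) + 1) * h, (real j + \<tau>) * h) = c"
      using M j kM v[of j] v[of "Suc j"] by (subst pw_linear_cell[OF h]) (auto simp: hat hat_eq_0 c)
    then show ?thesis
      using M by (simp add: j kM of_nat_diff)
  qed
qed

lemma pw_linear_in_Vhc:
  assumes L: "L > 0" and T: "uniform_mesh L M T"
    and v0: "\<And>j. j \<le> M \<Longrightarrow> v 0 j = c" and vM: "\<And>j. j \<le> M \<Longrightarrow> v M j = 0"
  obtains u where "u \<in> Vhc L T" "u \<in> H1 (\<Omega> L)" "has_trace (\<Omega> L) (side L 0) u (\<lambda>_. c)"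
    "AE p in lborel. p \<in> \<Omega> L \<longrightarrow> (\<exists>i<M. \<exists>j<M. \<exists>i'\<in>{i, Suc i}. \<exists>j'\<in>{j, Suc j}.
      real i * (L / real M) < fst p \<and> fst p < (real i + 1) * (L / real M) \<and>
      real j * (L / real M) < snd p \<and> snd p < (real j + 1) * (L / real M) \<and>
      weak_partial (\<Omega> L) (1, 0) u p = (v (Suc i) j' - v i j') / (L / real M) \<and>
      weak_partial (\<Omega> L) (0, 1) u p = (v i' (Suc j) - v i' j) / (L / real M))"
proof -
  define h where "h = L / real M"
  have M: "M \<ge> 1"
    using T by (auto simp: uniform_mesh_def)
  have h: "h > 0" and Mh: "real M * h = L"
    using L M by (auto simp: h_def)
  define \<kappa> :: real where "\<kappa> = (if T = mesh_up h M then 1 else - 1)"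
  have \<kappa>: "\<kappa> = 1 \<or> \<kappa> = - 1" "\<bar>\<kappa>\<bar> = 1"
    by (auto simp: \<kappa>_def)
  let ?u = "pw_linear \<kappa> h M v"
  have P1: "\<forall>K\<in>T. P1_on K ?u"
    using T pw_linear_P1[OF h, of _ M v] by (auto simp: uniform_mesh_def \<kappa>_def h_def[symmetric] split: if_splits)
  note lip = pw_linear_lipschitz[OF \<kappa>(2) h, where M = M and v = v]
  note slopes = AE_pw_linear_slopes[OF h M \<kappa>(1), of v, unfolded Mh]
  have "AE p in lborel. p \<in> \<Omega> L \<longrightarrow> (\<exists>cx cy. affine_near ?u p cx cy)"
    using slopes by eventually_elim (unfold cell_slopes_def, blast)
  note H = locally_affine_H1[OF lip this]
  have t0: "has_trace (\<Omega> L) (side L 0) ?u (\<lambda>_. c)"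
    using pw_linear_column[OF h M \<kappa>(1), of _ v 0 c] v0 by (intro H(3)) (auto simp: Mh)
  have tL: "has_trace (\<Omega> L) (side L L) ?u (\<lambda>_. 0)"
    using pw_linear_column[OF h M \<kappa>(1), of _ v M 0] vM by (intro H(3)) (auto simp: Mh)
  have "?u \<in> Vc L"
    using H(1) t0 tL by (auto simp: Vc_def ds_eq_side[OF L])
  then have "?u \<in> Vhc L T"
    using P1 coord_lipschitz_continuous[OF lip] by (auto simp: Vhc_def intro: continuous_on_subset)
  moreover have "AE p in lborel. p \<in> \<Omega> L \<longrightarrow> (\<exists>i<M. \<exists>j<M. \<exists>i'\<in>{i, Suc i}. \<exists>j'\<in>{j, Suc j}.
      real i * h < fst p \<and> fst p < (real i + 1) * h \<and> real j * h < snd p \<and> snd p < (real j + 1) * h \<and>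
      weak_partial (\<Omega> L) (1, 0) ?u p = (v (Suc i) j' - v i j') / h \<and>
      weak_partial (\<Omega> L) (0, 1) ?u p = (v i' (Suc j) - v i' j) / h)"
    using slopes H(2)
  proof eventually_elim
    case (elim p)
    show ?case
    proof
      assume p: "p \<in> \<Omega> L"
      then obtain i j i' j' where ij: "i < M" "j < M" "real i * h < fst p" "fst p < (real i + 1) * h"
        "real j * h < snd p" "snd p < (real j + 1) * h" "i' \<in> {i, Suc i}" "j' \<in> {j, Suc j}"
        and a: "affine_near ?u p ((v (Suc i) j' - v i j') / h) ((v i' (Suc j) - v i' j) / h)"
        using elim(1) unfolding cell_slopes_def by blast
      from elim(2) p a have "weak_partial (\<Omega> L) (1, 0) ?u p = (v (Suc i) j' - v i j') / h"
        "weak_partial (\<Omega> L) (0, 1) ?u p = (v i' (Suc j) - v i' j) / h"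
        by blast+
      with ij show "\<exists>i<M. \<exists>j<M. \<exists>i'\<in>{i, Suc i}. \<exists>j'\<in>{j, Suc j}.
        real i * h < fst p \<and> fst p < (real i + 1) * h \<and> real j * h < snd p \<and> snd p < (real j + 1) * h \<and>
        weak_partial (\<Omega> L) (1, 0) ?u p = (v (Suc i) j' - v i j') / h \<and>
        weak_partial (\<Omega> L) (0, 1) ?u p = (v i' (Suc j) - v i' j) / h"
        by blast
    qed
  qed
  ultimately show ?thesis
    using that[of ?u] H(1) t0 unfolding h_def by blast
qed

section \<open>The interpolation error\<close>

lemma segment_int_diff_bound:
  assumes f: "integrable lborel f" and x: "x \<in> {u..v}" and s: "s \<in> {u..v}"
  shows "\<bar>segment_int a x f - segment_int a s f\<bar> \<le> (\<integral>r. indicator {u<..<v} r * \<bar>f r\<bar> \<partial>lborel)"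
proof -
  note i = integrable_oriented_ind[OF f]
  have "segment_int a x f - segment_int a s f = (\<integral>r. oriented_ind a x r * f r - oriented_ind a s r * f r \<partial>lborel)"
    unfolding segment_int_def using i by simp
  then have "\<bar>segment_int a x f - segment_int a s f\<bar> \<le> (\<integral>r. \<bar>oriented_ind a x r * f r - oriented_ind a s r * f r\<bar> \<partial>lborel)"
    by (simp only: integral_abs_bound)
  also have "\<dots> \<le> (\<integral>r. indicator {u<..<v} r * \<bar>f r\<bar> \<partial>lborel)"
  proof (rule integral_mono_AE)
    show "AE r in lborel. \<bar>oriented_ind a x r * f r - oriented_ind a s r * f r\<bar> \<le> indicator {u<..<v} r * \<bar>f r\<bar>"
      using AE_lborel_singleton[of u] AE_lborel_singleton[of v]
    proof eventually_elim
      case (elim r)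
      have "\<bar>oriented_ind a x r - oriented_ind a s r\<bar> \<le> indicator {u<..<v} r"
        using x s elim by (auto simp: oriented_ind_def indicator_def)
      from mult_right_mono[OF this, of "\<bar>f r\<bar>"] show ?case
        by (simp add: left_diff_distrib[symmetric] abs_mult)
    qed
    show "integrable lborel (\<lambda>r. indicator {u<..<v} r * \<bar>f r\<bar>)"
      using integrable_mult_indicator[OF _ integrable_abs[OF f], of "{u<..<v}"] by simp
  qed (use i in auto)
  finally show ?thesis .
qed

lemma segment_int_interval:
  assumes f: "integrable lborel f" and uv: "0 \<le> u" "u \<le> v"
  shows "segment_int 0 v f - segment_int 0 u f = (\<integral>r. indicator {u<..<v} r * f r \<partial>lborel)"
proof -
  note i = integrable_oriented_ind[OF f]
  have [measurable]: "f \<in> borel_measurable borel"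
    using f by auto
  have "segment_int 0 v f - segment_int 0 u f = (\<integral>r. oriented_ind 0 v r * f r - oriented_ind 0 u r * f r \<partial>lborel)"
    unfolding segment_int_def using i by simp
  also have "\<dots> = (\<integral>r. indicator {u<..<v} r * f r \<partial>lborel)"
  proof (rule integral_cong_AE)
    show "AE r in lborel. oriented_ind 0 v r * f r - oriented_ind 0 u r * f r = indicator {u<..<v} r * f r"
      using AE_lborel_singleton[of u]
      by eventually_elim (use uv in \<open>auto simp: oriented_ind_def indicator_def\<close>)
  qed auto
  finally show ?thesis .
qed

text \<open>The two orders of integration of the mixed derivative serve different purposes: one
  exhibits horizontal differences of the nodal values as integrals over an edge, the other vertical
  differences.\<close>

lemma integrable_segment_int_param:
  fixes q :: "real \<times> real \<Rightarrow> real"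
  assumes q: "integrable lborel q"
  shows "integrable lborel (\<lambda>s. segment_int 0 y (\<lambda>t. q (s, t)))" "integrable lborel (\<lambda>t. segment_int 0 x (\<lambda>s. q (s, t)))"
    "segment_int 0 x (\<lambda>s. segment_int 0 y (\<lambda>t. q (s, t))) = segment_int 0 y (\<lambda>t. segment_int 0 x (\<lambda>s. q (s, t)))"
proof -
  have [measurable]: "q \<in> borel_measurable borel"
    using q by auto
  have o1: "integrable lborel (\<lambda>p. oriented_ind 0 y (snd p) * q p)"
    and o2: "integrable lborel (\<lambda>p. oriented_ind 0 x (fst p) * q p)"
    by (rule Bochner_Integration.integrable_bound[OF q];
        use abs_oriented_ind in \<open>auto simp: abs_mult intro!: mult_left_le_one_le\<close>)+
  have o3: "integrable lborel (\<lambda>p. oriented_ind 0 x (fst p) * (oriented_ind 0 y (snd p) * q p))"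
    by (rule Bochner_Integration.integrable_bound[OF o1];
        use abs_oriented_ind in \<open>auto simp: abs_mult intro!: mult_left_le_one_le\<close>)
  show "integrable lborel (\<lambda>s. segment_int 0 y (\<lambda>t. q (s, t)))" "integrable lborel (\<lambda>t. segment_int 0 x (\<lambda>s. q (s, t)))"
    using lborel_Fubini(5)[OF o1] lborel_Fubini(6)[OF o2] by (simp_all add: segment_int_def)
  show "segment_int 0 x (\<lambda>s. segment_int 0 y (\<lambda>t. q (s, t))) = segment_int 0 y (\<lambda>t. segment_int 0 x (\<lambda>s. q (s, t)))"
  proof -
    have "segment_int 0 x (\<lambda>s. segment_int 0 y (\<lambda>t. q (s, t)))
      = (\<integral>p. oriented_ind 0 x (fst p) * (oriented_ind 0 y (snd p) * q p) \<partial>lborel)"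
      using lborel_Fubini(1)[OF o3] by (simp add: segment_int_def)
    also have "\<dots> = (\<integral>t. (\<integral>s. oriented_ind 0 y t * (oriented_ind 0 x s * q (s, t)) \<partial>lborel) \<partial>lborel)"
      using lborel_Fubini(2)[OF o3] by (simp only: fst_conv snd_conv mult.left_commute)
    also have "\<dots> = segment_int 0 y (\<lambda>t. segment_int 0 x (\<lambda>s. q (s, t)))"
      by (simp add: segment_int_def)
    finally show ?thesis .
  qed
qed

text \<open>The mean of the trace of \<open>p0 x + \<integral>\<^sub>0\<^sup>y q (x, t) dt\<close> over the horizontal mesh edge at height \<open>y\<close>.\<close>

definition edge_mean :: "real \<Rightarrow> (real \<Rightarrow> real) \<Rightarrow> (real \<times> real \<Rightarrow> real) \<Rightarrow> real \<Rightarrow> real \<Rightarrow> real" where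
  "edge_mean h p0 q x0 y = (\<integral>s. indicator {x0<..<x0 + h} s * (p0 s + segment_int 0 y (\<lambda>t. q (s, t))) \<partial>lborel) / h"

section \<open>The error on a single cell\<close>

definition cell :: "real \<Rightarrow> real \<Rightarrow> real \<Rightarrow> (real \<times> real) set" where
  "cell h x0 y0 = {x0<..<x0 + h} \<times> {y0<..<y0 + h}"

lemma cell_borel [measurable, simp]: "cell h x0 y0 \<in> sets borel"
  by (simp add: cell_def open_Times)

lemma measure_cell:
  assumes "h > 0"
  shows "measure lborel (cell h x0 y0) = h\<^sup>2" "emeasure lborel (cell h x0 y0) < \<infinity>"
proof -
  have e: "emeasure lborel (cell h x0 y0) = ennreal (h\<^sup>2)"
    using assms lborel.emeasure_pair_measure_Times[of "{x0<..<x0 + h}" lborel "{y0<..<y0 + h}"]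
    by (simp add: cell_def lborel_prod power2_eq_square ennreal_mult)
  show "measure lborel (cell h x0 y0) = h\<^sup>2"
    by (simp add: measure_def e)
  show "emeasure lborel (cell h x0 y0) < \<infinity>"
    by (simp add: e)
qed

text \<open>Compare a point (x, y) of the cell with (s, \<eta>) on the edge in two moves. The
  horizontal move to (s, y) costs the integral of |a| over the row, the unknown \<open>s0\<close>
  cancelling; the vertical move to (s, \<eta>) costs the integral of |q| over the column at s,
  \<open>p0\<close> cancelling. Averaging over s turns the second cost into the integral over the
  cell divided by \<open>h\<close>.\<close>

lemma cell_pointwise_estimate:
  assumes h: "h > 0" and P: "P \<in> borel_measurable borel" and a: "integrable lborel a" and q: "integrable lborel q" and p0: "integrable lborel p0"
    and sub: "cell h x0 y0 \<subseteq> S" and \<eta>: "y0 \<le> \<eta>" "\<eta> \<le> y0 + h"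
    and Pq: "AE p in lborel. p \<in> S \<longrightarrow> P p = p0 (fst p) + segment_int 0 (snd p) (\<lambda>t. q (fst p, t))"
    and Pa: "AE p in lborel. p \<in> S \<longrightarrow> P p = s0 (snd p) + segment_int 0 (fst p) (\<lambda>s. a (s, snd p))"
  shows "AE p in lborel. p \<in> cell h x0 y0 \<longrightarrow> \<bar>P p - edge_mean h p0 q x0 \<eta>\<bar>
    \<le> (\<integral>s. indicator {x0<..<x0 + h} s * \<bar>a (s, snd p)\<bar> \<partial>lborel) + (\<integral>p. indicator (cell h x0 y0) p * \<bar>q p\<bar> \<partial>lborel) / h"
proof -
  define I where "I = {x0<..<x0 + h}"
  define J where "J = {y0<..<y0 + h}"
  define A where "A = edge_mean h p0 q x0 \<eta>"
  define g where "g s = p0 s + segment_int 0 \<eta> (\<lambda>t. q (s, t))" for s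
  define k where "k s = (\<integral>t. indicator J t * \<bar>q (s, t)\<bar> \<partial>lborel)" for s
  have indI: "integrable lborel (indicator I :: real \<Rightarrow> real)"
    by (auto simp: I_def intro!: integrable_indicator_bounded)
  have intI: "measure lborel I = h"
    using h by (simp add: I_def)
  have gi: "integrable lborel (\<lambda>s. indicator I s * g s)"
    unfolding g_def using integrable_mult_indicator[OF _ Bochner_Integration.integrable_add[OF p0 integrable_segment_int_param(1)[OF q, of \<eta>]], of I]
    by (simp add: I_def)
  have A: "h * A = (\<integral>s. indicator I s * g s \<partial>lborel)"
    using h by (simp add: A_def edge_mean_def I_def g_def)
  have qJ: "integrable lborel (\<lambda>p. indicator J (snd p) * \<bar>q p\<bar>)"
    by (rule Bochner_Integration.integrable_bound[OF q])
      (use q in \<open>auto simp: J_def indicator_def\<close>)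
  have qIJ: "integrable lborel (\<lambda>p. indicator I (fst p) * (indicator J (snd p) * \<bar>q p\<bar>))"
    by (rule Bochner_Integration.integrable_bound[OF q])
      (use q in \<open>auto simp: I_def J_def indicator_def\<close>)
  have ki: "integrable lborel (\<lambda>s. indicator I s * k s)" and kI: "(\<integral>s. indicator I s * k s \<partial>lborel) = (\<integral>p. indicator (cell h x0 y0) p * \<bar>q p\<bar> \<partial>lborel)"
  proof -
    show "integrable lborel (\<lambda>s. indicator I s * k s)"
      using lborel_Fubini(5)[OF qIJ] by (simp add: k_def)
    have "(\<integral>s. indicator I s * k s \<partial>lborel) = (\<integral>p. indicator I (fst p) * (indicator J (snd p) * \<bar>q p\<bar>) \<partial>lborel)"
      using lborel_Fubini(1)[OF qIJ] by (simp add: k_def)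
    then show "(\<integral>s. indicator I s * k s \<partial>lborel) = (\<integral>p. indicator (cell h x0 y0) p * \<bar>q p\<bar> \<partial>lborel)"
      by (simp add: cell_def I_def J_def indicator_times mult.assoc)
  qed
  have Pq': "AE p :: real \<times> real in lborel. AE s in lborel. (s, snd p) \<in> S \<longrightarrow> P (s, snd p) = p0 s + segment_int 0 (snd p) (\<lambda>t. q (s, t))"
    using AE_lborel_fst_snd(2)[OF AE_lborel_pairD(2)[OF Pq]] by simp
  have Pa': "AE p :: real \<times> real in lborel. AE s in lborel. (s, snd p) \<in> S \<longrightarrow> P (s, snd p) = s0 (snd p) + segment_int 0 s (\<lambda>s. a (s, snd p))"
    using AE_lborel_fst_snd(2)[OF AE_lborel_pairD(2)[OF Pa]] by simp
  show ?thesis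
    unfolding A_def[symmetric] I_def[symmetric]
    using Pa Pq' Pa' AE_lborel_fst_snd(2)[OF lborel_Fubini(4)[OF a]]
  proof eventually_elim
    case (elim p)
    show ?case
    proof
      assume "p \<in> cell h x0 y0"
      then obtain x y where p: "p = (x, y)" "x \<in> I" "y \<in> J"
        by (auto simp: cell_def I_def J_def)
      define \<alpha> where "\<alpha> = (\<integral>s. indicator I s * \<bar>a (s, y)\<bar> \<partial>lborel)"
      have ae: "AE s in lborel. \<bar>indicator I s * P (x, y) - indicator I s * g s\<bar> \<le> indicator I s * \<alpha> + indicator I s * k s"
        using elim(2,3) lborel_Fubini(3)[OF q]
      proof eventually_elim
        case (elim s)
        show ?case
        proof (cases "s \<in> I")
          case True
          have in_S: "(s, y) \<in> S" "(x, y) \<in> S"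
            using True p sub by (auto simp: cell_def I_def J_def)
          have "P (x, y) - P (s, y) = segment_int 0 x (\<lambda>s. a (s, y)) - segment_int 0 s (\<lambda>s. a (s, y))"
            using elim(2) in_S p \<open>p \<in> S \<longrightarrow> P p = s0 (snd p) + segment_int 0 (fst p) (\<lambda>s. a (s, snd p))\<close> by simp
          moreover have "\<bar>segment_int 0 x (\<lambda>s. a (s, y)) - segment_int 0 s (\<lambda>s. a (s, y))\<bar> \<le> \<alpha>"
            unfolding \<alpha>_def I_def using \<open>integrable lborel (\<lambda>x. a (x, snd p))\<close> True p
            by (intro segment_int_diff_bound) (auto simp: I_def)
          ultimately have 1: "\<bar>P (x, y) - P (s, y)\<bar> \<le> \<alpha>"
            by simp
          have "P (s, y) - g s = segment_int 0 y (\<lambda>t. q (s, t)) - segment_int 0 \<eta> (\<lambda>t. q (s, t))"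
            using elim(1) in_S p by (simp add: g_def)
          moreover have "\<bar>segment_int 0 y (\<lambda>t. q (s, t)) - segment_int 0 \<eta> (\<lambda>t. q (s, t))\<bar> \<le> k s"
            unfolding k_def J_def using elim(3) p \<eta> by (intro segment_int_diff_bound) (auto simp: J_def)
          ultimately have "\<bar>P (s, y) - g s\<bar> \<le> k s"
            by simp
          with 1 True show ?thesis
            by simp
        qed simp
      qed
      \<comment> \<open>The value at the fixed point is written as an average over s in the edge, so
        that it can be compared with the edge mean under one integral.\<close>
      have "h * (P (x, y) - A) = (\<integral>s. indicator I s * P (x, y) - indicator I s * g s \<partial>lborel)"
        using indI gi by (simp add: right_diff_distrib A intI)
      then have "\<bar>h * (P (x, y) - A)\<bar> \<le> (\<integral>s. \<bar>indicator I s * P (x, y) - indicator I s * g s\<bar> \<partial>lborel)"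
        by (simp only: integral_abs_bound)
      also have "\<dots> \<le> (\<integral>s. indicator I s * \<alpha> + indicator I s * k s \<partial>lborel)"
        using indI gi ki ae by (intro integral_mono_AE) auto
      also have "\<dots> = h * \<alpha> + (\<integral>p. indicator (cell h x0 y0) p * \<bar>q p\<bar> \<partial>lborel)"
        using indI ki by (simp add: intI kI)
      finally have "h * \<bar>P (x, y) - A\<bar> \<le> h * \<alpha> + (\<integral>p. indicator (cell h x0 y0) p * \<bar>q p\<bar> \<partial>lborel)"
        using h by (simp add: abs_mult)
      then have "\<bar>P (x, y) - A\<bar> \<le> (h * \<alpha> + (\<integral>p. indicator (cell h x0 y0) p * \<bar>q p\<bar> \<partial>lborel)) / h"
        using h by (simp add: pos_le_divide_eq mult.commute)
      also have "\<dots> = \<alpha> + (\<integral>p. indicator (cell h x0 y0) p * \<bar>q p\<bar> \<partial>lborel) / h"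
        using h by (simp add: add_divide_distrib)
      finally show "\<bar>P p - A\<bar> \<le> (\<integral>s. indicator I s * \<bar>a (s, snd p)\<bar> \<partial>lborel) + (\<integral>p. indicator (cell h x0 y0) p * \<bar>q p\<bar> \<partial>lborel) / h"
        by (simp add: p \<alpha>_def)
    qed
  qed
qed

text \<open>Square the pointwise bound u + w and use (u + w)^2 \<le> 2 u^2 + 2 w^2. By
  Cauchy-Schwarz u^2 is at most \<open>h\<close> times the integral of a^2 over the row, and
  integrating this over the cell yields a second factor \<open>h\<close>. Likewise w^2 is at most
  the integral of q^2 over the cell, and the area contributes h^2.\<close>

lemma cell_estimate:
  assumes h: "h > 0" and P: "P \<in> borel_measurable borel" and a: "integrable lborel a" and q: "integrable lborel q" and p0: "integrable lborel p0"
    and a2: "integrable lborel (\<lambda>p. (a p)\<^sup>2)" and q2: "integrable lborel (\<lambda>p. (q p)\<^sup>2)"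
    and sub: "cell h x0 y0 \<subseteq> S" and \<eta>: "y0 \<le> \<eta>" "\<eta> \<le> y0 + h"
    and Pq: "AE p in lborel. p \<in> S \<longrightarrow> P p = p0 (fst p) + segment_int 0 (snd p) (\<lambda>t. q (fst p, t))"
    and Pa: "AE p in lborel. p \<in> S \<longrightarrow> P p = s0 (snd p) + segment_int 0 (fst p) (\<lambda>s. a (s, snd p))"
  shows "integrable lborel (\<lambda>p. indicator (cell h x0 y0) p * (P p - edge_mean h p0 q x0 \<eta>)\<^sup>2)"
    and "(\<integral>p. indicator (cell h x0 y0) p * (P p - edge_mean h p0 q x0 \<eta>)\<^sup>2 \<partial>lborel)
      \<le> 2 * h\<^sup>2 * (\<integral>p. indicator (cell h x0 y0) p * ((a p)\<^sup>2 + (q p)\<^sup>2) \<partial>lborel)"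
proof -
  have [measurable]: "P \<in> borel_measurable borel" "a \<in> borel_measurable borel" "q \<in> borel_measurable borel"
    using P a q by auto
  let ?Q = "cell h x0 y0"
  define I where "I = {x0<..<x0 + h}"
  define J where "J = {y0<..<y0 + h}"
  have [measurable]: "I \<in> sets borel" "J \<in> sets borel"
    by (auto simp: I_def J_def)
  have ind: "indicator ?Q p = (indicator I (fst p) * indicator J (snd p) :: real)" for p
    by (simp add: cell_def I_def J_def indicator_times)
  have indI: "integrable lborel (indicator I :: real \<Rightarrow> real)" "integrable lborel (indicator J :: real \<Rightarrow> real)"
    by (auto simp: I_def J_def intro!: integrable_indicator_bounded)
  have intI: "(\<integral>s. indicator I s \<partial>lborel) = h" "measure lborel I = h" "emeasure lborel I < \<infinity>"
    using h by (auto simp: I_def)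
  define A where "A = edge_mean h p0 q x0 \<eta>"
  define \<beta> where "\<beta> = (\<integral>p. indicator ?Q p * (q p)\<^sup>2 \<partial>lborel)"
  define \<alpha> where "\<alpha> y = (\<integral>s. indicator I s * (a (s, y))\<^sup>2 \<partial>lborel)" for y
  have q2Q: "integrable lborel (\<lambda>p. indicator ?Q p * (q p)\<^sup>2)"
    using integrable_mult_indicator[OF _ q2, of ?Q] by simp
  have a2Q: "integrable lborel (\<lambda>p. indicator ?Q p * (a p)\<^sup>2)"
    using integrable_mult_indicator[OF _ a2, of ?Q] by simp
  have a2I: "integrable lborel (\<lambda>p. indicator I (fst p) * (a p)\<^sup>2)"
    by (rule Bochner_Integration.integrable_bound[OF a2]) (auto simp: indicator_def)
  have \<beta>: "((\<integral>p. indicator ?Q p * \<bar>q p\<bar> \<partial>lborel) / h)\<^sup>2 \<le> \<beta>"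
    using integral_abs_power2_le(2)[of q lborel ?Q] measure_cell[OF h, of x0 y0] q2Q h
    by (simp add: \<beta>_def power_divide divide_le_eq mult.commute)
  have "integrable lborel (\<lambda>p. indicator ?Q p * (2 * h * \<alpha> (snd p) + 2 * \<beta>)) \<and>
    (\<integral>p. indicator ?Q p * (2 * h * \<alpha> (snd p) + 2 * \<beta>) \<partial>lborel) = 2 * h\<^sup>2 * (\<integral>p. indicator ?Q p * ((a p)\<^sup>2 + (q p)\<^sup>2) \<partial>lborel)"
  proof -
    have Ji: "integrable lborel (\<lambda>y. indicator J y * \<alpha> y)" and JI: "(\<integral>y. indicator J y * \<alpha> y \<partial>lborel) = (\<integral>p. indicator ?Q p * (a p)\<^sup>2 \<partial>lborel)"
      using lborel_Fubini(6,2)[OF a2Q] by (simp_all add: ind \<alpha>_def mult.assoc mult.left_commute[of "indicator I _"])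
    have 1: "integrable lborel (\<lambda>p. indicator I (fst p) * (indicator J (snd p) * \<alpha> (snd p)))"
      "(\<integral>p. indicator I (fst p) * (indicator J (snd p) * \<alpha> (snd p)) \<partial>lborel) = h * (\<integral>p. indicator ?Q p * (a p)\<^sup>2 \<partial>lborel)"
      using integrable_lborel_prod[OF indI(1) Ji] by (simp_all add: intI JI)
    have 2: "integrable lborel (\<lambda>p. indicator ?Q p :: real)" "(\<integral>p. indicator ?Q p \<partial>lborel) = h\<^sup>2"
      using measure_cell[OF h, of x0 y0] by (simp_all add: integrable_indicator_iff)
    have eq: "(\<lambda>p. indicator ?Q p * (2 * h * \<alpha> (snd p) + 2 * \<beta>))
      = (\<lambda>p. (2 * h) * (indicator I (fst p) * (indicator J (snd p) * \<alpha> (snd p))) + (2 * \<beta>) * indicator ?Q p)"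
      by (auto simp: ind algebra_simps)
    have "(\<integral>p. indicator ?Q p * ((a p)\<^sup>2 + (q p)\<^sup>2) \<partial>lborel) = (\<integral>p. indicator ?Q p * (a p)\<^sup>2 \<partial>lborel) + \<beta>"
      unfolding \<beta>_def distrib_left using a2Q q2Q by simp
    then show ?thesis
      unfolding eq using 1 2 by (simp add: power2_eq_square algebra_simps)
  qed
  note R = this[THEN conjunct1] this[THEN conjunct2]
  have bound: "AE p in lborel. indicator ?Q p * (P p - A)\<^sup>2 \<le> indicator ?Q p * (2 * h * \<alpha> (snd p) + 2 * \<beta>)"
    using cell_pointwise_estimate[OF h P a q p0 sub \<eta> Pq Pa, folded I_def A_def] AE_lborel_fst_snd(2)[OF lborel_Fubini(4)[OF a2I]]
  proof eventually_elim
    case (elim p)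
    show ?case
    proof (cases "p \<in> ?Q")
      case True
      define u where "u = (\<integral>s. indicator I s * \<bar>a (s, snd p)\<bar> \<partial>lborel)"
      define w where "w = (\<integral>p. indicator ?Q p * \<bar>q p\<bar> \<partial>lborel) / h"
      have "\<bar>P p - A\<bar> \<le> u + w"
        using elim(1) True by (simp add: u_def w_def)
      then have "(P p - A)\<^sup>2 \<le> (u + w)\<^sup>2"
        using power_mono[of "\<bar>P p - A\<bar>" "u + w" 2] by simp
      also have "\<dots> \<le> 2 * u\<^sup>2 + 2 * w\<^sup>2"
        using sum_squares_bound[of u w] by (simp add: power2_sum)
      finally have 1: "(P p - A)\<^sup>2 \<le> 2 * u\<^sup>2 + 2 * w\<^sup>2" .
      have "u\<^sup>2 \<le> h * \<alpha> (snd p)"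
        using integral_abs_power2_le(2)[of "\<lambda>s. a (s, snd p)" lborel I] elim(2) intI(2,3)
        by (simp add: u_def \<alpha>_def)
      moreover have "w\<^sup>2 \<le> \<beta>"
        using \<beta> by (simp add: w_def)
      ultimately show ?thesis
        using 1 True by simp
    qed simp
  qed
  show "integrable lborel (\<lambda>p. indicator ?Q p * (P p - edge_mean h p0 q x0 \<eta>)\<^sup>2)"
    unfolding A_def[symmetric]
    by (rule Bochner_Integration.integrable_bound[OF R(1)]) (use bound in \<open>auto elim!: eventually_mono\<close>)
  then show "(\<integral>p. indicator ?Q p * (P p - edge_mean h p0 q x0 \<eta>)\<^sup>2 \<partial>lborel)
      \<le> 2 * h\<^sup>2 * (\<integral>p. indicator ?Q p * ((a p)\<^sup>2 + (q p)\<^sup>2) \<partial>lborel)"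
    unfolding A_def[symmetric] R(2)[symmetric] using R(1) bound by (intro integral_mono_AE)
qed

section \<open>Summation over the cells\<close>

lemma sum_indicator_intervals_le_1:
  assumes "h > 0"
  shows "(\<Sum>i<M. indicator {real i * h<..<real i * h + h} x) \<le> (1::real)"
proof -
  \<comment> \<open>The bound by the indicator of a half line instead of 1 is what the induction can
    propagate: the next interval starts where the half line ends.\<close>
  have "(\<Sum>i<M. indicator {real i * h<..<real i * h + h} x) \<le> (indicator {..<real M * h} x :: real)"
  proof (induction M)
    case (Suc M)
    have e: "real (Suc M) * h = real M * h + h"
      by (simp add: algebra_simps)
    have "(\<Sum>i<Suc M. indicator {real i * h<..<real i * h + h} x) \<le> (indicator {..<real M * h} x + indicator {real M * h<..<real M * h + h} x :: real)"
      using Suc by simp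
    also have "\<dots> \<le> indicator {..<real (Suc M) * h} x"
      unfolding e using assms by (auto simp: indicator_def)
    finally show ?case .
  qed simp
  also have "\<dots> \<le> 1"
    by (simp add: indicator_le_1)
  finally show ?thesis .
qed

lemma sum_indicator_cells_le_1:
  assumes "h > 0"
  shows "(\<Sum>i<M. \<Sum>j<M. indicator (cell h (real i * h) (real j * h)) p) \<le> (1::real)"
proof -
  have "(\<Sum>i<M. \<Sum>j<M. indicator (cell h (real i * h) (real j * h)) p :: real)
    = (\<Sum>i<M. indicator {real i * h<..<real i * h + h} (fst p)) * (\<Sum>j<M. indicator {real j * h<..<real j * h + h} (snd p))"
    by (simp add: cell_def indicator_times sum_product)
  also have "\<dots> \<le> 1"
    by (intro mult_le_one sum_indicator_intervals_le_1 assms sum_nonneg) auto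
  finally show ?thesis .
qed

text \<open>Which of the two horizontal edges of the cell determines \<open>W\<close> depends on the
  triangle. The cell is not split; instead the errors for both edges are added, which doubles the 2
  h^2 of a single cell.\<close>

lemma edge_mean_error:
  assumes h: "h > 0" and L: "L = real M * h"
    and P: "P \<in> borel_measurable borel" and a: "integrable lborel a" and q: "integrable lborel q" and p0: "integrable lborel p0"
    and a2: "integrable lborel (\<lambda>p. (a p)\<^sup>2)" and q2: "integrable lborel (\<lambda>p. (q p)\<^sup>2)"
    and Pq: "AE p in lborel. p \<in> \<Omega> L \<longrightarrow> P p = p0 (fst p) + segment_int 0 (snd p) (\<lambda>t. q (fst p, t))"
    and Pa: "AE p in lborel. p \<in> \<Omega> L \<longrightarrow> P p = s0 (snd p) + segment_int 0 (fst p) (\<lambda>s. a (s, snd p))"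
    and W: "AE p in lborel. p \<in> \<Omega> L \<longrightarrow> (\<exists>i<M. \<exists>j<M. \<exists>j'\<in>{j, Suc j}.
      p \<in> cell h (real i * h) (real j * h) \<and> W p = edge_mean h p0 q (real i * h) (real j' * h))"
    and z: "\<And>p. p \<notin> \<Omega> L \<Longrightarrow> P p = 0" "\<And>p. p \<notin> \<Omega> L \<Longrightarrow> W p = 0"
  shows "(\<integral>p. (P p - W p)\<^sup>2 \<partial>lborel) \<le> 4 * h\<^sup>2 * ((\<integral>p. (a p)\<^sup>2 \<partial>lborel) + (\<integral>p. (q p)\<^sup>2 \<partial>lborel))"
proof -
  let ?Q = "\<lambda>i j. cell h (real i * h) (real j * h)"
  define F where "F i j k p = indicator (?Q i j) p * (P p - edge_mean h p0 q (real i * h) (real k * h))\<^sup>2" for i j k p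
  have F0: "0 \<le> F i j k p" for i j k p
    by (simp add: F_def)
  have sub: "?Q i j \<subseteq> \<Omega> L" if ij: "i < M" "j < M" for i j
  proof -
    have "(real i + 1) * h \<le> real M * h" "(real j + 1) * h \<le> real M * h"
      using ij h by (intro mult_right_mono; linarith)+
    then have "real i * h + h \<le> L" "real j * h + h \<le> L"
      by (simp_all add: L algebra_simps)
    moreover have "0 \<le> real i * h" "0 \<le> real j * h"
      using h by auto
    moreover have "cell h x0 y0 \<subseteq> \<Omega> L" if "x0 + h \<le> L" "y0 + h \<le> L" "0 \<le> x0" "0 \<le> y0" for x0 y0
      using that by (auto simp: cell_def \<Omega>_def)
    ultimately show ?thesis
      by blast
  qed
  have in_edge: "real j * h \<le> real k * h" "real k * h \<le> real j * h + h" if "k \<in> {j, Suc j}" for j k :: nat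
    using that h by (auto simp: algebra_simps)
  have Fi: "integrable lborel (F i j k)"
    and FI: "(\<integral>p. F i j k p \<partial>lborel) \<le> 2 * h\<^sup>2 * (\<integral>p. indicator (?Q i j) p * ((a p)\<^sup>2 + (q p)\<^sup>2) \<partial>lborel)"
    if "i < M" "j < M" "k \<in> {j, Suc j}" for i j k
    using cell_estimate[OF h P a q p0 a2 q2 sub[OF that(1,2)] in_edge[OF that(3)] Pq Pa] by (simp_all add: F_def[abs_def])
  define G where "G p = (\<Sum>i<M. \<Sum>j<M. F i j j p + F i j (Suc j) p)" for p
  have Gi: "integrable lborel G"
    unfolding G_def by (intro Bochner_Integration.integrable_sum Bochner_Integration.integrable_add Fi) auto
  have ac: "integrable lborel (\<lambda>p. (a p)\<^sup>2 + (q p)\<^sup>2)"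
    using a2 q2 by simp
  have acQ: "integrable lborel (\<lambda>p. indicator (?Q i j) p * ((a p)\<^sup>2 + (q p)\<^sup>2))" for i j
    using integrable_mult_indicator[OF _ ac, of "?Q i j"] by simp
  have G0: "0 \<le> G p" for p
    unfolding G_def by (intro sum_nonneg add_nonneg_nonneg F0)
  have "AE p in lborel. (P p - W p)\<^sup>2 \<le> G p"
    using W
  proof eventually_elim
    case (elim p)
    show ?case
    proof (cases "p \<in> \<Omega> L")
      case True
      then obtain i j j' where ij: "i < M" "j < M" "j' \<in> {j, Suc j}" "p \<in> ?Q i j" "W p = edge_mean h p0 q (real i * h) (real j' * h)"
        using elim by blast
      have "(P p - W p)\<^sup>2 = F i j j' p"
        using ij by (simp add: F_def)
      also have "\<dots> \<le> F i j j p + F i j (Suc j) p"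
        using ij(3) F0[of i j j p] F0[of i j "Suc j" p] by auto
      also have "\<dots> \<le> (\<Sum>j<M. F i j j p + F i j (Suc j) p)"
        using ij by (intro member_le_sum) (auto intro: add_nonneg_nonneg F0)
      also have "\<dots> \<le> G p"
        unfolding G_def using ij
        by (intro member_le_sum[of i "{..<M}" "\<lambda>i. \<Sum>j<M. F i j j p + F i j (Suc j) p"]) (auto intro!: sum_nonneg add_nonneg_nonneg F0)
      finally show ?thesis .
    next
      case False
      then show ?thesis
        using G0 z by simp
    qed
  qed
  then have "(\<integral>p. (P p - W p)\<^sup>2 \<partial>lborel) \<le> (\<integral>p. G p \<partial>lborel)"
    using Gi G0 by (intro integral_mono_AE') auto
  also have "\<dots> = (\<Sum>i<M. \<Sum>j<M. (\<integral>p. F i j j p \<partial>lborel) + (\<integral>p. F i j (Suc j) p \<partial>lborel))"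
  proof -
    have 1: "integrable lborel (\<lambda>p. F i j j p + F i j (Suc j) p)" if "i < M" "j < M" for i j
      using that by (intro Bochner_Integration.integrable_add Fi) auto
    have 2: "integrable lborel (\<lambda>p. \<Sum>j<M. F i j j p + F i j (Suc j) p)" if "i < M" for i
      using that by (intro Bochner_Integration.integrable_sum 1) auto
    have "(\<integral>p. G p \<partial>lborel) = (\<Sum>i<M. \<integral>p. (\<Sum>j<M. F i j j p + F i j (Suc j) p) \<partial>lborel)"
      unfolding G_def by (rule Bochner_Integration.integral_sum) (use 2 in auto)
    also have "\<dots> = (\<Sum>i<M. \<Sum>j<M. \<integral>p. F i j j p + F i j (Suc j) p \<partial>lborel)"
      by (intro sum.cong refl Bochner_Integration.integral_sum) (use 1 in auto)
    also have "\<dots> = (\<Sum>i<M. \<Sum>j<M. (\<integral>p. F i j j p \<partial>lborel) + (\<integral>p. F i j (Suc j) p \<partial>lborel))"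
      by (intro sum.cong refl Bochner_Integration.integral_add Fi) auto
    finally show ?thesis .
  qed
  also have "\<dots> \<le> (\<Sum>i<M. \<Sum>j<M. 4 * h\<^sup>2 * (\<integral>p. indicator (?Q i j) p * ((a p)\<^sup>2 + (q p)\<^sup>2) \<partial>lborel))"
  proof (intro sum_mono)
    fix i j assume "i \<in> {..<M}" "j \<in> {..<M}"
    then show "(\<integral>p. F i j j p \<partial>lborel) + (\<integral>p. F i j (Suc j) p \<partial>lborel) \<le> 4 * h\<^sup>2 * (\<integral>p. indicator (?Q i j) p * ((a p)\<^sup>2 + (q p)\<^sup>2) \<partial>lborel)"
      using FI[of i j j] FI[of i j "Suc j"] by simp
  qed
  also have "\<dots> = 4 * h\<^sup>2 * (\<integral>p. (\<Sum>i<M. \<Sum>j<M. indicator (?Q i j) p) * ((a p)\<^sup>2 + (q p)\<^sup>2) \<partial>lborel)"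
  proof -
    have "(\<integral>p. (\<Sum>i<M. \<Sum>j<M. indicator (?Q i j) p) * ((a p)\<^sup>2 + (q p)\<^sup>2) \<partial>lborel)
      = (\<Sum>i<M. \<integral>p. (\<Sum>j<M. indicator (?Q i j) p * ((a p)\<^sup>2 + (q p)\<^sup>2)) \<partial>lborel)"
      unfolding sum_distrib_right by (rule Bochner_Integration.integral_sum) (intro Bochner_Integration.integrable_sum acQ)
    also have "\<dots> = (\<Sum>i<M. \<Sum>j<M. \<integral>p. indicator (?Q i j) p * ((a p)\<^sup>2 + (q p)\<^sup>2) \<partial>lborel)"
      by (intro sum.cong refl Bochner_Integration.integral_sum acQ)
    finally show ?thesis
      by (simp only: sum_distrib_left)
  qed
  also have "\<dots> \<le> 4 * h\<^sup>2 * (\<integral>p. (a p)\<^sup>2 + (q p)\<^sup>2 \<partial>lborel)"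
  proof (intro mult_left_mono integral_mono)
    show "integrable lborel (\<lambda>p. (\<Sum>i<M. \<Sum>j<M. indicator (?Q i j) p) * ((a p)\<^sup>2 + (q p)\<^sup>2))"
      unfolding sum_distrib_right by (intro Bochner_Integration.integrable_sum acQ)
    show "(\<Sum>i<M. \<Sum>j<M. indicator (?Q i j) p) * ((a p)\<^sup>2 + (q p)\<^sup>2) \<le> (a p)\<^sup>2 + (q p)\<^sup>2" for p
      using sum_indicator_cells_le_1[OF h, where M = M and p = p] by (intro mult_left_le_one_le) (auto intro!: sum_nonneg)
  qed (use ac in auto)
  also have "\<dots> = 4 * h\<^sup>2 * ((\<integral>p. (a p)\<^sup>2 \<partial>lborel) + (\<integral>p. (q p)\<^sup>2 \<partial>lborel))"
    using a2 q2 by simp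
  finally show ?thesis .
qed

section \<open>The nodal interpolant of the exact solution\<close>

lemma segment_int_same [simp]: "segment_int a a f = 0"
  by (simp add: segment_int_def oriented_ind_def)

lemma AE_lborel_swapI: "AE p in lborel. P p \<Longrightarrow> AE p :: real \<times> real in lborel. P (prod.swap p)"
  using AE_lborel_swap[of "\<lambda>p. P (prod.swap p)"] by simp

lemma borel_rep_weak_partial_exists:
  assumes "u \<in> H1 (\<Omega> L)" "b \<in> Basis"
  obtains g where "borel_rep (\<Omega> L) (weak_partial (\<Omega> L) b u) g"
  using borel_rep_exists[OF square_borel] H1_D(2)[OF assms] by (auto simp: square_integrable_def)

lemma H1_diff_rep:
  assumes "u \<in> H1 (\<Omega> L)" "v \<in> H1 (\<Omega> L)" "b \<in> Basis"
    and "borel_rep (\<Omega> L) (weak_partial (\<Omega> L) b u) g" "borel_rep (\<Omega> L) (weak_partial (\<Omega> L) b v) k"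
  shows "(LINT p|lebesgue_on (\<Omega> L). (weak_partial (\<Omega> L) b (\<lambda>x. u x - v x) p)\<^sup>2) = (\<integral>p. (g p - k p)\<^sup>2 \<partial>lborel)"
proof -
  have "borel_rep (\<Omega> L) (weak_partial (\<Omega> L) b (\<lambda>x. u x - v x)) (\<lambda>p. g p - k p)"
    using borel_rep_diff[OF assms(4,5)] H1_D(2)[OF H1_diff(1)[OF assms(1,2)] assms(3)]
      H1_diff(2)[OF assms(1-3), unfolded AE_lebesgue_on[OF square_borel]]
    unfolding borel_rep_def square_integrable_def by auto
  from borel_rep_integral(1)[OF square_borel borel_rep_power2[OF this]] show ?thesis .
qed

lemma interpolation_error:
  assumes L: "L > 0" and T: "uniform_mesh L M T" and \<Phi>: "\<Phi> \<in> H2 (\<Omega> L)"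
    and t0: "has_trace (\<Omega> L) (side L 0) \<Phi> (\<lambda>_. c)" and tL: "has_trace (\<Omega> L) (side L L) \<Phi> (\<lambda>_. 0)"
  obtains u where "u \<in> Vhc L T" "u \<in> H1 (\<Omega> L)" "has_trace (\<Omega> L) (side L 0) u (\<lambda>_. c)"
    "(H1_seminorm (\<Omega> L) (\<lambda>x. \<Phi> x - u x))\<^sup>2 \<le> 8 * (L / real M)\<^sup>2 * (H2_norm (\<Omega> L) \<Phi>)\<^sup>2"
proof -
  define h where "h = L / real M"
  have M: "M \<ge> 1"
    using T by (auto simp: uniform_mesh_def)
  have h: "h > 0" and LM: "L = real M * h"
    using L M by (auto simp: h_def)
  note B = Basis_real_prod_mem
  have H: "\<Phi> \<in> H1 (\<Omega> L)" "weak_partial (\<Omega> L) (1, 0) \<Phi> \<in> H1 (\<Omega> L)" "weak_partial (\<Omega> L) (0, 1) \<Phi> \<in> H1 (\<Omega> L)"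
    using \<Phi> B by (auto simp: H2_def)
  have "\<Phi> \<in> borel_measurable (lebesgue_on (\<Omega> L))" and sq: "square_integrable (lebesgue_on (\<Omega> L)) \<Phi>"
    using H(1) by (auto simp: H1_def square_integrable_def)
  then obtain F where F: "borel_rep (\<Omega> L) \<Phi> F"
    using borel_rep_exists[OF square_borel] by blast
  obtain P where P: "borel_rep (\<Omega> L) (weak_partial (\<Omega> L) (1, 0) \<Phi>) P"
    using borel_rep_weak_partial_exists[OF H(1) B(1)] .
  obtain G where G: "borel_rep (\<Omega> L) (weak_partial (\<Omega> L) (0, 1) \<Phi>) G"
    using borel_rep_weak_partial_exists[OF H(1) B(2)] .
  obtain a where a: "borel_rep (\<Omega> L) (weak_partial (\<Omega> L) (1, 0) (weak_partial (\<Omega> L) (1, 0) \<Phi>)) a"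
    using borel_rep_weak_partial_exists[OF H(2) B(1)] .
  obtain q where q: "borel_rep (\<Omega> L) (weak_partial (\<Omega> L) (0, 1) (weak_partial (\<Omega> L) (1, 0) \<Phi>)) q"
    using borel_rep_weak_partial_exists[OF H(2) B(2)] .
  obtain b where b: "borel_rep (\<Omega> L) (weak_partial (\<Omega> L) (0, 1) (weak_partial (\<Omega> L) (0, 1) \<Phi>)) b"
    using borel_rep_weak_partial_exists[OF H(3) B(2)] .
  note Fi = square_integrable_rep(1)[OF sq F]
  note Pi = H1_rep_integrable(1)[OF H(1) B(1) P]
  note Gi = H1_rep_integrable(1)[OF H(1) B(2) G]
  note ai = H1_rep_integrable[OF H(2) B(1) a]
  note qi = H1_rep_integrable[OF H(2) B(2) q]
  note bi = H1_rep_integrable[OF H(3) B(2) b]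
  have [measurable]: "P \<in> borel_measurable borel" "G \<in> borel_measurable borel" "b \<in> borel_measurable borel" "q \<in> borel_measurable borel"
    using Pi Gi bi qi by auto
  obtain p0 where p0: "integrable lborel p0"
    and Pq: "AE p in lborel. p \<in> \<Omega> L \<longrightarrow> P p = p0 (fst p) + segment_int 0 (snd p) (\<lambda>t. q (fst p, t))"
    using weak_partial_snd_representation[OF L Pi qi(1)] H1_rep_bumps(2)[OF H(2) P q B(2)] by blast
  obtain s0 where Pa: "AE p in lborel. p \<in> \<Omega> L \<longrightarrow> P p = s0 (snd p) + segment_int 0 (fst p) (\<lambda>s. a (s, snd p))"
    using weak_partial_fst_representation[OF L Pi ai(1)] H1_rep_bumps(1)[OF H(2) P a B(1)] by blast
  obtain r0 where Gb: "AE p in lborel. p \<in> \<Omega> L \<longrightarrow> G p = r0 (fst p) + segment_int 0 (snd p) (\<lambda>t. b (fst p, t))"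
    using weak_partial_snd_representation[OF L Gi bi(1)] H1_rep_bumps(2)[OF H(3) G b B(2)] by blast
  have F\<Phi>: "AE p in lborel. p \<in> \<Omega> L \<longrightarrow> \<Phi> p = F p"
    using F by (simp add: borel_rep_def)
  have F0: "AE p in lborel. p \<in> \<Omega> L \<longrightarrow> F p = c + segment_int 0 (fst p) (\<lambda>s. P (s, snd p))"
    using has_trace_representation[OF L order_refl less_imp_le[OF L] t0 P] F\<Phi> by eventually_elim simp
  have FL: "AE p in lborel. p \<in> \<Omega> L \<longrightarrow> F p = segment_int L (fst p) (\<lambda>s. P (s, snd p))"
    using has_trace_representation[OF L less_imp_le[OF L] order_refl tL P] F\<Phi> by eventually_elim simp
  have Gq: "AE p in lborel. p \<in> \<Omega> L \<longrightarrow> G p = segment_int 0 (fst p) (\<lambda>s. q (s, snd p))"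
    using mixed_partial_representation[OF Fi Pi Gi qi(1) p0 _ F0 Pq]
      H1_rep_bumps(2)[OF H(1) F G B(2)] by simp
  \<comment> \<open>By \<open>Pq\<close>, \<open>g y\<close> represents the first partial of \<Phi>
    on the horizontal line at height y. It is given by a formula for every y, so its integrals from
    the left side define nodal values without any almost everywhere exception.\<close>
  define g where "g y s = p0 s + segment_int 0 y (\<lambda>t. q (s, t))" for y s
  have gi: "integrable lborel (g y)" for y
    unfolding g_def using p0 integrable_segment_int_param(1)[OF qi(1)] by simp
  have gL: "segment_int 0 L (g y) = - c" if "y \<in> {0..L}" for y
    unfolding g_def
    by (rule two_traces_representation[OF L Pi qi(1) p0 borel_rep_zero[OF P] borel_rep_zero[OF q] F0 FL Pq that])
  define v where "v i j = c + segment_int 0 (real i * h) (g (real j * h))" for i j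
  have v0: "v 0 j = c" for j
    by (simp add: v_def)
  have vM: "v M j = 0" if "j \<le> M" for j
    using gL[of "real j * h"] that h by (simp add: v_def LM[symmetric]) (simp add: LM)
  have vx: "(v (Suc i) j - v i j) / h = edge_mean h p0 q (real i * h) (real j * h)" for i j
  proof -
    have "v (Suc i) j - v i j = (\<integral>s. indicator {real i * h<..<real i * h + h} s * g (real j * h) s \<partial>lborel)"
      using segment_int_interval[OF gi, of "real i * h" "real i * h + h" "real j * h"] h
      by (simp add: v_def algebra_simps)
    then show ?thesis
      by (simp add: edge_mean_def g_def)
  qed
  \<comment> \<open>After the exchange of integrals, \<open>c\<close> and the integral of
    \<open>p0\<close> do not depend on the height and cancel in the difference. What remains has the
    form of an edge mean in exchanged coordinates, with zero in the place of
    \<open>p0\<close>.\<close>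
  have vy: "(v i (Suc j) - v i j) / h = edge_mean h (\<lambda>_. 0) (\<lambda>p. q (prod.swap p)) (real j * h) (real i * h)" for i j
  proof -
    let ?k = "\<lambda>t. segment_int 0 (real i * h) (\<lambda>s. q (s, t))"
    have "v i j = c + segment_int 0 (real i * h) p0 + segment_int 0 (real j * h) ?k" for j
      unfolding v_def g_def
      using segment_int_add[OF p0 integrable_segment_int_param(1)[OF qi(1)]] integrable_segment_int_param(3)[OF qi(1)] by simp
    then have "v i (Suc j) - v i j = (\<integral>t. indicator {real j * h<..<real j * h + h} t * ?k t \<partial>lborel)"
      using segment_int_interval[OF integrable_segment_int_param(2)[OF qi(1)], of "real j * h" "real j * h + h" "real i * h"] h
      by (simp add: algebra_simps)
    then show ?thesis
      by (simp add: edge_mean_def)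
  qed
  obtain u where u: "u \<in> Vhc L T" "u \<in> H1 (\<Omega> L)" "has_trace (\<Omega> L) (side L 0) u (\<lambda>_. c)"
    and slopes: "AE p in lborel. p \<in> \<Omega> L \<longrightarrow> (\<exists>i<M. \<exists>j<M. \<exists>i'\<in>{i, Suc i}. \<exists>j'\<in>{j, Suc j}.
      real i * h < fst p \<and> fst p < (real i + 1) * h \<and> real j * h < snd p \<and> snd p < (real j + 1) * h \<and>
      weak_partial (\<Omega> L) (1, 0) u p = (v (Suc i) j' - v i j') / h \<and>
      weak_partial (\<Omega> L) (0, 1) u p = (v i' (Suc j) - v i' j) / h)"
    using pw_linear_in_Vhc[where v = v and c = c, OF L T v0 vM] unfolding h_def[symmetric] by blast
  obtain wx where wx: "borel_rep (\<Omega> L) (weak_partial (\<Omega> L) (1, 0) u) wx"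
    using borel_rep_weak_partial_exists[OF u(2) B(1)] .
  obtain wy where wy: "borel_rep (\<Omega> L) (weak_partial (\<Omega> L) (0, 1) u) wy"
    using borel_rep_weak_partial_exists[OF u(2) B(2)] .
  have cells: "AE p in lborel. p \<in> \<Omega> L \<longrightarrow> (\<exists>i<M. \<exists>j<M. \<exists>i'\<in>{i, Suc i}. \<exists>j'\<in>{j, Suc j}.
      p \<in> cell h (real i * h) (real j * h) \<and>
      wx p = edge_mean h p0 q (real i * h) (real j' * h) \<and>
      wy p = edge_mean h (\<lambda>_. 0) (\<lambda>p. q (prod.swap p)) (real j * h) (real i' * h))"
  proof -
    have "AE p in lborel. p \<in> \<Omega> L \<longrightarrow> weak_partial (\<Omega> L) (1, 0) u p = wx p" "AE p in lborel. p \<in> \<Omega> L \<longrightarrow> weak_partial (\<Omega> L) (0, 1) u p = wy p"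
      using wx wy by (auto simp: borel_rep_def)
    with slopes show ?thesis
    proof eventually_elim
      case (elim p)
      show ?case
      proof
        assume p: "p \<in> \<Omega> L"
        then obtain i j i' j' where ij: "i < M" "j < M" "i' \<in> {i, Suc i}" "j' \<in> {j, Suc j}"
          and pos: "real i * h < fst p" "fst p < (real i + 1) * h" "real j * h < snd p" "snd p < (real j + 1) * h"
          and w: "weak_partial (\<Omega> L) (1, 0) u p = (v (Suc i) j' - v i j') / h"
            "weak_partial (\<Omega> L) (0, 1) u p = (v i' (Suc j) - v i' j) / h"
          using elim(1) by blast
        have "p \<in> cell h (real i * h) (real j * h)"
          using pos by (simp add: cell_def mem_Times_iff distrib_right)
        moreover have "wx p = edge_mean h p0 q (real i * h) (real j' * h)"
          "wy p = edge_mean h (\<lambda>_. 0) (\<lambda>p. q (prod.swap p)) (real j * h) (real i' * h)"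
          using elim(2,3) p w vx vy by simp_all
        ultimately show "\<exists>i<M. \<exists>j<M. \<exists>i'\<in>{i, Suc i}. \<exists>j'\<in>{j, Suc j}.
          p \<in> cell h (real i * h) (real j * h) \<and>
          wx p = edge_mean h p0 q (real i * h) (real j' * h) \<and>
          wy p = edge_mean h (\<lambda>_. 0) (\<lambda>p. q (prod.swap p)) (real j * h) (real i' * h)"
          using ij by blast
      qed
    qed
  qed
  have swap_square: "prod.swap p \<in> \<Omega> L \<longleftrightarrow> p \<in> \<Omega> L" for p
    by (cases p) (auto simp: \<Omega>_def)
  have ex: "(\<integral>p. (P p - wx p)\<^sup>2 \<partial>lborel) \<le> 4 * h\<^sup>2 * ((\<integral>p. (a p)\<^sup>2 \<partial>lborel) + (\<integral>p. (q p)\<^sup>2 \<partial>lborel))"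
  proof (rule edge_mean_error[OF h LM _ ai(1) qi(1) p0 ai(2) qi(2) Pq Pa _ borel_rep_zero[OF P] borel_rep_zero[OF wx]])
    show "AE p in lborel. p \<in> \<Omega> L \<longrightarrow> (\<exists>i<M. \<exists>j<M. \<exists>j'\<in>{j, Suc j}.
        p \<in> cell h (real i * h) (real j * h) \<and> wx p = edge_mean h p0 q (real i * h) (real j' * h))"
      using cells by eventually_elim blast
  qed simp
  \<comment> \<open>The vertical error is the horizontal one in exchanged coordinates:
    \<open>G\<close> takes the role of \<open>P\<close>, with \<open>b\<close> as its derivative
    along the edges and \<open>q\<close> as its derivative across them.\<close>
  have "(\<integral>p. (G (prod.swap p) - wy (prod.swap p))\<^sup>2 \<partial>lborel)
    \<le> 4 * h\<^sup>2 * ((\<integral>p. (b (prod.swap p))\<^sup>2 \<partial>lborel) + (\<integral>p. (q (prod.swap p))\<^sup>2 \<partial>lborel))"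
  proof (rule edge_mean_error[OF h LM])
    show "AE p in lborel. p \<in> \<Omega> L \<longrightarrow> G (prod.swap p) = 0 + segment_int 0 (snd p) (\<lambda>t. q (prod.swap (fst p, t)))"
      using AE_lborel_swapI[OF Gq] by eventually_elim (simp add: swap_square)
    show "AE p in lborel. p \<in> \<Omega> L \<longrightarrow> G (prod.swap p) = r0 (snd p) + segment_int 0 (fst p) (\<lambda>s. b (prod.swap (s, snd p)))"
      using AE_lborel_swapI[OF Gb] by eventually_elim (simp add: swap_square)
    show "AE p in lborel. p \<in> \<Omega> L \<longrightarrow> (\<exists>i<M. \<exists>j<M. \<exists>j'\<in>{j, Suc j}.
        p \<in> cell h (real i * h) (real j * h) \<and> wy (prod.swap p) = edge_mean h (\<lambda>_. 0) (\<lambda>p. q (prod.swap p)) (real i * h) (real j' * h))"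
      using AE_lborel_swapI[OF cells]
    proof eventually_elim
      case (elim p)
      show ?case
      proof
        assume "p \<in> \<Omega> L"
        then obtain i j i' where "i < M" "j < M" "i' \<in> {i, Suc i}" "prod.swap p \<in> cell h (real i * h) (real j * h)"
          "wy (prod.swap p) = edge_mean h (\<lambda>_. 0) (\<lambda>p. q (prod.swap p)) (real j * h) (real i' * h)"
          using elim swap_square by blast
        moreover from this have "p \<in> cell h (real j * h) (real i * h)"
          by (cases p) (simp add: cell_def)
        ultimately show "\<exists>i<M. \<exists>j<M. \<exists>j'\<in>{j, Suc j}. p \<in> cell h (real i * h) (real j * h) \<and>
            wy (prod.swap p) = edge_mean h (\<lambda>_. 0) (\<lambda>p. q (prod.swap p)) (real i * h) (real j' * h)"
          by blast
      qed
    qed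
    show "integrable lborel (\<lambda>p. b (prod.swap p))" "integrable lborel (\<lambda>p. q (prod.swap p))"
      using bi(1) qi(1) by (simp_all add: lborel_swap(2))
    show "integrable lborel (\<lambda>p. (b (prod.swap p))\<^sup>2)" "integrable lborel (\<lambda>p. (q (prod.swap p))\<^sup>2)"
      using bi(2) qi(2) lborel_swap(2)[of "\<lambda>p. (b p)\<^sup>2"] lborel_swap(2)[of "\<lambda>p. (q p)\<^sup>2"] by simp_all
    show "G (prod.swap p) = 0" "wy (prod.swap p) = 0" if "p \<notin> \<Omega> L" for p
      using borel_rep_zero[OF G] borel_rep_zero[OF wy] that swap_square by blast+
  qed simp_all
  moreover have "wy \<in> borel_measurable borel"
    using wy by (simp add: borel_rep_def)
  ultimately have ey: "(\<integral>p. (G p - wy p)\<^sup>2 \<partial>lborel) \<le> 4 * h\<^sup>2 * ((\<integral>p. (b p)\<^sup>2 \<partial>lborel) + (\<integral>p. (q p)\<^sup>2 \<partial>lborel))"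
    using lborel_swap(1)[of "\<lambda>p. (G p - wy p)\<^sup>2"] lborel_swap(1)[of "\<lambda>p. (b p)\<^sup>2"] lborel_swap(1)[of "\<lambda>p. (q p)\<^sup>2"] by simp
  have "(H1_seminorm (\<Omega> L) (\<lambda>x. \<Phi> x - u x))\<^sup>2 = (\<integral>p. (P p - wx p)\<^sup>2 \<partial>lborel) + (\<integral>p. (G p - wy p)\<^sup>2 \<partial>lborel)"
    unfolding H1_seminorm_sq[OF H1_diff(1)[OF H(1) u(2)]] H1_diff_rep[OF H(1) u(2) B(1) P wx] H1_diff_rep[OF H(1) u(2) B(2) G wy] ..
  also have "\<dots> \<le> 4 * h\<^sup>2 * ((\<integral>p. (a p)\<^sup>2 \<partial>lborel) + 2 * (\<integral>p. (q p)\<^sup>2 \<partial>lborel) + (\<integral>p. (b p)\<^sup>2 \<partial>lborel))"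
    using ex ey by (simp add: algebra_simps)
  \<comment> \<open>Both components of the error involve \<open>q\<close>, which is identified only
    as part of the gradient of the first partial. That seminorm contains a^2 + q^2 once, and the
    factor 2 absorbs the second copy of q^2.\<close>
  also have "\<dots> \<le> 4 * h\<^sup>2 * (2 * (H2_norm (\<Omega> L) \<Phi>)\<^sup>2)"
  proof (intro mult_left_mono)
    have 1: "(H1_seminorm (\<Omega> L) (weak_partial (\<Omega> L) (1, 0) \<Phi>))\<^sup>2 = (\<integral>p. (a p)\<^sup>2 \<partial>lborel) + (\<integral>p. (q p)\<^sup>2 \<partial>lborel)"
      unfolding H1_seminorm_sq[OF H(2)] borel_rep_integral(1)[OF square_borel borel_rep_power2[OF a]]
        borel_rep_integral(1)[OF square_borel borel_rep_power2[OF q]] ..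
    have 2: "(\<integral>p. (b p)\<^sup>2 \<partial>lborel) \<le> (H1_seminorm (\<Omega> L) (weak_partial (\<Omega> L) (0, 1) \<Phi>))\<^sup>2"
      unfolding H1_seminorm_sq[OF H(3)] borel_rep_integral(1)[OF square_borel borel_rep_power2[OF b]] by simp
    have "(H2_norm (\<Omega> L) \<Phi>)\<^sup>2 = (H1_norm (\<Omega> L) \<Phi>)\<^sup>2 + (H1_seminorm (\<Omega> L) (weak_partial (\<Omega> L) (1, 0) \<Phi>))\<^sup>2
        + (H1_seminorm (\<Omega> L) (weak_partial (\<Omega> L) (0, 1) \<Phi>))\<^sup>2"
      by (simp add: H2_norm_def Basis_real_prod)
    moreover have "0 \<le> (\<integral>p. (a p)\<^sup>2 \<partial>lborel)" "0 \<le> (\<integral>p. (b p)\<^sup>2 \<partial>lborel)" "0 \<le> (H1_norm (\<Omega> L) \<Phi>)\<^sup>2"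
      by simp_all
    ultimately show "(\<integral>p. (a p)\<^sup>2 \<partial>lborel) + 2 * (\<integral>p. (q p)\<^sup>2 \<partial>lborel) + (\<integral>p. (b p)\<^sup>2 \<partial>lborel) \<le> 2 * (H2_norm (\<Omega> L) \<Phi>)\<^sup>2"
      using 1 2 by linarith
  qed simp
  finally have "(H1_seminorm (\<Omega> L) (\<lambda>x. \<Phi> x - u x))\<^sup>2 \<le> 8 * (L / real M)\<^sup>2 * (H2_norm (\<Omega> L) \<Phi>)\<^sup>2"
    by (simp add: h_def)
  with u show ?thesis
    using that by blast
qed

section \<open>Quasi-optimality\<close>

text \<open>The chosen traces are equal to the constants almost everywhere by uniqueness. The
  resulting factor \<open>L\<close> cancels against the length of the side in the bilinear
  form.\<close>

lemma boundary_form_eq: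
  assumes L: "L > 0" and u: "has_trace (\<Omega> L) (side L 0) u (\<lambda>_. c)" and v: "has_trace (\<Omega> L) (side L 0) v (\<lambda>_. d)"
  shows "(LINT x|ds\<^sub>1 L. boundary_trace (\<Omega> L) (ds\<^sub>1 L) u x * boundary_trace (\<Omega> L) (ds\<^sub>1 L) v x) = L * (c * d)"
proof -
  have t: "has_trace (\<Omega> L) (side L 0) w (boundary_trace (\<Omega> L) (side L 0) w)"
    and ae: "AE y in lborel. y \<in> {0<..<L} \<longrightarrow> boundary_trace (\<Omega> L) (side L 0) w (0, y) = k"
    if w: "has_trace (\<Omega> L) (side L 0) w (\<lambda>_. k)" for w k
  proof -
    show t: "has_trace (\<Omega> L) (side L 0) w (boundary_trace (\<Omega> L) (side L 0) w)"
      unfolding boundary_trace_def by (rule someI[where P = "has_trace (\<Omega> L) (side L 0) w", OF w])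
    show "AE y in lborel. y \<in> {0<..<L} \<longrightarrow> boundary_trace (\<Omega> L) (side L 0) w (0, y) = k"
      using has_trace_unique[OF L _ _ t w] L by simp
  qed
  have m: "boundary_trace (\<Omega> L) (side L 0) u \<in> borel_measurable (side L 0)" "boundary_trace (\<Omega> L) (side L 0) v \<in> borel_measurable (side L 0)"
    using t[OF u] t[OF v] by (auto simp: has_trace_def square_integrable_def)
  note S = side_integral[OF borel_measurable_times[OF m]]
  have "(\<integral>y. indicator {0..L} y * (boundary_trace (\<Omega> L) (side L 0) u (0, y) * boundary_trace (\<Omega> L) (side L 0) v (0, y)) \<partial>lborel)
    = (\<integral>y. indicator {0..L} y * (c * d) \<partial>lborel)"
  proof (rule integral_cong_AE)
    show "AE y in lborel. indicator {0..L} y * (boundary_trace (\<Omega> L) (side L 0) u (0, y) * boundary_trace (\<Omega> L) (side L 0) v (0, y))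
        = indicator {0..L} y * (c * d)"
      using ae[OF u] ae[OF v] AE_lborel_singleton[of 0] AE_lborel_singleton[of L]
      by eventually_elim (auto simp: indicator_def)
  qed (use S(1) in simp_all)
  then show ?thesis
    using S(2) L by (simp add: ds_eq_side(1)[OF L])
qed

lemma weak_grad_diff_AE:
  assumes "u \<in> H1 (\<Omega> L)" "v \<in> H1 (\<Omega> L)"
  shows "AE p in lebesgue_on (\<Omega> L). weak_grad (\<Omega> L) (\<lambda>x. u x - v x) p = weak_grad (\<Omega> L) u p - weak_grad (\<Omega> L) v p"
  using H1_diff(2)[OF assms Basis_real_prod_mem(1)] H1_diff(2)[OF assms Basis_real_prod_mem(2)]
  by eventually_elim (simp add: weak_grad_def Basis_real_prod)

lemma integrable_weak_grad_inner:
  assumes u: "u \<in> H1 (\<Omega> L)" and v: "v \<in> H1 (\<Omega> L)"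
    and \<sigma>: "\<sigma> \<in> borel_measurable (lebesgue_on (\<Omega> L))" "\<And>x. x \<in> \<Omega> L \<Longrightarrow> \<bar>\<sigma> x\<bar> \<le> C"
  shows "integrable (lebesgue_on (\<Omega> L)) (\<lambda>p. \<sigma> p * (weak_grad (\<Omega> L) u p \<bullet> weak_grad (\<Omega> L) v p))"
proof -
  have i: "integrable (lebesgue_on (\<Omega> L)) (\<lambda>p. weak_grad (\<Omega> L) u p \<bullet> weak_grad (\<Omega> L) v p)"
    unfolding inner_weak_grad using Basis_real_prod_mem
    by (intro Bochner_Integration.integrable_add square_integrable_mult H1_D u v)
  show ?thesis
  proof (rule Bochner_Integration.integrable_bound)
    show "integrable (lebesgue_on (\<Omega> L)) (\<lambda>p. C * (weak_grad (\<Omega> L) u p \<bullet> weak_grad (\<Omega> L) v p))"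
      using i by simp
    show "(\<lambda>p. \<sigma> p * (weak_grad (\<Omega> L) u p \<bullet> weak_grad (\<Omega> L) v p)) \<in> borel_measurable (lebesgue_on (\<Omega> L))"
      using \<sigma>(1) borel_measurable_integrable[OF i] by (rule borel_measurable_times)
    show "AE p in lebesgue_on (\<Omega> L). norm (\<sigma> p * (weak_grad (\<Omega> L) u p \<bullet> weak_grad (\<Omega> L) v p))
        \<le> norm (C * (weak_grad (\<Omega> L) u p \<bullet> weak_grad (\<Omega> L) v p))"
    proof (rule AE_I2)
      fix p assume "p \<in> space (lebesgue_on (\<Omega> L))"
      then have "\<bar>\<sigma> p\<bar> \<le> \<bar>C\<bar>"
        using \<sigma>(2)[of p] by simp
      then show "norm (\<sigma> p * (weak_grad (\<Omega> L) u p \<bullet> weak_grad (\<Omega> L) v p))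
        \<le> norm (C * (weak_grad (\<Omega> L) u p \<bullet> weak_grad (\<Omega> L) v p))"
        by (simp add: abs_mult mult_right_mono)
    qed
  qed
qed

text \<open>The boundary terms only help: testing with the interpolant and with the discrete solution, they
  contribute the square of the difference of the two constants on the left side, with the good sign.\<close>

lemma quasi_optimality:
  fixes L R \<sigma>m \<sigma>M :: real
  assumes L: "L > 0" and R: "R > 0" and \<sigma>m: "\<sigma>m > 0" and \<sigma>M: "\<sigma>M > 0"
    and \<sigma>: "\<sigma> \<in> borel_measurable (lebesgue_on (closure (\<Omega> L)))"
    and bounds: "\<And>x. x \<in> closure (\<Omega> L) \<Longrightarrow> \<sigma>m \<le> \<sigma> x \<and> \<sigma> x \<le> \<sigma>M"
    and \<Phi>: "solves_in (Vc L) L R \<sigma> U f \<Phi>" and \<Phi>h: "solves_in (Vhc L T) L R \<sigma> U f \<Phi>h"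
    and u: "u \<in> Vhc L T" and t\<Phi>: "has_trace (\<Omega> L) (side L 0) \<Phi> (\<lambda>_. c)" and tu: "has_trace (\<Omega> L) (side L 0) u (\<lambda>_. c)"
  shows "H1_seminorm (\<Omega> L) (\<lambda>x. \<Phi> x - \<Phi>h x) \<le> \<sigma>M / \<sigma>m * H1_seminorm (\<Omega> L) (\<lambda>x. \<Phi> x - u x)"
proof -
  let ?M = "lebesgue_on (\<Omega> L)"
  let ?g = "weak_grad (\<Omega> L)"
  have V: "\<Phi> \<in> Vc L" "\<Phi>h \<in> Vhc L T" "\<Phi>h \<in> Vc L" "u \<in> Vc L"
    using \<Phi> \<Phi>h u by (auto simp: solves_in_def Vhc_def)
  then have H: "\<Phi> \<in> H1 (\<Omega> L)" "\<Phi>h \<in> H1 (\<Omega> L)" "u \<in> H1 (\<Omega> L)"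
    by (auto simp: Vc_def)
  obtain d where td: "has_trace (\<Omega> L) (side L 0) \<Phi>h (\<lambda>_. d)"
    using V(3) ds_eq_side[OF L] by (auto simp: Vc_def)
  have sub: "\<Omega> L \<subseteq> closure (\<Omega> L)"
    by (rule closure_subset)
  have \<sigma>': "\<sigma> \<in> borel_measurable ?M" "\<And>x. x \<in> \<Omega> L \<Longrightarrow> \<bar>\<sigma> x\<bar> \<le> \<sigma>M"
    using measurable_restrict_mono[OF \<sigma> sub] bounds sub \<sigma>m by fastforce+
  note int = integrable_weak_grad_inner[OF _ _ \<sigma>']
  define D where "D v w = (LINT x|?M. \<sigma> x * (?g v x \<bullet> ?g w x))" for v w
  have form: "bilinear_form L R \<sigma> v w = D v w + k * l / R"
    if "has_trace (\<Omega> L) (side L 0) v (\<lambda>_. k)" "has_trace (\<Omega> L) (side L 0) w (\<lambda>_. l)" for v w k l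
    unfolding bilinear_form_def D_def boundary_form_eq[OF L that] using L R by (simp add: length\<^sub>1_eq)
  have "bilinear_form L R \<sigma> \<Phi> w = bilinear_form L R \<sigma> \<Phi>h w" if "w \<in> Vhc L T" for w
    using \<Phi> \<Phi>h that by (auto simp: solves_in_def Vhc_def)
  from this[OF u] this[OF V(2)]
  \<comment> \<open>Galerkin orthogonality is kept as two separate identities, for the interpolant
    and for the discrete solution as test functions, so only functions known to lie in
    \<open>Vhc\<close> are tested.\<close>
  have orth: "D \<Phi> u + c * c / R = D \<Phi>h u + d * c / R" "D \<Phi> \<Phi>h + c * d / R = D \<Phi>h \<Phi>h + d * d / R"
    by (simp_all add: form[OF t\<Phi> tu] form[OF td tu] form[OF t\<Phi> td] form[OF td td])
  define E where "E = ?g (\<lambda>x. \<Phi> x - \<Phi>h x)"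
  define W where "W = ?g (\<lambda>x. \<Phi> x - u x)"
  note HE = H1_diff(1)[OF H(1,2)] and HW = H1_diff(1)[OF H(1,3)]
  have iEE: "integrable ?M (\<lambda>x. \<sigma> x * (E x \<bullet> E x))" and iEW: "integrable ?M (\<lambda>x. \<sigma> x * (E x \<bullet> W x))"
    using int[OF HE HE] int[OF HE HW] by (simp_all only: E_def W_def)
  have one: "integrable ?M (\<lambda>x. 1 * (?g v x \<bullet> ?g v x))" if "v \<in> H1 (\<Omega> L)" for v
    by (rule integrable_weak_grad_inner[OF that that, where C = 1]) auto
  have iE: "integrable ?M (\<lambda>x. (norm (E x))\<^sup>2)" and iW: "integrable ?M (\<lambda>x. (norm (W x))\<^sup>2)"
    using one[OF HE] one[OF HW] by (simp_all add: E_def W_def power2_norm_eq_inner)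
  have "(LINT x|?M. \<sigma> x * (E x \<bullet> E x)) - (LINT x|?M. \<sigma> x * (E x \<bullet> W x))
    = (LINT x|?M. \<sigma> x * (E x \<bullet> E x) - \<sigma> x * (E x \<bullet> W x))"
    using iEE iEW by simp
  \<comment> \<open>E - W is the gradient of \<open>u\<close> - \<open>\<Phi>h\<close>, so the
    integrand is the error paired with a discrete function; expanding it gives the four terms of the
    two identities.\<close>
  also have "\<dots> = (LINT x|?M. \<sigma> x * (?g \<Phi> x \<bullet> ?g u x) - \<sigma> x * (?g \<Phi> x \<bullet> ?g \<Phi>h x)
      - (\<sigma> x * (?g \<Phi>h x \<bullet> ?g u x) - \<sigma> x * (?g \<Phi>h x \<bullet> ?g \<Phi>h x)))"
  proof (rule integral_cong_AE)
    show "AE x in ?M. \<sigma> x * (E x \<bullet> E x) - \<sigma> x * (E x \<bullet> W x) = \<sigma> x * (?g \<Phi> x \<bullet> ?g u x) - \<sigma> x * (?g \<Phi> x \<bullet> ?g \<Phi>h x)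
      - (\<sigma> x * (?g \<Phi>h x \<bullet> ?g u x) - \<sigma> x * (?g \<Phi>h x \<bullet> ?g \<Phi>h x))"
      using weak_grad_diff_AE[OF H(1,2)] weak_grad_diff_AE[OF H(1,3)]
      unfolding E_def W_def
      by eventually_elim (simp add: inner_diff_left inner_diff_right right_diff_distrib distrib_left inner_commute)
  qed (use iEE iEW int H in \<open>auto intro!: borel_measurable_integrable\<close>)
  also have "\<dots> = D \<Phi> u - D \<Phi> \<Phi>h - (D \<Phi>h u - D \<Phi>h \<Phi>h)"
    unfolding D_def using int H by simp
  also have "\<dots> = - ((c - d)\<^sup>2 / R)"
  proof -
    have "(c - d)\<^sup>2 / R = c * c / R + d * d / R - 2 * (c * d / R)"
      using R by (simp add: power2_eq_square field_simps)
    then show ?thesis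
      using orth by (simp add: mult.commute[of d c])
  qed
  also have "\<dots> \<le> 0"
    using R by simp
  finally have 1: "(LINT x|?M. \<sigma> x * (E x \<bullet> E x)) \<le> (LINT x|?M. \<sigma> x * (E x \<bullet> W x))"
    by simp
  have "(LINT x|?M. \<sigma>m * (norm (E x))\<^sup>2) \<le> (LINT x|?M. \<sigma> x * (E x \<bullet> E x))"
  proof (rule integral_mono[OF _ iEE])
    show "integrable ?M (\<lambda>x. \<sigma>m * (norm (E x))\<^sup>2)"
      using iE by simp
    show "\<sigma>m * (norm (E x))\<^sup>2 \<le> \<sigma> x * (E x \<bullet> E x)" if "x \<in> space ?M" for x
      using bounds[of x] sub that by (auto simp: power2_norm_eq_inner intro!: mult_right_mono)
  qed
  also note 1
  \<comment> \<open>Young's inequality, weighted so that exactly half of the lower bound \<sigma>m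
    |E|^2 is absorbed on the left. The final factor is then (\<sigma>M / \<sigma>m)^2 for the
    squared seminorms.\<close>
  also have "(LINT x|?M. \<sigma> x * (E x \<bullet> W x)) \<le> (LINT x|?M. \<sigma>m / 2 * (norm (E x))\<^sup>2 + \<sigma>M\<^sup>2 / (2 * \<sigma>m) * (norm (W x))\<^sup>2)"
  proof (rule integral_mono[OF iEW])
    show "integrable ?M (\<lambda>x. \<sigma>m / 2 * (norm (E x))\<^sup>2 + \<sigma>M\<^sup>2 / (2 * \<sigma>m) * (norm (W x))\<^sup>2)"
      using iE iW by simp
    show "\<sigma> x * (E x \<bullet> W x) \<le> \<sigma>m / 2 * (norm (E x))\<^sup>2 + \<sigma>M\<^sup>2 / (2 * \<sigma>m) * (norm (W x))\<^sup>2" if "x \<in> space ?M" for x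
    proof -
      have "\<sigma> x * (E x \<bullet> W x) \<le> \<bar>\<sigma> x\<bar> * \<bar>E x \<bullet> W x\<bar>"
        by (metis abs_ge_self abs_mult)
      also have "\<dots> \<le> \<sigma>M * (norm (E x) * norm (W x))"
        using \<sigma>'(2)[of x] that \<sigma>M by (intro mult_mono Cauchy_Schwarz_ineq2) auto
      also have "\<dots> \<le> \<sigma>m / 2 * (norm (E x))\<^sup>2 + \<sigma>M\<^sup>2 / (2 * \<sigma>m) * (norm (W x))\<^sup>2"
      proof -
        have "0 \<le> (\<sigma>m * norm (E x) - \<sigma>M * norm (W x))\<^sup>2 / (2 * \<sigma>m)"
          using \<sigma>m by simp
        also have "\<dots> = \<sigma>m / 2 * (norm (E x))\<^sup>2 + \<sigma>M\<^sup>2 / (2 * \<sigma>m) * (norm (W x))\<^sup>2 - \<sigma>M * (norm (E x) * norm (W x))"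
          using \<sigma>m by (simp add: power2_eq_square field_simps)
        finally show ?thesis
          by simp
      qed
      finally show ?thesis .
    qed
  qed
  also have "\<dots> = \<sigma>m / 2 * (LINT x|?M. (norm (E x))\<^sup>2) + \<sigma>M\<^sup>2 / (2 * \<sigma>m) * (LINT x|?M. (norm (W x))\<^sup>2)"
    using iE iW by simp
  finally have "\<sigma>m / 2 * (LINT x|?M. (norm (E x))\<^sup>2) \<le> \<sigma>M\<^sup>2 / (2 * \<sigma>m) * (LINT x|?M. (norm (W x))\<^sup>2)"
    by simp
  then have "(LINT x|?M. (norm (E x))\<^sup>2) \<le> (\<sigma>M / \<sigma>m)\<^sup>2 * (LINT x|?M. (norm (W x))\<^sup>2)"
    using \<sigma>m by (simp add: field_simps power2_eq_square)
  then have "(H1_seminorm (\<Omega> L) (\<lambda>x. \<Phi> x - \<Phi>h x))\<^sup>2 \<le> (\<sigma>M / \<sigma>m * H1_seminorm (\<Omega> L) (\<lambda>x. \<Phi> x - u x))\<^sup>2"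
    by (simp only: power_mult_distrib H1_seminorm_def L2_norm_sq E_def W_def)
  then show ?thesis
    by (rule power2_le_imp_le) (use \<sigma>m \<sigma>M in \<open>simp add: H1_seminorm_def L2_norm_nonneg\<close>)
qed

theorem theorem2:
  fixes L R \<sigma>m \<sigma>M :: real and \<sigma> :: "real \<times> real \<Rightarrow> real"
  assumes "L > 0" and "R > 0" and "\<sigma>m > 0" and "\<sigma>M > 0"
    and "\<sigma> \<in> borel_measurable (lebesgue_on (closure (\<Omega> L)))"
    and "\<And>x. x \<in> closure (\<Omega> L) \<Longrightarrow> \<sigma>m \<le> \<sigma> x \<and> \<sigma> x \<le> \<sigma>M"
  shows
    "(\<exists>C>0. \<forall>U f M T \<Phi> \<Phi>h.
        square_integrable (lebesgue_on (\<Omega> L)) f \<longrightarrow>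
        uniform_mesh L M T \<longrightarrow>
        solves_in (Vc L) L R \<sigma> U f \<Phi> \<longrightarrow>
        solves_in (Vhc L T) L R \<sigma> U f \<Phi>h \<longrightarrow>
        \<Phi> \<in> H2 (\<Omega> L) \<longrightarrow>
        H1_seminorm (\<Omega> L) (\<lambda>x. \<Phi> x - \<Phi>h x) \<le> C * (L / real M) * H2_norm (\<Omega> L) \<Phi>)
     \<and>
     (\<forall>Creg. \<exists>C'>0. \<forall>U f M T \<Phi> \<Phi>h.
        square_integrable (lebesgue_on (\<Omega> L)) f \<longrightarrow>
        uniform_mesh L M T \<longrightarrow>
        solves_in (Vc L) L R \<sigma> U f \<Phi> \<longrightarrow>
        solves_in (Vhc L T) L R \<sigma> U f \<Phi>h \<longrightarrow>
        \<Phi> \<in> H2 (\<Omega> L) \<longrightarrow>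
        H2_norm (\<Omega> L) \<Phi> \<le> Creg * L2_norm (lebesgue_on (\<Omega> L)) f \<longrightarrow>
        H1_seminorm (\<Omega> L) (\<lambda>x. \<Phi> x - \<Phi>h x)
          \<le> C' * (L / real M) * L2_norm (lebesgue_on (\<Omega> L)) f)"
proof -
  \<comment> \<open>The factor 3 replaces the square root of the 8 in
    \<open>interpolation_error\<close>; the quotient is the quasi-optimality constant.\<close>
  define C where "C = \<sigma>M / \<sigma>m * 3"
  have C: "C > 0"
    using assms(3,4) by (simp add: C_def)
  have main: "H1_seminorm (\<Omega> L) (\<lambda>x. \<Phi> x - \<Phi>h x) \<le> C * (L / real M) * H2_norm (\<Omega> L) \<Phi>"
    if T: "uniform_mesh L M T" and \<Phi>: "solves_in (Vc L) L R \<sigma> U f \<Phi>" and \<Phi>h: "solves_in (Vhc L T) L R \<sigma> U f \<Phi>h"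
      and H2: "\<Phi> \<in> H2 (\<Omega> L)" for U f M T \<Phi> \<Phi>h
  proof -
    obtain c where t0: "has_trace (\<Omega> L) (side L 0) \<Phi> (\<lambda>_. c)" and tL: "has_trace (\<Omega> L) (side L L) \<Phi> (\<lambda>_. 0)"
      using \<Phi> by (auto simp: solves_in_def Vc_def ds_eq_side[OF assms(1)])
    obtain u where u: "u \<in> Vhc L T" "has_trace (\<Omega> L) (side L 0) u (\<lambda>_. c)"
      and err: "(H1_seminorm (\<Omega> L) (\<lambda>x. \<Phi> x - u x))\<^sup>2 \<le> 8 * (L / real M)\<^sup>2 * (H2_norm (\<Omega> L) \<Phi>)\<^sup>2"
      using interpolation_error[OF assms(1) T H2 t0 tL] by blast
    have "H2_norm (\<Omega> L) \<Phi> \<ge> 0"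
      by (auto simp: H2_norm_def intro!: add_nonneg_nonneg sum_nonneg)
    moreover have "8 * (L / real M)\<^sup>2 * (H2_norm (\<Omega> L) \<Phi>)\<^sup>2 \<le> (3 * (L / real M) * H2_norm (\<Omega> L) \<Phi>)\<^sup>2"
    proof -
      have "(3 * (L / real M) * H2_norm (\<Omega> L) \<Phi>)\<^sup>2 = 9 * ((L / real M)\<^sup>2 * (H2_norm (\<Omega> L) \<Phi>)\<^sup>2)"
        unfolding power_mult_distrib by simp
      moreover have "0 \<le> (L / real M)\<^sup>2 * (H2_norm (\<Omega> L) \<Phi>)\<^sup>2"
        by simp
      ultimately show ?thesis
        by linarith
    qed
    ultimately have "H1_seminorm (\<Omega> L) (\<lambda>x. \<Phi> x - u x) \<le> 3 * (L / real M) * H2_norm (\<Omega> L) \<Phi>"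
      using err assms(1) by (intro power2_le_imp_le[OF order_trans[OF err]]) simp_all
    then have "\<sigma>M / \<sigma>m * H1_seminorm (\<Omega> L) (\<lambda>x. \<Phi> x - u x) \<le> \<sigma>M / \<sigma>m * (3 * (L / real M) * H2_norm (\<Omega> L) \<Phi>)"
      using assms(3,4) by (intro mult_left_mono) auto
    with quasi_optimality[OF assms \<Phi> \<Phi>h u(1) t0 u(2)] show ?thesis
      by (simp add: C_def mult.assoc)
  qed
  \<comment> \<open>\<open>Creg\<close> may be any real number; |\<open>Creg\<close>| + 1 dominates
    it and keeps the constant positive.\<close>
  have "H1_seminorm (\<Omega> L) (\<lambda>x. \<Phi> x - \<Phi>h x) \<le> C * (\<bar>Creg\<bar> + 1) * (L / real M) * L2_norm (lebesgue_on (\<Omega> L)) f"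
    if "uniform_mesh L M T" "solves_in (Vc L) L R \<sigma> U f \<Phi>" "solves_in (Vhc L T) L R \<sigma> U f \<Phi>h"
      "\<Phi> \<in> H2 (\<Omega> L)" and reg: "H2_norm (\<Omega> L) \<Phi> \<le> Creg * L2_norm (lebesgue_on (\<Omega> L)) f" for U f M T \<Phi> \<Phi>h Creg
  proof -
    have "Creg * L2_norm (lebesgue_on (\<Omega> L)) f \<le> (\<bar>Creg\<bar> + 1) * L2_norm (lebesgue_on (\<Omega> L)) f"
      by (intro mult_right_mono L2_norm_nonneg) auto
    with reg have "H2_norm (\<Omega> L) \<Phi> \<le> (\<bar>Creg\<bar> + 1) * L2_norm (lebesgue_on (\<Omega> L)) f"
      by simp
    then have "C * (L / real M) * H2_norm (\<Omega> L) \<Phi> \<le> C * (L / real M) * ((\<bar>Creg\<bar> + 1) * L2_norm (lebesgue_on (\<Omega> L)) f)"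
      using C assms(1) by (intro mult_left_mono) auto
    with main[OF that(1-4)] show ?thesis
      by (simp add: mult.assoc mult.left_commute)
  qed
  moreover have "C * (\<bar>Creg\<bar> + 1) > 0" for Creg
    using C by (intro mult_pos_pos) auto
  ultimately show ?thesis
    using main C by blast
qed

end
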